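(* MISP restricted to 7-snake-free tournaments is NP-complete.
   Context: The 7-snake is the tournament on vertices $v_1,\dots,v_7$ with $v_{i+1}\to v_i$ for all $i\in\{1,\dots,6\}$ and $v_i\to v_j$ whenever $j\ge i+2$ (equivalently, its backedge graph under the ordering $(v_1,\dots,v_7)$ is the path $v_1v_2\cdots v_7$). A tournament is 7-snake-free if no induced subtournament is isomorphic to the 7-snake. A set of vertices is independent if it induces a transitive (acyclic) subtournament. MISP (decision version): given a tournament $G$ and a positive integer $k$, decide whether $G$ has an independent set of size at least $k$. *)

theory Defs
  imports "HOL-Computational_Algebra.Polynomial"
begin

section \<open>Tournaments\<close>

definition tournament :: "'a set \<Rightarrow> 'a rel \<Rightarrow> bool" where
  "tournament V E \<longleftrightarrow> finite V \<and> E \<subseteq> V \<times> V \<and> irrefl E \<and>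
     (\<forall>u\<in>V. \<forall>v\<in>V. u \<noteq> v \<longrightarrow> ((u, v) \<in> E \<longleftrightarrow> (v, u) \<notin> E))"

definition induced :: "'a rel \<Rightarrow> 'a set \<Rightarrow> 'a rel" where
  "induced E S = E \<inter> S \<times> S"

definition digraph_isomorphic :: "'a set \<Rightarrow> 'a rel \<Rightarrow> 'b set \<Rightarrow> 'b rel \<Rightarrow> bool" where
  "digraph_isomorphic V E W F \<longleftrightarrow>
     (\<exists>f. bij_betw f V W \<and> (\<forall>u\<in>V. \<forall>v\<in>V. (u, v) \<in> E \<longleftrightarrow> (f u, f v) \<in> F))"

definition snake7_verts :: "nat set" where
  "snake7_verts = {1..7}"

definition snake7_arcs :: "nat rel" where
  "snake7_arcs = {(i + 1, i) | i. i \<in> {1..6}} \<union>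
     {(i, j). i \<in> {1..7} \<and> j \<in> {1..7} \<and> j \<ge> i + 2}"

definition snake7_free :: "'a set \<Rightarrow> 'a rel \<Rightarrow> bool" where
  "snake7_free V E \<longleftrightarrow>
     \<not> (\<exists>S\<subseteq>V. digraph_isomorphic S (induced E S) snake7_verts snake7_arcs)"

definition independent_set :: "'a set \<Rightarrow> 'a rel \<Rightarrow> 'a set \<Rightarrow> bool" where
  "independent_set V E S \<longleftrightarrow> S \<subseteq> V \<and> trans (induced E S)"

lemma tournament_snake7: "tournament snake7_verts snake7_arcs"
  unfolding tournament_def snake7_verts_def snake7_arcs_def irrefl_def by auto

lemma independent_set_iff_acyclic:
  assumes "tournament V E" "S \<subseteq> V"
  shows "independent_set V E S \<longleftrightarrow> acyclic (induced E S)"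
proof
  assume "independent_set V E S"
  then have "trans (induced E S)" by (simp add: independent_set_def)
  then show "acyclic (induced E S)"
    using assms by (auto simp: acyclic_def trancl_id induced_def tournament_def irrefl_def)
next
  assume ac: "acyclic (induced E S)"
  have "trans (induced E S)"
  proof (rule transI)
    fix x y z assume xy: "(x, y) \<in> induced E S" and yz: "(y, z) \<in> induced E S"
    have "(x, z) \<in> (induced E S)\<^sup>+" using xy yz by auto
    then have "x \<noteq> z" "(z, x) \<notin> induced E S"
      using ac by (auto simp: acyclic_def dest: trancl_into_trancl)
    then show "(x, z) \<in> induced E S"
      using assms xy yz unfolding induced_def tournament_def by blast
  qed
  then show "independent_set V E S" using assms by (simp add: independent_set_def)
qed


section \<open>Deterministic multi-tape Turing machines\<close>

text \<open>States and tape symbols are initial segments of the naturals. Symbol 0 is the blank, 1 and 2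
  are the bits, 3 is a separator; a machine may have further symbols. Tapes are infinite in both
  directions. The first tape is the input tape and the last one the output tape (they coincide on
  a one-tape machine).\<close>

datatype move = MoveLeft | NoMove | MoveRight

fun shift :: "move \<Rightarrow> int" where
  "shift MoveLeft = -1"
| "shift NoMove = 0"
| "shift MoveRight = 1"

record tm =
  num_tapes :: nat
  num_states :: nat
  num_syms :: nat
  start_state :: nat
  halt_state :: nat
  transition :: "nat \<Rightarrow> nat list \<Rightarrow> nat \<times> (nat \<times> move) list"

definition wf_tm :: "tm \<Rightarrow> bool" where
  "wf_tm M \<longleftrightarrow> num_tapes M \<ge> 1 \<and> num_syms M \<ge> 4 \<and>
     start_state M < num_states M \<and> halt_state M < num_states M \<and>
     (\<forall>q < num_states M. \<forall>rs. length rs = num_tapes M \<and> set rs \<subseteq> {..<num_syms M} \<longrightarrow>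
        (case transition M q rs of (q', acts) \<Rightarrow>
           q' < num_states M \<and> length acts = num_tapes M \<and> fst ` set acts \<subseteq> {..<num_syms M}))"

text \<open>A tape is its contents together with the head position.\<close>

type_synonym tape = "(int \<Rightarrow> nat) \<times> int"
type_synonym config = "nat \<times> tape list"

definition contents :: "nat list \<Rightarrow> int \<Rightarrow> nat" where
  "contents w i = (if 0 \<le> i \<and> i < int (length w) then w ! nat i else 0)"

fun read_tape :: "tape \<Rightarrow> nat" where
  "read_tape (c, h) = c h"

fun act_tape :: "nat \<times> move \<Rightarrow> tape \<Rightarrow> tape" where
  "act_tape (s, d) (c, h) = (c(h := s), h + shift d)"

fun step :: "tm \<Rightarrow> config \<Rightarrow> config" where
  "step M (q, ts) =
     (if q = halt_state M then (q, ts)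
      else case transition M q (map read_tape ts) of (q', acts) \<Rightarrow> (q', map2 act_tape acts ts))"

definition init_config :: "tm \<Rightarrow> nat list \<Rightarrow> config" where
  "init_config M w =
     (start_state M, (contents w, 0) # replicate (num_tapes M - 1) (contents [], 0))"

text \<open>A halted configuration does not change any more, so the following says that the machine
  halts after at most \<open>t\<close> steps with \<open>v\<close> on its output tape.\<close>

definition computes_within :: "tm \<Rightarrow> nat list \<Rightarrow> nat list \<Rightarrow> nat \<Rightarrow> bool" where
  "computes_within M w v t \<longleftrightarrow>
     (case (step M ^^ t) (init_config M w) of (q, ts) \<Rightarrow>
        q = halt_state M \<and> fst (last ts) = contents v)"


section \<open>Polynomial time, NP and NP-completeness\<close>

definition bits :: "bool list \<Rightarrow> nat list" where
  "bits x = map (\<lambda>b. if b then 2 else 1) x"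

definition poly_time :: "('a \<Rightarrow> nat list) \<Rightarrow> ('a \<Rightarrow> nat list) \<Rightarrow> bool" where
  "poly_time inp out \<longleftrightarrow>
     (\<exists>M (p :: nat poly). wf_tm M \<and>
        (\<forall>a. computes_within M (inp a) (out a) (poly p (length (inp a)))))"

definition poly_time_computable :: "(bool list \<Rightarrow> bool list) \<Rightarrow> bool" where
  "poly_time_computable f \<longleftrightarrow> poly_time bits (\<lambda>x. bits (f x))"

definition poly_time_decidable_rel :: "(bool list \<times> bool list) set \<Rightarrow> bool" where
  "poly_time_decidable_rel R \<longleftrightarrow>
     poly_time (\<lambda>(x, u). bits x @ [3] @ bits u) (\<lambda>(x, u). bits [(x, u) \<in> R])"

definition NP :: "bool list set set" where
  "NP = {L. \<exists>R (p :: nat poly). poly_time_decidable_rel R \<and>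
     (\<forall>x. x \<in> L \<longleftrightarrow> (\<exists>u. length u \<le> poly p (length x) \<and> (x, u) \<in> R))}"

definition poly_reducible :: "bool list set \<Rightarrow> bool list set \<Rightarrow> bool" where
  "poly_reducible L L' \<longleftrightarrow> (\<exists>f. poly_time_computable f \<and> (\<forall>x. x \<in> L \<longleftrightarrow> f x \<in> L'))"

definition NP_hard :: "bool list set \<Rightarrow> bool" where
  "NP_hard L \<longleftrightarrow> (\<forall>L'\<in>NP. poly_reducible L' L)"

definition NP_complete :: "bool list set \<Rightarrow> bool" where
  "NP_complete L \<longleftrightarrow> L \<in> NP \<and> NP_hard L"


section \<open>The decision problem\<close>

text \<open>Binary representation, least significant bit first, without superfluous zeros.\<close>

fun binary :: "nat \<Rightarrow> bool list" where
  "binary n = (if n = 0 then [] else odd n # binary (n div 2))"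

declare binary.simps [simp del]

definition adjacency_matrix :: "nat \<Rightarrow> nat rel \<Rightarrow> bool list" where
  "adjacency_matrix n E = concat (map (\<lambda>i. map (\<lambda>j. (i, j) \<in> E) [0..<n]) [0..<n])"

text \<open>The unary prefix makes the code self-delimiting; next to the \<open>n\<^sup>2\<close> matrix entries it does
  not affect polynomial bounds.\<close>

definition encode_instance :: "nat \<Rightarrow> nat rel \<Rightarrow> nat \<Rightarrow> bool list" where
  "encode_instance n E k = replicate n True @ [False] @ adjacency_matrix n E @ binary k"

definition MISP_snake7_free :: "bool list set" where
  "MISP_snake7_free = {encode_instance n E k | n E k.
     tournament {..<n} E \<and> snake7_free {..<n} E \<and> k \<ge> 1 \<and>
     (\<exists>S. independent_set {..<n} E S \<and> card S \<ge> k)}"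

lemma binary_inject: "binary m = binary n \<Longrightarrow> m = n"
proof (induction m arbitrary: n rule: less_induct)
  case (less m)
  show ?case
  proof (cases "m = 0 \<or> n = 0")
    case True
    then show ?thesis using less.prems
      by (auto simp: binary.simps[of m] binary.simps[of n] split: if_splits)
  next
    case False
    then have *: "odd m = odd n" "binary (m div 2) = binary (n div 2)"
      using less.prems by (auto simp: binary.simps[of m] binary.simps[of n])
    then have "m div 2 = n div 2" using less.IH[of "m div 2"] False by auto
    then show ?thesis using *(1) by (metis bit_eq_rec)
  qed
qed

lemma encode_instance_inject:
  assumes eq: "encode_instance n E k = encode_instance n' E' k'"
    and E: "E \<subseteq> {..<n} \<times> {..<n}" and E': "E' \<subseteq> {..<n'} \<times> {..<n'}"
  shows "n = n' \<and> E = E' \<and> k = k'"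
proof -
  have tw': "takeWhile id (replicate m True @ False # w) = replicate m True" for m w
    by (induction m) auto
  have tw: "takeWhile id (encode_instance m F l) = replicate m True" for m F l
    by (simp add: encode_instance_def tw')
  have n: "n = n'" using tw[of n E k] tw[of n' E' k'] eq by (metis length_replicate)
  have len: "length (adjacency_matrix n F) = n * n" for F
    by (simp add: adjacency_matrix_def length_concat comp_def sum_list_triv)
  have adj: "adjacency_matrix n E = adjacency_matrix n E'" and b: "binary k = binary k'"
    using eq n len by (auto simp: encode_instance_def)
  have "map (\<lambda>i. map (\<lambda>j. (i, j) \<in> E) [0..<n]) [0..<n] =
        map (\<lambda>i. map (\<lambda>j. (i, j) \<in> E') [0..<n]) [0..<n]"
    by (rule concat_injective[OF adj[unfolded adjacency_matrix_def]]) (auto simp: set_zip)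
  then have "(i, j) \<in> E \<longleftrightarrow> (i, j) \<in> E'" if "i < n" "j < n" for i j
    using that by (auto simp: map_eq_conv)
  then have "E = E'" using E E' n by auto
  then show ?thesis using n binary_inject[OF b] by blast
qed

end

theory Submission
  imports Defs
begin

text \<open>
  Hardness. A set of squares of a computation tableau, each filled with a local piece of a
  configuration, is a run of the verifier iff the pieces are pairwise compatible; so acceptance
  becomes the existence of a large independent set in a graph whose vertices are the possible
  fillings of the squares. A path with four inner vertices is attached for each ordered pair of
  vertices and joined to the pair if it is an edge, which raises the independence number by two per
  pair. The resulting vertices are arranged in layers so that the edges become backedges of an
  otherwise transitively ordered tournament. Two further large layers without backedges separate the
  ends of every backedge; a large transitive set has to meet both of them and therefore contains no
  backedge. In a 7-snake the first and the last triangle both contain a backedge, and the first lies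
  completely before the second. In the chosen order of the layers this is only possible for a backedge
  from layer 1 to 3 and one from layer 3 to 5, and since these two matchings are nested, no vertex can
  link the triangles in the way the middle vertex of the snake does.

  Membership and the computability of the reduction both rest on a class of functions built from
  addition, truncated subtraction, inspection of the input and bounded sums. Their values are
  polynomially bounded, so that they are evaluated by programs over unary counters, and a
  multi-tape machine simulates a counter in real time by a head position.
\<close>

section \<open>Counter programs\<close>

text \<open>The obstacle is branching: a graph vertex may have many edges, and unrestricted
  backedges easily form snakes. Replacing an edge by a path with five edges confines branching to
  layer 0; between any two other layers the backedges form a matching. The number of inner vertices
  has to be even for the count. A transitive set without backedges is the complement of a vertex
  cover of the backedges. The three edges between the four inner vertices need two cover vertices;
  two also suffice for the whole path if one of its ends is in the cover, and three are needed if
  neither is. The pairs are ordered and include (u, u), where the path closes to a cycle of length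
  five; so a vertex clashing with itself is excluded by the same count, and the clash relation need
  not be symmetric. Since independence constrains all pairs of squares and not only neighbouring
  ones, a whole row can be forced to agree on its state and on the symbols read, and a head can be
  compared with every square of the next row.\<close>

datatype test = Nz nat | Sym nat | NonBlank

datatype com = Skip | Inc nat | Dec nat | Fwd | Bwd | Out bool
  | Seq com com (infixr ";;" 60) | If test com com | While test com

datatype act = Nop | AInc nat | ADec nat | AFwd | ABwd | AOut bool

type_synonym mem = "(nat \<Rightarrow> nat) \<times> int \<times> bool list"

fun holds :: "nat list \<Rightarrow> mem \<Rightarrow> test \<Rightarrow> bool" where
  "holds w (r, h, out) (Nz k) \<longleftrightarrow> r k \<noteq> 0"
| "holds w (r, h, out) (Sym s) \<longleftrightarrow> contents w h = s"
| "holds w (r, h, out) NonBlank \<longleftrightarrow> contents w h \<noteq> 0"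

text \<open>One step of control yields the rest of the program and an elementary action. The memory
  enters only through the truth values \<open>T\<close> of the tests, so the possible rests can
  serve as machine states.\<close>

fun nxt :: "(test \<Rightarrow> bool) \<Rightarrow> com \<Rightarrow> com \<times> act" where
  "nxt T Skip = (Skip, Nop)"
| "nxt T (Inc k) = (Skip, AInc k)"
| "nxt T (Dec k) = (Skip, ADec k)"
| "nxt T Fwd = (Skip, AFwd)"
| "nxt T Bwd = (Skip, ABwd)"
| "nxt T (Out b) = (Skip, AOut b)"
| "nxt T (c1 ;; c2) =
     (if c1 = Skip then (c2, Nop) else (fst (nxt T c1) ;; c2, snd (nxt T c1)))"
| "nxt T (If t c1 c2) = (if T t then c1 else c2, Nop)"
| "nxt T (While t c) = (if T t then c ;; While t c else Skip, Nop)"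

fun perform :: "act \<Rightarrow> mem \<Rightarrow> mem" where
  "perform Nop m = m"
| "perform (AInc k) (r, h, out) = (r(k := r k + 1), h, out)"
| "perform (ADec k) (r, h, out) = (r(k := r k - 1), h, out)"
| "perform AFwd (r, h, out) = (r, h + 1, out)"
| "perform ABwd (r, h, out) = (r, h - 1, out)"
| "perform (AOut b) (r, h, out) = (r, h, out @ [b])"

fun cstep :: "nat list \<Rightarrow> com \<times> mem \<Rightarrow> com \<times> mem" where
  "cstep w (c, m) = (fst (nxt (holds w m) c), perform (snd (nxt (holds w m) c)) m)"

text \<open>\<open>Skip\<close> is a fixed point of \<open>cstep\<close>, so \<open>n\<close> is
  only an upper bound on the running time.\<close>

definition runs :: "nat list \<Rightarrow> com \<Rightarrow> mem \<Rightarrow> nat \<Rightarrow> mem \<Rightarrow> bool" where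
  "runs w c m n m' \<longleftrightarrow> (cstep w ^^ n) (c, m) = (Skip, m')"

lemma cstep_Skip: "(cstep w ^^ n) (Skip, m) = (Skip, m)"
  by (induction n) auto

lemma runs_mono:
  assumes "runs w c m n m'" "n \<le> n'"
  shows "runs w c m n' m'"
proof -
  have "(cstep w ^^ (n' - n + n)) (c, m) = (Skip, m')"
    using assms(1) unfolding runs_def by (simp only: funpow_add o_apply cstep_Skip)
  then show ?thesis using assms(2) by (simp add: runs_def)
qed

lemma runs_Suc: "runs w (fst (cstep w (c, m))) (snd (cstep w (c, m))) n m' \<Longrightarrow> runs w c m (Suc n) m'"
  unfolding runs_def by (simp add: funpow_Suc_right del: funpow.simps)

lemma runs_Skip: "runs w Skip m 0 m"
  by (simp add: runs_def)

lemma runs_Inc: "runs w (Inc k) (r, h, out) 1 (r(k := r k + 1), h, out)"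
  and runs_Dec: "runs w (Dec k) (r, h, out) 1 (r(k := r k - 1), h, out)"
  and runs_Fwd: "runs w Fwd (r, h, out) 1 (r, h + 1, out)"
  and runs_Bwd: "runs w Bwd (r, h, out) 1 (r, h - 1, out)"
  and runs_Out: "runs w (Out b) (r, h, out) 1 (r, h, out @ [b])"
  by (simp_all add: runs_def)

lemma runs_Seq:
  assumes "runs w c1 m n1 m1" "runs w c2 m1 n2 m2"
  shows "runs w (c1 ;; c2) m (n1 + n2 + 1) m2"
  using assms(1)
proof (induction n1 arbitrary: c1 m)
  case 0
  then have "c1 = Skip" "m = m1" by (auto simp: runs_def)
  then show ?case using assms(2) by (auto intro: runs_Suc)
next
  case (Suc n)
  show ?case
  proof (cases "c1 = Skip")
    case True
    with Suc.prems have "m = m1" by (simp add: runs_def cstep_Skip del: funpow.simps)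
    with True have "runs w (c1 ;; c2) m (Suc n2) m2" using assms(2) by (auto intro: runs_Suc)
    then show ?thesis by (rule runs_mono) simp
  next
    case False
    have "runs w (fst (cstep w (c1, m))) (snd (cstep w (c1, m))) n m1"
      using Suc.prems unfolding runs_def by (simp add: funpow_Suc_right del: funpow.simps)
    from Suc.IH[OF this] show ?thesis using False by (auto intro: runs_Suc)
  qed
qed

lemma runs_If:
  assumes "holds w m t \<Longrightarrow> runs w c1 m n m'" "\<not> holds w m t \<Longrightarrow> runs w c2 m n m'"
  shows "runs w (If t c1 c2) m (n + 1) m'"
  using assms by (auto intro!: runs_Suc)

text \<open>\<open>f i\<close> is the memory after i rounds. A round costs \<open>n\<close> steps
  for the body, one for the test and one for leaving the sequence.\<close>

lemma runs_While:
  assumes "\<And>i. i < N \<Longrightarrow> holds w (f i) t" "\<And>i. i < N \<Longrightarrow> runs w c (f i) n (f (Suc i))"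
    and "\<not> holds w (f N) t"
  shows "runs w (While t c) (f 0) (N * (n + 2) + 1) (f N)"
  using assms
proof (induction N arbitrary: f)
  case 0
  then show ?case by (auto intro!: runs_Suc runs_Skip)
next
  case (Suc N)
  have "runs w (While t c) (f (Suc 0)) (N * (n + 2) + 1) (f (Suc N))"
    using Suc.IH[of "\<lambda>i. f (Suc i)"] Suc.prems by auto
  then have "runs w (c ;; While t c) (f 0) (n + (N * (n + 2) + 1) + 1) (f (Suc N))"
    using Suc.prems by (intro runs_Seq) auto
  then have "runs w (While t c) (f 0) (Suc (n + (N * (n + 2) + 1) + 1)) (f (Suc N))"
    using Suc.prems(1)[of 0] by (intro runs_Suc[of w "While t c"]) simp
  then show ?case by (rule runs_mono) simp
qed

lemma runs_WhileI:
  assumes "\<And>i. i < N \<Longrightarrow> holds w (f i) t" "\<And>i. i < N \<Longrightarrow> runs w c (f i) n (f (Suc i))"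
    and "\<not> holds w (f N) t" "m = f 0" "m' = f N"
  shows "runs w (While t c) m (N * (n + 2) + 1) m'"
  using runs_While[of N w f t c n] assms by simp


section \<open>From counter programs to Turing machines\<close>

fun test_below :: "nat \<Rightarrow> test \<Rightarrow> bool" where
  "test_below K (Nz k) \<longleftrightarrow> k < K"
| "test_below K _ \<longleftrightarrow> True"

fun com_below :: "nat \<Rightarrow> com \<Rightarrow> bool" where
  "com_below K (Inc k) \<longleftrightarrow> k < K"
| "com_below K (Dec k) \<longleftrightarrow> k < K"
| "com_below K (c1 ;; c2) \<longleftrightarrow> com_below K c1 \<and> com_below K c2"
| "com_below K (If t c1 c2) \<longleftrightarrow> test_below K t \<and> com_below K c1 \<and> com_below K c2"
| "com_below K (While t c) \<longleftrightarrow> test_below K t \<and> com_below K c"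
| "com_below K _ \<longleftrightarrow> True"

fun act_below :: "nat \<Rightarrow> act \<Rightarrow> bool" where
  "act_below K (AInc k) \<longleftrightarrow> k < K"
| "act_below K (ADec k) \<longleftrightarrow> k < K"
| "act_below K _ \<longleftrightarrow> True"

lemma com_below_mono: "com_below K c \<Longrightarrow> K \<le> K' \<Longrightarrow> com_below K' c"
proof -
  have t: "test_below K t \<Longrightarrow> K \<le> K' \<Longrightarrow> test_below K' t" for t by (cases t) auto
  show "com_below K c \<Longrightarrow> K \<le> K' \<Longrightarrow> com_below K' c" by (induction c) (auto dest: t)
qed

lemma ex_com_below: "\<exists>K. com_below K c"
proof (induction c)
  case (Seq c1 c2)
  then obtain K1 K2 where "com_below K1 c1" "com_below K2 c2" by blast
  then have "com_below (max K1 K2) (c1 ;; c2)" by (auto intro: com_below_mono)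
  then show ?case by blast
next
  case (If t c1 c2)
  then obtain K1 K2 where K: "com_below K1 c1" "com_below K2 c2" by blast
  obtain K3 where K3: "test_below K3 t" by (cases t) auto
  have "test_below (max K3 (max K1 K2)) t" using K3 by (cases t) auto
  then have "com_below (max K3 (max K1 K2)) (If t c1 c2)" using K by (auto intro: com_below_mono)
  then show ?case by blast
next
  case (While t c)
  then obtain K1 where K: "com_below K1 c" by blast
  obtain K3 where K3: "test_below K3 t" by (cases t) auto
  have "test_below (max K3 K1) t" using K3 by (cases t) auto
  then have "com_below (max K3 K1) (While t c)" using K by (auto intro: com_below_mono)
  then show ?case by blast
qed auto

lemma nxt_below: "com_below K c \<Longrightarrow> com_below K (fst (nxt T c)) \<and> act_below K (snd (nxt T c))"
  by (induction c) auto

lemma nxt_cong: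
  "com_below K c \<Longrightarrow> (\<And>t. test_below K t \<Longrightarrow> T t = T' t) \<Longrightarrow> nxt T c = nxt T' c"
  by (induction c) auto

text \<open>Unfolding a loop copies its body, but the programs that arise are only
  \<open>d ;; While t c\<close> with \<open>d\<close> a rest of the body, and the loop itself. So
  the rests stay finite in number although programs can grow in a step.\<close>

lemma ex_finite_control:
  "\<exists>C. finite C \<and> c \<in> C \<and> Skip \<in> C \<and> (\<forall>c\<in>C. \<forall>T. fst (nxt T c) \<in> C)"
proof (induction c)
  case (Seq c1 c2)
  then obtain C1 C2 where "finite C1" "c1 \<in> C1" "Skip \<in> C1" "\<forall>c\<in>C1. \<forall>T. fst (nxt T c) \<in> C1"
    "finite C2" "c2 \<in> C2" "Skip \<in> C2" "\<forall>c\<in>C2. \<forall>T. fst (nxt T c) \<in> C2" by blast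
  then show ?case by (intro exI[of _ "(\<lambda>c. c ;; c2) ` C1 \<union> C2"]) auto
next
  case (If t c1 c2)
  then obtain C1 C2 where "finite C1" "c1 \<in> C1" "Skip \<in> C1" "\<forall>c\<in>C1. \<forall>T. fst (nxt T c) \<in> C1"
    "finite C2" "c2 \<in> C2" "Skip \<in> C2" "\<forall>c\<in>C2. \<forall>T. fst (nxt T c) \<in> C2" by blast
  then show ?case by (intro exI[of _ "insert (If t c1 c2) (C1 \<union> C2)"]) auto
next
  case (While t c)
  then obtain C where "finite C" "c \<in> C" "Skip \<in> C" "\<forall>c\<in>C. \<forall>T. fst (nxt T c) \<in> C" by blast
  then show ?case by (intro exI[of _ "{While t c, Skip} \<union> (\<lambda>d. d ;; While t c) ` C"]) auto
next
  case Skip show ?case by (intro exI[of _ "{Skip}"]) auto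
next
  case (Inc k) show ?case by (intro exI[of _ "{Inc k, Skip}"]) auto
next
  case (Dec k) show ?case by (intro exI[of _ "{Dec k, Skip}"]) auto
next
  case Fwd show ?case by (intro exI[of _ "{Fwd, Skip}"]) auto
next
  case Bwd show ?case by (intro exI[of _ "{Bwd, Skip}"]) auto
next
  case (Out b) show ?case by (intro exI[of _ "{Out b, Skip}"]) auto
qed

text \<open>Tape \<open>k + 1\<close> holds counter \<open>k\<close> as its head position, with the symbol 1 marking cell 0.\<close>

definition tapes_of :: "nat \<Rightarrow> nat list \<Rightarrow> mem \<Rightarrow> tape list" where
  "tapes_of K w m = (case m of (r, h, out) \<Rightarrow>
     (contents w, h) # map (\<lambda>k. (contents [1], int (r k))) [0..<K] @
     [(contents (bits out), int (length out))])"

fun test_syms :: "nat list \<Rightarrow> test \<Rightarrow> bool" where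
  "test_syms rs (Nz k) \<longleftrightarrow> rs ! Suc k \<noteq> 1"
| "test_syms rs (Sym s) \<longleftrightarrow> rs ! 0 = s"
| "test_syms rs NonBlank \<longleftrightarrow> rs ! 0 \<noteq> 0"

text \<open>A decrement on the marked cell leaves the head in place, which is truncated subtraction.
  Only the output tape is ever written.\<close>

fun tape_act :: "nat \<Rightarrow> act \<Rightarrow> nat \<Rightarrow> nat \<Rightarrow> nat \<times> move" where
  "tape_act K Nop j s = (s, NoMove)"
| "tape_act K (AInc k) j s = (s, if j = Suc k then MoveRight else NoMove)"
| "tape_act K (ADec k) j s = (s, if j = Suc k \<and> s \<noteq> 1 then MoveLeft else NoMove)"
| "tape_act K AFwd j s = (s, if j = 0 then MoveRight else NoMove)"
| "tape_act K ABwd j s = (s, if j = 0 then MoveLeft else NoMove)"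
| "tape_act K (AOut b) j s =
     (if j = Suc K then (if b then 2 else 1, MoveRight) else (s, NoMove))"

text \<open>With programs coded below \<open>N\<close>, the additional start state \<open>N\<close>
  writes the marker on the counter tapes. From then on each program step is one machine
  step.\<close>

definition counter_tm :: "nat \<Rightarrow> nat \<Rightarrow> (com \<Rightarrow> nat) \<Rightarrow> (nat \<Rightarrow> com) \<Rightarrow> com \<Rightarrow> tm" where
  "counter_tm K N enc dec c0 = \<lparr>
     num_tapes = K + 2, num_states = N + 1, num_syms = 4, start_state = N, halt_state = enc Skip,
     transition = (\<lambda>q rs.
       if q = N then
         (enc c0, map (\<lambda>j. (if 0 < j \<and> j \<le> K then 1 else rs ! j, NoMove)) [0..<K + 2])
       else
         (enc (fst (nxt (test_syms rs) (dec q))),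
          map (\<lambda>j. tape_act K (snd (nxt (test_syms rs) (dec q))) j (rs ! j)) [0..<K + 2])) \<rparr>"

lemma contents_snoc: "contents (xs @ [x]) = (contents xs)(int (length xs) := x)"
  by (rule ext) (auto simp: contents_def nth_append)

lemma length_tapes_of: "length (tapes_of K w m) = K + 2"
  by (cases m) (simp add: tapes_of_def)

lemma tapes_of_0: "tapes_of K w (r, h, out) ! 0 = (contents w, h)"
  and tapes_of_Suc: "k < K \<Longrightarrow> tapes_of K w (r, h, out) ! Suc k = (contents [1], int (r k))"
  and tapes_of_last: "tapes_of K w (r, h, out) ! Suc K = (contents (bits out), int (length out))"
  by (simp_all add: tapes_of_def nth_append)

lemma tapes_of_eqI:
  assumes "length ts = K + 2" "ts ! 0 = (contents w, h)"
    "\<And>k. k < K \<Longrightarrow> ts ! Suc k = (contents [1], int (r k))"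
    "ts ! Suc K = (contents (bits out), int (length out))"
  shows "ts = tapes_of K w (r, h, out)"
proof (rule nth_equalityI)
  show "length ts = length (tapes_of K w (r, h, out))" using assms by (simp add: length_tapes_of)
  fix i assume "i < length ts"
  then consider "i = 0" | k where "i = Suc k" "k < K" | "i = Suc K"
    using assms(1) by (cases i) (auto simp: less_Suc_eq)
  then show "ts ! i = tapes_of K w (r, h, out) ! i"
    by cases (use assms in \<open>auto simp: tapes_of_0 tapes_of_Suc tapes_of_last\<close>)
qed

lemma test_syms_tapes_of:
  assumes "test_below K t"
  shows "test_syms (map read_tape (tapes_of K w m)) t = holds w m t"
proof -
  obtain r h out where m: "m = (r, h, out)" by (cases m)
  show ?thesis using assms unfolding m
    by (cases t) (auto simp: tapes_of_0 tapes_of_Suc nth_map length_tapes_of contents_def)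
qed

lemma act_tapes_of:
  assumes "act_below K a"
  shows "map2 act_tape
      (map (\<lambda>j. tape_act K a j (map read_tape (tapes_of K w m) ! j)) [0..<K + 2])
      (tapes_of K w m) = tapes_of K w (perform a m)" (is "?ts = _")
proof -
  obtain r h out where m: "m = (r, h, out)" by (cases m)
  have len: "length ?ts = K + 2" by (simp add: length_tapes_of)
  have nth: "?ts ! j = act_tape (tape_act K a j (read_tape (tapes_of K w m ! j))) (tapes_of K w m ! j)"
    if "j < K + 2" for j
    using that by (simp add: length_tapes_of del: upt_Suc)
  obtain r' h' out' where m': "perform a m = (r', h', out')" by (cases "perform a m")
  show ?thesis unfolding m'
  proof (rule tapes_of_eqI[OF len])
    show "?ts ! 0 = (contents w, h')"
      by (rule trans[OF nth]) (use m' assms in \<open>cases a; auto simp: m tapes_of_0\<close>)+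
    show "?ts ! Suc k = (contents [1], int (r' k))" if "k < K" for k
      by (rule trans[OF nth])
        (use m' assms that in \<open>cases a; auto simp: m tapes_of_Suc contents_def\<close>)+
    show "?ts ! Suc K = (contents (bits out'), int (length out'))"
      by (rule trans[OF nth])
        (use m' assms in \<open>cases a; auto simp: m tapes_of_last bits_def contents_snoc\<close>)+
  qed
qed

lemma run_on_tm:
  assumes run: "\<And>a. \<exists>m. runs (inp a) c (\<lambda>_. 0, 0, []) (poly p (length (inp a))) m \<and>
      bits (snd (snd m)) = out a"
  shows "poly_time inp out"
proof -
  obtain K where K: "com_below K c" using ex_com_below by blast
  obtain C0 where C0: "finite C0" "c \<in> C0" "Skip \<in> C0" "\<forall>c\<in>C0. \<forall>T. fst (nxt T c) \<in> C0"
    using ex_finite_control by blast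
  \<comment> \<open>The restriction to registers below \<open>K\<close> ensures that every counter
    tested or changed has its tape.\<close>
  define C where "C = C0 \<inter> {c. com_below K c}"
  have C: "finite C" "c \<in> C" "Skip \<in> C" and Cn: "\<And>c T. c \<in> C \<Longrightarrow> fst (nxt T c) \<in> C"
    and CK: "\<And>c. c \<in> C \<Longrightarrow> com_below K c"
    using C0 K by (auto simp: C_def nxt_below)
  obtain enc where enc: "bij_betw enc C {0..<card C}" using ex_bij_betw_finite_nat[OF C(1)] by blast
  define dec where "dec = inv_into C enc"
  have dec: "dec (enc c) = c" if "c \<in> C" for c
    using that enc by (simp add: dec_def bij_betw_def)
  have enc_less: "enc c < card C" if "c \<in> C" for c using that enc by (auto simp: bij_betw_def)
  have dec_in: "dec q \<in> C" if "q < card C" for q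
    using that enc unfolding dec_def by (metis atLeastLessThan_iff bij_betw_imp_surj_on inv_into_into zero_le)
  define M where "M = counter_tm K (card C) enc dec c"
  have "wf_tm M"
  proof -
    have ta: "fst (tape_act K a j s) < 4" if "s < 4" for a j s using that by (cases a) auto
    have trans: "case transition M q rs of (q', acts) \<Rightarrow>
        q' < num_states M \<and> length acts = num_tapes M \<and> fst ` set acts \<subseteq> {..<num_syms M}"
      if q: "q < num_states M" and rs: "length rs = num_tapes M" "set rs \<subseteq> {..<num_syms M}" for q rs
    proof -
      have r: "rs ! j < 4" if "j < K + 2" for j
      proof -
        have "rs ! j \<in> set rs" using rs that by (simp add: M_def counter_tm_def)
        then show ?thesis using rs by (auto simp: M_def counter_tm_def)
      qed
      show ?thesis
      proof (cases "q = card C")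
        case True
        then show ?thesis using enc_less[OF C(2)] r
          by (auto simp: M_def counter_tm_def simp del: upt_Suc)
      next
        case False
        then have "enc (fst (nxt (test_syms rs) (dec q))) < card C"
          using q by (intro enc_less Cn dec_in) (auto simp: M_def counter_tm_def)
        then show ?thesis using False r ta
          by (auto simp: M_def counter_tm_def simp del: upt_Suc)
      qed
    qed
    show ?thesis
      unfolding wf_tm_def using trans enc_less[OF C(3)] by (auto simp: M_def counter_tm_def)
  qed
  have step: "step M (enc c', tapes_of K w m) =
      (enc (fst (cstep w (c', m))), tapes_of K w (snd (cstep w (c', m))))" if c': "c' \<in> C" for w m c'
  proof (cases "c' = Skip")
    case True
    then show ?thesis by (simp add: M_def counter_tm_def)
  next
    case False
    then have "enc c' \<noteq> enc Skip" using c' C(3) dec by metis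
    moreover have n: "nxt (test_syms (map read_tape (tapes_of K w m))) c' = nxt (holds w m) c'"
      by (rule nxt_cong[OF CK[OF c']]) (rule test_syms_tapes_of)
    ultimately show ?thesis
      using enc_less[OF c'] act_tapes_of[of K "snd (nxt (holds w m) c')" w m] nxt_below[OF CK[OF c']]
      by (simp add: M_def counter_tm_def dec[OF c'] n)
  qed
  have steps: "(step M ^^ n) (enc c', tapes_of K w m) =
      (enc (fst ((cstep w ^^ n) (c', m))), tapes_of K w (snd ((cstep w ^^ n) (c', m)))) \<and>
      fst ((cstep w ^^ n) (c', m)) \<in> C" if "c' \<in> C" for n w m c'
  proof (induction n)
    case (Suc n)
    obtain d m' where d: "(cstep w ^^ n) (c', m) = (d, m')" by (cases "(cstep w ^^ n) (c', m)")
    show ?case using Suc d step[of d w m'] Cn[of d] by simp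
  qed (use that in simp)
  have init: "step M (init_config M w) = (enc c, tapes_of K w (\<lambda>_. 0, 0, []))" for w
  proof -
    have ne: "card C \<noteq> enc Skip" using enc_less[OF C(3)] by simp
    let ?ts = "(contents w, 0) # replicate (K + 1) (contents [], 0)"
    have "map2 act_tape (map (\<lambda>j. (if 0 < j \<and> j \<le> K then 1 else map read_tape ?ts ! j, NoMove)) [0..<K + 2]) ?ts
      = tapes_of K w (\<lambda>_. 0, 0, [])" (is "?l = _")
    proof (rule tapes_of_eqI)
      show "length ?l = K + 2" by simp
      have nth: "?l ! j = act_tape (if 0 < j \<and> j \<le> K then 1 else read_tape (?ts ! j), NoMove) (?ts ! j)"
        if "j < K + 2" for j using that by (simp del: upt_Suc replicate_Suc)
      show "?l ! 0 = (contents w, 0)" by (subst nth) auto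
      show "?l ! Suc k = (contents [1], int 0)" if "k < K" for k
        using that by (subst nth) (auto simp: contents_def fun_eq_iff nth_append simp del: replicate_Suc)
      show "?l ! Suc K = (contents (bits []), int (length []))"
        by (subst nth) (auto simp: bits_def contents_def simp del: replicate_Suc)
    qed
    then show ?thesis using ne by (simp add: M_def counter_tm_def init_config_def del: upt_Suc cong: if_cong)
  qed
  \<comment> \<open>The additional step is the initial marking of the counter tapes.\<close>
  have "computes_within M (inp a) (out a) (poly (p + 1) (length (inp a)))" for a
  proof -
    obtain m where m: "runs (inp a) c (\<lambda>_. 0, 0, []) (poly p (length (inp a))) m" "bits (snd (snd m)) = out a"
      using run by blast
    have "(step M ^^ Suc (poly p (length (inp a)))) (init_config M (inp a)) = (enc Skip, tapes_of K (inp a) m)"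
      using steps[OF C(2), of "poly p (length (inp a))" "inp a" "(\<lambda>_. 0, 0, [])"] m(1)
      by (simp add: funpow_Suc_right init runs_def del: funpow.simps)
    moreover have "fst (last (tapes_of K (inp a) m)) = contents (out a)"
      using m(2) by (cases m) (simp add: tapes_of_def)
    ultimately show ?thesis by (simp add: computes_within_def M_def counter_tm_def)
  qed
  then show ?thesis unfolding poly_time_def using \<open>wf_tm M\<close> by blast
qed

section \<open>A class of polynomial-time functions\<close>

text \<open>Functions of the input \<open>w\<close> and of natural number variables \<open>e\<close>, which are de Bruijn indices: the
  summation index is variable 0 of the summand. All values stay polynomial, so numbers can be kept
  in unary and counter programs suffice.\<close>

inductive pf :: "nat \<Rightarrow> (nat list \<Rightarrow> (nat \<Rightarrow> nat) \<Rightarrow> nat) \<Rightarrow> bool" where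
  one: "pf d (\<lambda>w e. 1)"
| var: "k < d \<Longrightarrow> pf d (\<lambda>w e. e k)"
| add: "pf d f \<Longrightarrow> pf d g \<Longrightarrow> pf d (\<lambda>w e. f w e + g w e)"
| sub: "pf d f \<Longrightarrow> pf d g \<Longrightarrow> pf d (\<lambda>w e. f w e - g w e)"
| len: "pf d (\<lambda>w e. length w)"
| sym: "pf d f \<Longrightarrow> pf d (\<lambda>w e. of_bool (contents w (int (f w e)) = s))"
| sum: "pf d f \<Longrightarrow> pf (Suc d) g \<Longrightarrow> pf d (\<lambda>w e. \<Sum>i<f w e. g w (case_nat i e))"

lemma pf_local_aux: "pf d f \<Longrightarrow> \<forall>e e'. (\<forall>k<d. e k = e' k) \<longrightarrow> f w e = f w e'"
proof (induction rule: pf.induct)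
  case (sum d f g)
  show ?case
  proof (intro allI impI)
    fix e e' :: "nat \<Rightarrow> nat" assume *: "\<forall>k<d. e k = e' k"
    have "\<forall>k<Suc d. case_nat i e k = case_nat i e' k" for i using * by (auto split: nat.split)
    then have "g w (case_nat i e) = g w (case_nat i e')" for i using sum.IH(2) by blast
    moreover have "f w e = f w e'" using * sum.IH(1) by blast
    ultimately show "(\<Sum>i<f w e. g w (case_nat i e)) = (\<Sum>i<f w e'. g w (case_nat i e'))" by simp
  qed
next
  case (add d f g)
  show ?case
  proof (intro allI impI)
    fix e e' :: "nat \<Rightarrow> nat" assume "\<forall>k<d. e k = e' k"
    then show "f w e + g w e = f w e' + g w e'" using add.IH[rule_format, of e e'] by simp
  qed
next
  case (sub d f g)
  show ?case
  proof (intro allI impI)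
    fix e e' :: "nat \<Rightarrow> nat" assume "\<forall>k<d. e k = e' k"
    then show "f w e - g w e = f w e' - g w e'" using sub.IH[rule_format, of e e'] by simp
  qed
next
  case (sym d f s)
  show ?case
  proof (intro allI impI)
    fix e e' :: "nat \<Rightarrow> nat" assume "\<forall>k<d. e k = e' k"
    then show "of_bool (contents w (int (f w e)) = s) = of_bool (contents w (int (f w e')) = s)"
      using sym.IH[rule_format, of e e'] by simp
  qed
qed simp_all

text \<open>This allows scratch registers to be overwritten between the evaluation of two subterms:
  only the registers of the first \<open>d\<close> variables matter.\<close>

lemma pf_local: "pf d f \<Longrightarrow> (\<And>k. k < d \<Longrightarrow> e k = e' k) \<Longrightarrow> f w e = f w e'"
  using pf_local_aux by blast

lemma pf_rename_aux: "pf k f \<Longrightarrow> \<forall>\<rho> d. (\<forall>i<k. \<rho> i < d) \<longrightarrow> pf d (\<lambda>w e. f w (\<lambda>i. e (\<rho> i)))"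
proof (induction rule: pf.induct)
  case (sum k f g)
  show ?case
  proof (intro allI impI)
    fix \<rho> :: "nat \<Rightarrow> nat" and d assume *: "\<forall>i<k. \<rho> i < d"
    let ?\<rho> = "case_nat 0 (\<lambda>i. Suc (\<rho> i))"
    have "\<forall>i<Suc k. ?\<rho> i < Suc d" using * by (auto split: nat.split)
    then have "pf (Suc d) (\<lambda>w e. g w (\<lambda>i. e (?\<rho> i)))" using sum.IH(2) by blast
    moreover have "pf d (\<lambda>w e. f w (\<lambda>i. e (\<rho> i)))" using * sum.IH(1) by blast
    moreover have "(\<lambda>j. case_nat i e (?\<rho> j)) = case_nat i (\<lambda>j. e (\<rho> j))" for i :: nat and e
      by (rule ext) (auto split: nat.split)
    ultimately show "pf d (\<lambda>w e. \<Sum>i<f w (\<lambda>i. e (\<rho> i)). g w (case_nat i (\<lambda>i. e (\<rho> i))))"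
      using pf.sum[of d "\<lambda>w e. f w (\<lambda>i. e (\<rho> i))" "\<lambda>w e. g w (\<lambda>i. e (?\<rho> i))"] by simp
  qed
qed (auto intro: pf.intros pf.one[simplified])

lemma pf_rename: "pf k f \<Longrightarrow> (\<And>i. i < k \<Longrightarrow> \<rho> i < d) \<Longrightarrow> pf d (\<lambda>w e. f w (\<lambda>i. e (\<rho> i)))"
  using pf_rename_aux by blast

text \<open>Under a sum, variable 0 becomes the new index and the substituted functions are shifted
  by one; the shift is an instance of renaming.\<close>

lemma pf_subst_aux:
  "pf k f \<Longrightarrow> \<forall>d g. (\<forall>i<k. pf d (g i)) \<longrightarrow> pf d (\<lambda>w e. f w (\<lambda>i. g i w e))"
proof (induction rule: pf.induct)
  case (sum k f h)
  show ?case
  proof (intro allI impI)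
    fix d and g :: "nat \<Rightarrow> nat list \<Rightarrow> (nat \<Rightarrow> nat) \<Rightarrow> nat" assume *: "\<forall>i<k. pf d (g i)"
    let ?g = "case_nat (\<lambda>w e. e 0) (\<lambda>i w e. g i w (\<lambda>j. e (Suc j)))"
    have "pf (Suc d) (?g i)" if "i < Suc k" for i
    proof (cases i)
      case 0
      then show ?thesis using pf.var[of 0 "Suc d"] by simp
    next
      case (Suc i')
      then have "pf d (g i')" using * that by simp
      then show ?thesis using Suc pf_rename[of d "g i'" Suc "Suc d"] by simp
    qed
    then have "pf (Suc d) (\<lambda>w e. h w (\<lambda>i. ?g i w e))"
      using sum.IH(2)[rule_format, of "Suc d" ?g] by simp
    moreover have "(\<lambda>j. ?g j w (case_nat i e)) = case_nat i (\<lambda>j. g j w e)" for i :: nat and e w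
      by (rule ext) (auto split: nat.split)
    moreover have "pf d (\<lambda>w e. f w (\<lambda>i. g i w e))"
      using sum.IH(1)[rule_format, of d g] * by simp
    ultimately show "pf d (\<lambda>w e. \<Sum>i<f w (\<lambda>i. g i w e). h w (case_nat i (\<lambda>i. g i w e)))"
      using pf.sum[of d "\<lambda>w e. f w (\<lambda>i. g i w e)" "\<lambda>w e. h w (\<lambda>i. ?g i w e)"] by simp
  qed
next
  case (add k f h)
  show ?case
  proof (intro allI impI)
    fix d and g :: "nat \<Rightarrow> nat list \<Rightarrow> (nat \<Rightarrow> nat) \<Rightarrow> nat" assume "\<forall>i<k. pf d (g i)"
    then show "pf d (\<lambda>w e. f w (\<lambda>i. g i w e) + h w (\<lambda>i. g i w e))"
      using add.IH[rule_format, of d g] by (intro pf.add) simp_all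
  qed
next
  case (sub k f h)
  show ?case
  proof (intro allI impI)
    fix d and g :: "nat \<Rightarrow> nat list \<Rightarrow> (nat \<Rightarrow> nat) \<Rightarrow> nat" assume "\<forall>i<k. pf d (g i)"
    then show "pf d (\<lambda>w e. f w (\<lambda>i. g i w e) - h w (\<lambda>i. g i w e))"
      using sub.IH[rule_format, of d g] by (intro pf.sub) simp_all
  qed
next
  case (sym k f s)
  show ?case
  proof (intro allI impI)
    fix d and g :: "nat \<Rightarrow> nat list \<Rightarrow> (nat \<Rightarrow> nat) \<Rightarrow> nat" assume "\<forall>i<k. pf d (g i)"
    then show "pf d (\<lambda>w e. of_bool (contents w (int (f w (\<lambda>i. g i w e))) = s))"
      using sym.IH[rule_format, of d g] by (intro pf.sym) simp_all
  qed
next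
  case (one d)
  show ?case by (intro allI impI pf.one)
next
  case (len d)
  show ?case by (intro allI impI pf.len)
qed simp

lemma pf_subst:
  "pf k f \<Longrightarrow> (\<And>i. i < k \<Longrightarrow> pf d (g i)) \<Longrightarrow> pf d (\<lambda>w e. f w (\<lambda>i. g i w e))"
  using pf_subst_aux[of k f, rule_format, of d g] by simp

lemma poly_mono_nat: "a \<le> b \<Longrightarrow> poly (p :: nat poly) a \<le> poly p b"
  by (induction p) (auto intro!: mult_mono)

section \<open>Evaluation of the functions by counter programs\<close>

definition move_to :: "nat \<Rightarrow> nat \<Rightarrow> com" where
  "move_to a b = While (Nz a) (Dec a ;; Inc b)"

lemma runs_move_to:
  assumes "a \<noteq> b"
  shows "runs w (move_to a b) (r, h, out) (r a * (3 + 2) + 1) (r(a := 0, b := r b + r a), h, out)"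
  unfolding move_to_def
  by (rule runs_WhileI[where f = "\<lambda>i. (r(a := r a - i, b := r b + i), h, out)"])
    (use assms in \<open>auto simp: fun_eq_iff runs_def numeral_eq_Suc\<close>)

text \<open>A counter can only be read by emptying it. The value therefore goes to two registers,
  one of which restores the source.\<close>

definition copy_to :: "nat \<Rightarrow> nat \<Rightarrow> com" where
  "copy_to a b = While (Nz a) (Dec a ;; Inc b ;; Inc (Suc b)) ;; move_to (Suc b) a"

lemma runs_copy_to:
  assumes "a < b" "r b = 0" "r (Suc b) = 0"
  shows "runs w (copy_to a b) (r, h, out) (r a * 12 + 3) (r(b := r a), h, out)"
proof -
  have 1: "runs w (While (Nz a) (Dec a ;; Inc b ;; Inc (Suc b))) (r, h, out) (r a * (5 + 2) + 1)
      (r(a := 0, b := r a, Suc b := r a), h, out)"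
    by (rule runs_WhileI[where f = "\<lambda>i. (r(a := r a - i, b := i, Suc b := i), h, out)"])
      (use assms in \<open>auto simp: fun_eq_iff runs_def numeral_eq_Suc\<close>)
  have 2: "runs w (move_to (Suc b) a) (r(a := 0, b := r a, Suc b := r a), h, out) (r a * (3 + 2) + 1)
      (r(b := r a), h, out)"
  proof -
    have "(r(a := 0, b := r a, Suc b := r a))(Suc b := 0, a := r a) = r(b := r a)"
      using assms by auto
    then show ?thesis
      using runs_move_to[of "Suc b" a w "r(a := 0, b := r a, Suc b := r a)" h out] assms by simp
  qed
  show ?thesis using runs_Seq[OF 1 2] unfolding copy_to_def by (rule runs_mono) simp
qed

lemma runs_rewind:
  "runs w (While (Nz a) (Dec a ;; Bwd)) (r, h, out) (r a * (3 + 2) + 1) (r(a := 0), h - int (r a), out)"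
  by (rule runs_WhileI[where f = "\<lambda>i. (r(a := r a - i), h - int i, out)"])
    (auto simp: fun_eq_iff runs_def numeral_eq_Suc)

lemma runs_monus:
  assumes "a \<noteq> b"
  shows "runs w (While (Nz a) (Dec a ;; Dec b)) (r, h, out) (r a * (3 + 2) + 1)
    (r(a := 0, b := r b - r a), h, out)"
  by (rule runs_WhileI[where f = "\<lambda>i. (r(a := r a - i, b := r b - i), h, out)"])
    (use assms in \<open>auto simp: fun_eq_iff runs_def numeral_eq_Suc\<close>)

lemma runs_clear:
  "runs w (While (Nz a) (Dec a)) (r, h, out) (r a * (1 + 2) + 1) (r(a := 0), h, out)"
  by (rule runs_WhileI[where f = "\<lambda>i. (r(a := r a - i), h, out)"])
    (auto simp: fun_eq_iff runs_def numeral_eq_Suc)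

text \<open>The length is recorded twice, as the result and as the distance for the way back. The
  input has no blank inside, so the first blank marks its end.\<close>

lemma runs_scan:
  assumes "0 \<notin> set w" "r b = 0" "r (Suc b) = 0"
  shows "runs w (While NonBlank (Fwd ;; Inc b ;; Inc (Suc b))) (r, 0, out) (length w * (5 + 2) + 1)
    (r(b := length w, Suc b := length w), int (length w), out)"
proof -
  have "w ! i \<noteq> 0" if "i < length w" for i using assms(1) nth_mem[OF that] by metis
  then show ?thesis
    by (intro runs_WhileI[where f = "\<lambda>i. (r(b := i, Suc b := i), int i, out)"])
      (use assms in \<open>auto simp: fun_eq_iff runs_def numeral_eq_Suc contents_def\<close>)
qed

lemma runs_advance:
  assumes "r (Suc b) = 0"
  shows "runs w (While (Nz b) (Dec b ;; Inc (Suc b) ;; Fwd)) (r, 0, out) (r b * (5 + 2) + 1)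
    (r(b := 0, Suc b := r b), int (r b), out)"
  by (rule runs_WhileI[where f = "\<lambda>i. (r(b := r b - i, Suc b := i), int i, out)"])
    (use assms in \<open>auto simp: fun_eq_iff runs_def numeral_eq_Suc\<close>)

text \<open>The command \<open>c\<close> evaluates \<open>f\<close>: variable \<open>k\<close> lives in register \<open>\<rho> k\<close>, the result goes to
  register \<open>b\<close>, and the registers from \<open>b\<close> on serve as scratch space, zero before and after.\<close>

definition evaluates ::
  "com \<Rightarrow> nat \<Rightarrow> (nat list \<Rightarrow> (nat \<Rightarrow> nat) \<Rightarrow> nat) \<Rightarrow> (nat \<Rightarrow> nat) \<Rightarrow> nat \<Rightarrow> nat poly \<Rightarrow> bool" where
  "evaluates c d f \<rho> b p \<longleftrightarrow> (\<forall>w r out B. 0 \<notin> set w \<longrightarrow> (\<forall>k\<ge>b. r k = 0) \<longrightarrow> length w \<le> B \<longrightarrow>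
     (\<forall>k<d. r (\<rho> k) \<le> B) \<longrightarrow>
     f w (\<lambda>k. r (\<rho> k)) \<le> poly p B \<and>
     runs w c (r, 0, out) (poly p B) (r(b := f w (\<lambda>k. r (\<rho> k))), 0, out))"

lemma evaluatesI:
  assumes "\<And>w r out B. 0 \<notin> set w \<Longrightarrow> \<forall>k\<ge>b. r k = 0 \<Longrightarrow> length w \<le> B \<Longrightarrow> \<forall>k<d. r (\<rho> k) \<le> B \<Longrightarrow>
     f w (\<lambda>k. r (\<rho> k)) \<le> poly p B \<and>
     runs w c (r, 0, out) (poly p B) (r(b := f w (\<lambda>k. r (\<rho> k))), 0, out)"
  shows "evaluates c d f \<rho> b p"
  using assms unfolding evaluates_def by blast

lemma evaluatesD:
  assumes "evaluates c d f \<rho> b p" "0 \<notin> set w" "\<forall>k\<ge>b. r k = 0" "length w \<le> B" "\<forall>k<d. r (\<rho> k) \<le> B"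
  shows "f w (\<lambda>k. r (\<rho> k)) \<le> poly p B"
    "runs w c (r, 0, out) (poly p B) (r(b := f w (\<lambda>k. r (\<rho> k))), 0, out)"
  using assms unfolding evaluates_def by blast+

text \<open>The operands are left in \<open>b\<close> and \<open>Suc b\<close> and combined by
  \<open>c''\<close>. The bound x + y on the result fits both addition and truncated
  subtraction.\<close>

lemma evaluates_binary:
  assumes f: "pf d f" and g: "pf d g" and \<rho>: "\<forall>k<d. \<rho> k < b"
    and c: "evaluates c d f \<rho> b p" and c': "evaluates c' d g \<rho> (Suc b) p'"
    and le: "\<And>x y. F x y \<le> x + y"
    and last: "\<And>w r out. runs w c'' (r, 0, out) (r (Suc b) * 5 + 1)
      (r(b := F (r b) (r (Suc b)), Suc b := 0), 0, out)"
  shows "evaluates (c ;; c' ;; c'') d (\<lambda>w e. F (f w e) (g w e)) \<rho> b (p + 6 * p' + 3)"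
proof (rule evaluatesI)
  fix w :: "nat list" and r :: "nat \<Rightarrow> nat" and out and B :: nat
  assume w: "0 \<notin> set w" and r: "\<forall>k\<ge>b. r k = 0" and B: "length w \<le> B" "\<forall>k<d. r (\<rho> k) \<le> B"
  let ?e = "\<lambda>k. r (\<rho> k)"
  let ?r = "r(b := f w ?e)"
  let ?s = "r(b := f w ?e, Suc b := g w ?e)"
  have g1: "g w (\<lambda>k. ?r (\<rho> k)) = g w ?e" using \<rho> by (auto intro!: pf_local[OF g])
  have B': "\<forall>k<d. ?r (\<rho> k) \<le> B" "\<forall>k\<ge>Suc b. ?r k = 0" using B \<rho> r by auto
  note 1 = evaluatesD[OF c w r B]
  note 2 = evaluatesD[OF c' w B'(2) B(1) B'(1), unfolded g1]
  have "runs w c'' (?s, 0, out) (g w ?e * 5 + 1) (r(b := F (f w ?e) (g w ?e)), 0, out)"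
    using last[of w ?s out] r by (simp add: fun_upd_twist[of b "Suc b"] fun_upd_idem)
  from runs_Seq[OF 1(2) runs_Seq[OF 2(2) this]]
  have "runs w (c ;; c' ;; c'') (r, 0, out) (poly (p + 6 * p' + 3) B) (r(b := F (f w ?e) (g w ?e)), 0, out)"
    by (rule runs_mono) (use 2(1) in simp)
  moreover have "F (f w ?e) (g w ?e) \<le> poly (p + 6 * p' + 3) B"
    using le[of "f w ?e" "g w ?e"] 1(1) 2(1) by simp
  ultimately show "F (f w ?e) (g w ?e) \<le> poly (p + 6 * p' + 3) B \<and>
    runs w (c ;; c' ;; c'') (r, 0, out) (poly (p + 6 * p' + 3) B) (r(b := F (f w ?e) (g w ?e)), 0, out)"
    by blast
qed

lemma evaluates_sym:
  assumes c: "evaluates c d f \<rho> b p"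
  shows "evaluates (c ;; While (Nz b) (Dec b ;; Inc (Suc b) ;; Fwd) ;; If (Sym s) (Inc b) Skip ;;
      While (Nz (Suc b)) (Dec (Suc b) ;; Bwd)) d
    (\<lambda>w e. of_bool (contents w (int (f w e)) = s)) \<rho> b (13 * p + 7)"
proof (rule evaluatesI)
  fix w :: "nat list" and r :: "nat \<Rightarrow> nat" and out and B :: nat
  assume w: "0 \<notin> set w" and r: "\<forall>k\<ge>b. r k = 0" and B: "length w \<le> B" "\<forall>k<d. r (\<rho> k) \<le> B"
  let ?e = "\<lambda>k. r (\<rho> k)"
  define n where "n = f w ?e"
  define v :: nat where "v = of_bool (contents w (int n) = s)"
  note 1 = evaluatesD[OF c w r B, folded n_def]
  have 2: "runs w (While (Nz b) (Dec b ;; Inc (Suc b) ;; Fwd)) (r(b := n), 0, out) (n * (5 + 2) + 1)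
      (r(Suc b := n), int n, out)"
    using runs_advance[of "r(b := n)" b w out] r by (simp add: fun_upd_idem)
  have 3: "runs w (If (Sym s) (Inc b) Skip) (r(Suc b := n), int n, out) (1 + 1)
      (r(Suc b := n, b := v), int n, out)"
  proof (rule runs_If)
    assume "holds w (r(Suc b := n), int n, out) (Sym s)"
    then show "runs w (Inc b) (r(Suc b := n), int n, out) 1 (r(Suc b := n, b := v), int n, out)"
      using r runs_Inc[of w b "r(Suc b := n)"] by (simp add: v_def)
  next
    assume "\<not> holds w (r(Suc b := n), int n, out) (Sym s)"
    then have "r(Suc b := n, b := v) = r(Suc b := n)" using r by (simp add: v_def fun_upd_idem_iff)
    then show "runs w Skip (r(Suc b := n), int n, out) 1 (r(Suc b := n, b := v), int n, out)"
      using runs_mono[OF runs_Skip] by simp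
  qed
  have 4: "runs w (While (Nz (Suc b)) (Dec (Suc b) ;; Bwd)) (r(Suc b := n, b := v), int n, out)
      (n * (3 + 2) + 1) (r(b := v), 0, out)"
    using runs_rewind[of w "Suc b" "r(Suc b := n, b := v)" "int n" out] r
    by (simp add: fun_upd_twist[of b "Suc b"] fun_upd_idem)
  have "v \<le> 1" by (simp add: v_def)
  then show "of_bool (contents w (int (f w ?e)) = s) \<le> poly (13 * p + 7) B \<and>
    runs w (c ;; While (Nz b) (Dec b ;; Inc (Suc b) ;; Fwd) ;; If (Sym s) (Inc b) Skip ;;
      While (Nz (Suc b)) (Dec (Suc b) ;; Bwd)) (r, 0, out) (poly (13 * p + 7) B)
      (r(b := of_bool (contents w (int (f w ?e)) = s)), 0, out)"
    unfolding n_def[symmetric] v_def[symmetric] using 1(1)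
    by (auto intro!: runs_mono[OF runs_Seq[OF 1(2) runs_Seq[OF 2 runs_Seq[OF 3 4]]]])
qed

text \<open>Register \<open>b\<close> holds the number of summands left, \<open>b + 1\<close> the
  partial sum, \<open>b + 2\<close> the index, and the summand is evaluated from
  \<open>b + 3\<close> on. The index is bounded by the value of \<open>f\<close> and may exceed
  \<open>B\<close>, so the summand is evaluated with the bound B + p(B); this is the origin of
  \<open>pcompose\<close>.\<close>

lemma evaluates_sum:
  assumes f: "pf d f" and g: "pf (Suc d) g" and \<rho>: "\<forall>k<d. \<rho> k < b"
    and c: "evaluates c d f \<rho> b p"
    and c': "evaluates c' (Suc d) g (case_nat (b + 2) \<rho>) (b + 3) p'"
  shows "evaluates
    (c ;; While (Nz b) (Dec b ;; c' ;; move_to (b + 3) (b + 1) ;; Inc (b + 2)) ;;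
     While (Nz (b + 2)) (Dec (b + 2)) ;; move_to (b + 1) b) d
    (\<lambda>w e. \<Sum>i<f w e. g w (case_nat i e)) \<rho> b
    (p * (11 * pcompose p' (p + [:0, 1:]) + 12) + 7)"
proof (rule evaluatesI)
  fix w :: "nat list" and r :: "nat \<Rightarrow> nat" and out and B :: nat
  assume w: "0 \<notin> set w" and r: "\<forall>k\<ge>b. r k = 0" and B: "length w \<le> B" "\<forall>k<d. r (\<rho> k) \<le> B"
  let ?e = "\<lambda>k. r (\<rho> k)"
  define n where "n = f w ?e"
  define G where "G i = g w (case_nat i ?e)" for i
  define B' where "B' = B + poly p B"
  define t where "t = poly p' B'"
  define P where "P = poly p B"
  note 1 = evaluatesD[OF c w r B, folded n_def P_def]
  define s where "s i = r(b := n - i, b + 1 := (\<Sum>j<i. G j), b + 2 := i)" for i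
  have body: "G i \<le> t \<and> runs w (Dec b ;; c' ;; move_to (b + 3) (b + 1) ;; Inc (b + 2)) (s i, 0, out)
      (6 * t + 6) (s (Suc i), 0, out)" if "i < n" for i
  proof -
    let ?s = "(s i)(b := n - Suc i)"
    have e: "g w (\<lambda>k. ?s (case_nat (b + 2) \<rho> k)) = G i"
      unfolding G_def by (rule pf_local[OF g]) (use \<rho> in \<open>auto simp: s_def split: nat.split\<close>)
    have "\<forall>k\<ge>b + 3. ?s k = 0" using r by (auto simp: s_def)
    moreover have "length w \<le> B'" using B by (simp add: B'_def)
    moreover have "\<forall>k<Suc d. ?s (case_nat (b + 2) \<rho> k) \<le> B'"
      using B \<rho> that 1(1) by (auto simp: s_def B'_def P_def trans_le_add1 split: nat.split)
    ultimately have 2: "G i \<le> t" "runs w c' (?s, 0, out) t (?s(b + 3 := G i), 0, out)"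
      using evaluatesD[OF c' w, of ?s B'] unfolding e t_def by blast+
    have 3: "runs w (move_to (b + 3) (b + 1)) (?s(b + 3 := G i), 0, out) (G i * (3 + 2) + 1)
        (?s(b + 1 := (\<Sum>j<Suc i. G j)), 0, out)"
      using runs_move_to[of "b + 3" "b + 1" w "?s(b + 3 := G i)" 0 out] r
      by (simp add: s_def fun_upd_twist[of "b + 3"] fun_upd_idem)
    have 4: "runs w (Inc (b + 2)) (?s(b + 1 := (\<Sum>j<Suc i. G j)), 0, out) 1 (s (Suc i), 0, out)"
      using runs_Inc[of w "b + 2" "?s(b + 1 := (\<Sum>j<Suc i. G j))" 0 out]
      by (simp add: s_def fun_upd_twist)
    have 0: "runs w (Dec b) (s i, 0, out) 1 (?s, 0, out)"
      using runs_Dec[of w b "s i" 0 out] by (simp add: s_def)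
    show ?thesis
    proof
      show "runs w (Dec b ;; c' ;; move_to (b + 3) (b + 1) ;; Inc (b + 2)) (s i, 0, out)
          (6 * t + 6) (s (Suc i), 0, out)"
        by (rule runs_mono[OF runs_Seq[OF 0 runs_Seq[OF 2(2) runs_Seq[OF 3 4]]]]) (use 2(1) in simp)
    qed (fact 2(1))
  qed
  have loop: "runs w (While (Nz b) (Dec b ;; c' ;; move_to (b + 3) (b + 1) ;; Inc (b + 2)))
      (r(b := n), 0, out) (n * (6 * t + 6 + 2) + 1) (s n, 0, out)"
    by (rule runs_WhileI[where f = "\<lambda>i. (s i, 0, out)"])
      (use body r in \<open>auto simp: s_def fun_upd_idem\<close>)
  define S where "S = (\<Sum>j<n. G j)"
  have "S \<le> (\<Sum>j<n. t)" unfolding S_def by (rule sum_mono) (use body in auto)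
  then have S: "S \<le> n * t" by simp
  have sn: "s n = r(b + 1 := S, b + 2 := n)"
    using r by (simp add: s_def S_def fun_upd_idem)
  have clear: "runs w (While (Nz (b + 2)) (Dec (b + 2))) (s n, 0, out) (n * (1 + 2) + 1) (r(b + 1 := S), 0, out)"
    using runs_clear[of w "b + 2" "s n" 0 out] r unfolding sn by (simp add: fun_upd_twist fun_upd_idem)
  have move: "runs w (move_to (b + 1) b) (r(b + 1 := S), 0, out) (S * (3 + 2) + 1) (r(b := S), 0, out)"
    using runs_move_to[of "b + 1" b w "r(b + 1 := S)" 0 out] r by (simp add: fun_upd_twist fun_upd_idem)
  have nP: "n * t \<le> P * t" using 1(1) by (rule mult_le_mono1)
  have pc: "poly (p * (11 * pcompose p' (p + [:0, 1:]) + 12) + 7) B = P * (11 * t + 12) + 7"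
    by (simp add: P_def t_def B'_def poly_pcompose add.commute)
  show "(\<Sum>i<f w ?e. g w (case_nat i ?e)) \<le> poly (p * (11 * pcompose p' (p + [:0, 1:]) + 12) + 7) B \<and>
    runs w (c ;; While (Nz b) (Dec b ;; c' ;; move_to (b + 3) (b + 1) ;; Inc (b + 2)) ;;
     While (Nz (b + 2)) (Dec (b + 2)) ;; move_to (b + 1) b) (r, 0, out)
     (poly (p * (11 * pcompose p' (p + [:0, 1:]) + 12) + 7) B)
     (r(b := \<Sum>i<f w ?e. g w (case_nat i ?e)), 0, out)"
    unfolding pc n_def[symmetric] G_def[symmetric] S_def[symmetric]
  proof
    have e: "P * (11 * t + 12) + 7 = 11 * (P * t) + 12 * P + 7"
      "n * (6 * t + 6 + 2) = 6 * (n * t) + 8 * n" by (simp_all add: algebra_simps)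
    have time: "P + (6 * x + 8 * n + 1 + (n * (1 + 2) + 1 + (S * (3 + 2) + 1) + 1) + 1) + 1
        \<le> 11 * y + 12 * P + 7" if "S \<le> x" "x \<le> y" for x y
      using that 1(1) by simp
    show "S \<le> P * (11 * t + 12) + 7" unfolding e using S nP by linarith
    show "runs w (c ;; While (Nz b) (Dec b ;; c' ;; move_to (b + 3) (b + 1) ;; Inc (b + 2)) ;;
        While (Nz (b + 2)) (Dec (b + 2)) ;; move_to (b + 1) b) (r, 0, out) (P * (11 * t + 12) + 7)
        (r(b := S), 0, out)"
      by (rule runs_mono[OF runs_Seq[OF 1(2) runs_Seq[OF loop runs_Seq[OF clear move]]]])
        (unfold e, rule time[OF S nP])
  qed
qed

lemma pf_evaluates: "pf d f \<Longrightarrow> \<forall>k<d. \<rho> k < b \<Longrightarrow> \<exists>c p. evaluates c d f \<rho> b p"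
proof (induction arbitrary: \<rho> b rule: pf.induct)
  case (one d)
  have "evaluates (Inc b) d (\<lambda>w e. 1) \<rho> b 1"
    by (rule evaluatesI) (auto simp: runs_def)
  then show ?case by blast
next
  case (var k d)
  have "evaluates (copy_to (\<rho> k) b) d (\<lambda>w e. e k) \<rho> b [:3, 12:]"
  proof (rule evaluatesI)
    fix w :: "nat list" and r :: "nat \<Rightarrow> nat" and out and B :: nat
    assume "0 \<notin> set w" "\<forall>k\<ge>b. r k = 0" "length w \<le> B" "\<forall>k<d. r (\<rho> k) \<le> B"
    then show "r (\<rho> k) \<le> poly [:3, 12:] B \<and>
      runs w (copy_to (\<rho> k) b) (r, 0, out) (poly [:3, 12:] B) (r(b := r (\<rho> k)), 0, out)"
      using var by (fastforce intro: runs_mono[OF runs_copy_to])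
  qed
  then show ?case by blast
next
  case (add d f g)
  from add.IH(1)[of \<rho> b] add.IH(2)[of \<rho> "Suc b"] add.prems
  obtain c p c' p' where "evaluates c d f \<rho> b p" "evaluates c' d g \<rho> (Suc b) p'"
    by (meson less_SucI)
  from evaluates_binary[OF add.hyps add.prems this, of "(+)" "move_to (Suc b) b"]
  show ?case using runs_move_to[of "Suc b" b] by (auto simp: fun_upd_twist)
next
  case (sub d f g)
  from sub.IH(1)[of \<rho> b] sub.IH(2)[of \<rho> "Suc b"] sub.prems
  obtain c p c' p' where "evaluates c d f \<rho> b p" "evaluates c' d g \<rho> (Suc b) p'"
    by (meson less_SucI)
  note binary = evaluates_binary[OF sub.hyps sub.prems this]
  have "x - y \<le> x + y" for x y :: nat by simp
  from binary[of "(-)", OF this, of "While (Nz (Suc b)) (Dec (Suc b) ;; Dec b)"]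
  show ?case using runs_monus[of "Suc b" b] by (auto simp: fun_upd_twist)
next
  case (len d)
  have "evaluates (While NonBlank (Fwd ;; Inc b ;; Inc (Suc b)) ;;
      While (Nz (Suc b)) (Dec (Suc b) ;; Bwd)) d (\<lambda>w e. length w) \<rho> b [:3, 12:]"
  proof (rule evaluatesI)
    fix w :: "nat list" and r :: "nat \<Rightarrow> nat" and out and B :: nat
    assume w: "0 \<notin> set w" and r: "\<forall>k\<ge>b. r k = 0" and B: "length w \<le> B" "\<forall>k<d. r (\<rho> k) \<le> B"
    have 1: "runs w (While NonBlank (Fwd ;; Inc b ;; Inc (Suc b))) (r, 0, out) (length w * (5 + 2) + 1)
        (r(b := length w, Suc b := length w), int (length w), out)"
      using runs_scan[OF w] r by simp
    have 2: "runs w (While (Nz (Suc b)) (Dec (Suc b) ;; Bwd))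
        (r(b := length w, Suc b := length w), int (length w), out) (length w * (3 + 2) + 1)
        (r(b := length w), 0, out)"
      using runs_rewind[of w "Suc b" "r(b := length w, Suc b := length w)" "int (length w)" out] r
      by (simp add: fun_upd_twist fun_upd_idem)
    show "length w \<le> poly [:3, 12:] B \<and> runs w (While NonBlank (Fwd ;; Inc b ;; Inc (Suc b)) ;;
      While (Nz (Suc b)) (Dec (Suc b) ;; Bwd)) (r, 0, out) (poly [:3, 12:] B) (r(b := length w), 0, out)"
      using B by (auto intro!: runs_mono[OF runs_Seq[OF 1 2]])
  qed
  then show ?case by blast
next
  case (sym d f s)
  then obtain c p where "evaluates c d f \<rho> b p" by blast
  from evaluates_sym[OF this] show ?case by blast
next
  case (sum d f g)
  from sum.IH(1)[of \<rho> b] sum.IH(2)[of "case_nat (b + 2) \<rho>" "b + 3"] sum.prems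
  obtain c p c' p' where "evaluates c d f \<rho> b p"
    "evaluates c' (Suc d) g (case_nat (b + 2) \<rho>) (b + 3) p'"
    by (fastforce split: nat.split intro: less_trans)
  from evaluates_sum[OF sum.hyps sum.prems this] show ?case by blast
qed

text \<open>The output is produced bit by bit from formulas for its length and for the bit at a
  given position. Register 0 holds the number of bits left, register 1 the position.\<close>

lemma poly_timeI:
  assumes L: "pf 0 (\<lambda>w e. L w)" and g: "pf 1 (\<lambda>w e. of_bool (g w (e 0)))"
    and inp: "\<And>a. 0 \<notin> set (inp a)"
    and out: "\<And>a. out a = bits (map (g (inp a)) [0..<L (inp a)])"
  shows "poly_time inp out"
proof -
  obtain c p where c: "evaluates c 0 (\<lambda>w e. L w) id 0 p" using pf_evaluates[OF L, of id 0] by auto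
  obtain c' p' where c': "evaluates c' 1 (\<lambda>w e. of_bool (g w (e 0))) (\<lambda>_. 1) 2 p'"
    using pf_evaluates[OF g, of "\<lambda>_. 1" 2] by auto
  define body where "body = Dec 0 ;; c' ;; If (Nz 2) (Dec 2 ;; Out True) (Out False) ;; Inc 1"
  define P where "P = p * (pcompose p' (p + [:0, 1:]) + 11) + 2 + p"
  have "\<exists>m. runs (inp a) (c ;; While (Nz 0) body) (\<lambda>_. 0, 0, []) (poly P (length (inp a))) m \<and>
      bits (snd (snd m)) = out a" for a
  proof -
    define w where "w = inp a"
    have w: "0 \<notin> set w" using inp by (simp add: w_def)
    define n where "n = L w"
    define s where "s i = (\<lambda>_::nat. 0)(0 := n - i, 1 := i)" for i :: nat
    define B where "B = length w"
    define t where "t = poly p' (B + poly p B)"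
    have 1: "n \<le> poly p B" "runs w c (\<lambda>_. 0, 0, []) (poly p B) (s 0, 0, [])"
      using evaluatesD(1)[OF c w, of "\<lambda>_. 0" B] evaluatesD(2)[OF c w, of "\<lambda>_. 0" B "[]"]
      by (auto simp: n_def B_def s_def fun_upd_idem)
    have "runs w body (s i, 0, map (g w) [0..<i]) (t + 9) (s (Suc i), 0, map (g w) [0..<Suc i])"
      if "i < n" for i
    proof -
      let ?s = "(s i)(0 := n - Suc i)" and ?o = "map (g w) [0..<i]"
      have 0: "runs w (Dec 0) (s i, 0, ?o) 1 (?s, 0, ?o)"
        using runs_Dec[of w 0 "s i" 0 ?o] by (simp add: s_def)
      have 2: "runs w c' (?s, 0, ?o) t (?s(2 := of_bool (g w i)), 0, ?o)"
        using evaluatesD(2)[OF c' w, of ?s "B + poly p B" ?o] that 1(1)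
        by (simp add: s_def B_def t_def)
      have 3: "runs w (If (Nz 2) (Dec 2 ;; Out True) (Out False)) (?s(2 := of_bool (g w i)), 0, ?o) (3 + 1)
          (?s, 0, ?o @ [g w i])"
        by (rule runs_If) (auto simp: runs_def numeral_eq_Suc s_def fun_eq_iff split: if_splits)
      have 4: "runs w (Inc 1) (?s, 0, ?o @ [g w i]) 1 (s (Suc i), 0, map (g w) [0..<Suc i])"
        using runs_Inc[of w 1 ?s 0 "?o @ [g w i]"] by (simp add: s_def)
      show ?thesis unfolding body_def
        by (rule runs_mono[OF runs_Seq[OF 0 runs_Seq[OF 2 runs_Seq[OF 3 4]]]]) simp
    qed
    then have loop: "runs w (While (Nz 0) body) (s 0, 0, []) (n * (t + 9 + 2) + 1) (s n, 0, map (g w) [0..<n])"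
      by (intro runs_WhileI[where f = "\<lambda>i. (s i, 0, map (g w) [0..<i])"]) (auto simp: s_def)
    have "n * (t + 11) \<le> poly p B * (t + 11)" using 1(1) by (rule mult_le_mono1)
    then have "poly p B + (n * (t + 9 + 2) + 1) + 1 \<le> poly P B"
      by (simp add: P_def t_def poly_pcompose algebra_simps)
    then have "runs w (c ;; While (Nz 0) body) (\<lambda>_. 0, 0, []) (poly P B) (s n, 0, map (g w) [0..<n])"
      by (rule runs_mono[OF runs_Seq[OF 1(2) loop]])
    then show ?thesis using out[of a] by (auto simp: w_def n_def B_def)
  qed
  then show ?thesis by (rule run_on_tm)
qed

section \<open>Arithmetic, bounded logic and finite tables within the class\<close>

named_theorems pf_rules

lemmas [pf_rules] = pf.var pf.add pf.sub pf.len pf.sym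

lemma pf_one [pf_rules]: "pf d (\<lambda>w e. 1)"
  by (rule pf.one)

lemma pf_const: "pf d (\<lambda>w e. c)"
proof (induction c)
  case 0
  show ?case using pf.sub[OF pf.one[of d] pf.one] by simp
next
  case (Suc c)
  show ?case using pf.add[OF Suc pf.one] by simp
qed

lemmas [pf_rules] = pf_const

lemma pf_sum [pf_rules]:
  assumes "pf d f" "pf (Suc d) (\<lambda>w e. g w (\<lambda>k. e (Suc k)) (e 0))"
  shows "pf d (\<lambda>w e. \<Sum>i<f w e. g w e i)"
  using pf.sum[OF assms] by simp

lemma pf_mult [pf_rules]:
  assumes "pf d f" "pf d g"
  shows "pf d (\<lambda>w e. f w e * g w e)"
  using pf.sum[OF assms(1) pf_rename[OF assms(2), of Suc "Suc d"]] by (simp add: mult.commute)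

lemma pf_comp1:
  assumes "pf 1 (\<lambda>w e. h w (e 0))" "pf d f"
  shows "pf d (\<lambda>w e. h w (f w e))"
  using pf_subst[OF assms(1), of d "\<lambda>_. f"] assms(2) by simp

lemma pf_comp2:
  assumes "pf 2 (\<lambda>w e. h w (e 0) (e 1))" "pf d f" "pf d g"
  shows "pf d (\<lambda>w e. h w (f w e) (g w e))"
  using pf_subst[OF assms(1), of d "case_nat f (\<lambda>_. g)"] assms(2,3)
  by (auto split: nat.split)

lemma pf_comp3:
  assumes "pf 3 (\<lambda>w e. h w (e 0) (e 1) (e 2))" "pf d f" "pf d g" "pf d f'"
  shows "pf d (\<lambda>w e. h w (f w e) (g w e) (f' w e))"
proof -
  have "pf d (case_nat f (case_nat g (\<lambda>_. f')) i)" for i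
    using assms(2-4) by (auto split: nat.split)
  then show ?thesis
    using pf_subst[OF assms(1), of d "case_nat f (case_nat g (\<lambda>_. f'))"] by (simp add: numeral_2_eq_2)
qed

lemma pf_le [pf_rules]: "pf d f \<Longrightarrow> pf d g \<Longrightarrow> pf d (\<lambda>w e. of_bool (f w e \<le> g w e))"
proof -
  assume "pf d f" "pf d g"
  then have "pf d (\<lambda>w e. 1 - (f w e - g w e))" by (intro pf_rules)
  moreover have "1 - (x - y) = of_bool (x \<le> y)" for x y :: nat by simp
  ultimately show ?thesis by simp
qed

lemma pf_not [pf_rules]: "pf d (\<lambda>w e. of_bool (P w e)) \<Longrightarrow> pf d (\<lambda>w e. of_bool (\<not> P w e))"
proof -
  assume "pf d (\<lambda>w e. of_bool (P w e))"
  then have "pf d (\<lambda>w e. 1 - of_bool (P w e))" by (intro pf_rules)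
  moreover have "1 - of_bool p = (of_bool (\<not> p) :: nat)" for p by simp
  ultimately show ?thesis by simp
qed

lemma pf_conj [pf_rules]:
  assumes "pf d (\<lambda>w e. of_bool (P w e))" "pf d (\<lambda>w e. of_bool (Q w e))"
  shows "pf d (\<lambda>w e. of_bool (P w e \<and> Q w e))"
  using pf_mult[OF assms] by (simp add: of_bool_conj)

lemma pf_disj [pf_rules]:
  assumes "pf d (\<lambda>w e. of_bool (P w e))" "pf d (\<lambda>w e. of_bool (Q w e))"
  shows "pf d (\<lambda>w e. of_bool (P w e \<or> Q w e))"
  using pf_not[OF pf_conj[OF pf_not[OF assms(1)] pf_not[OF assms(2)]]] by simp

lemma pf_imp [pf_rules]:
  assumes "pf d (\<lambda>w e. of_bool (P w e))" "pf d (\<lambda>w e. of_bool (Q w e))"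
  shows "pf d (\<lambda>w e. of_bool (P w e \<longrightarrow> Q w e))"
  using pf_disj[OF pf_not[OF assms(1)] assms(2)] by simp

lemma pf_iff [pf_rules]:
  assumes "pf d (\<lambda>w e. of_bool (P w e))" "pf d (\<lambda>w e. of_bool (Q w e))"
  shows "pf d (\<lambda>w e. of_bool (P w e \<longleftrightarrow> Q w e))"
proof -
  have "(p \<longleftrightarrow> q) \<longleftrightarrow> (p \<longrightarrow> q) \<and> (q \<longrightarrow> p)" for p q by blast
  then show ?thesis using pf_conj[OF pf_imp[OF assms] pf_imp[OF assms(2,1)]] by (simp only:)
qed

lemma pf_less [pf_rules]: "pf d f \<Longrightarrow> pf d g \<Longrightarrow> pf d (\<lambda>w e. of_bool (f w e < g w e))"
  using pf_not[OF pf_le[of d g f]] by (simp add: not_le)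

lemma pf_eq [pf_rules]: "pf d f \<Longrightarrow> pf d g \<Longrightarrow> pf d (\<lambda>w e. of_bool (f w e = g w e))"
  using pf_conj[OF pf_le[of d f g] pf_le[of d g f]] by (simp add: order_eq_iff)

lemma pf_if [pf_rules]:
  assumes "pf d (\<lambda>w e. of_bool (P w e))" "pf d f" "pf d g"
  shows "pf d (\<lambda>w e. if P w e then f w e else g w e)"
proof -
  have "(if p then x else y) = of_bool p * x + of_bool (\<not> p) * y" for p and x y :: nat by simp
  then show ?thesis using assms by (simp only:) (intro pf_rules)
qed

lemma pf_if_bool [pf_rules]:
  assumes "pf d (\<lambda>w e. of_bool (P w e))" "pf d (\<lambda>w e. of_bool (Q w e))" "pf d (\<lambda>w e. of_bool (R w e))"
  shows "pf d (\<lambda>w e. of_bool (if P w e then Q w e else R w e))"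
  using pf_if[OF assms] by (simp add: if_distrib cong: if_cong)

lemma pf_ex [pf_rules]:
  assumes "pf d f" "pf (Suc d) (\<lambda>w e. of_bool (P w (\<lambda>k. e (Suc k)) (e 0)))"
  shows "pf d (\<lambda>w e. of_bool (\<exists>i<f w e. P w e i))"
proof -
  have "(\<exists>i<n. p i) \<longleftrightarrow> 1 \<le> (\<Sum>i<n. of_bool (p i) :: nat)" for n :: nat and p
  proof -
    have "(\<Sum>i<n. of_bool (p i) :: nat) = 0 \<longleftrightarrow> (\<forall>i<n. \<not> p i)"
      by auto
    then show ?thesis by (metis less_one not_le)
  qed
  then show ?thesis using assms by (simp only:) (intro pf_rules)
qed

lemma pf_all [pf_rules]:
  assumes "pf d f" "pf (Suc d) (\<lambda>w e. of_bool (P w (\<lambda>k. e (Suc k)) (e 0)))"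
  shows "pf d (\<lambda>w e. of_bool (\<forall>i<f w e. P w e i))"
  using pf_not[OF pf_ex[OF assms(1) pf_not[OF assms(2)]]] by simp

lemma pf_div [pf_rules]:
  assumes "pf d f" "pf d g"
  shows "pf d (\<lambda>w e. f w e div g w e)"
proof (rule pf_comp2[OF _ assms])
  \<comment> \<open>The quotient counts the positive multiples of b up to a; the conjunct 0 < b
    reproduces division by zero.\<close>
  have "a div b = (\<Sum>i<a. of_bool (0 < b \<and> (i + 1) * b \<le> a))" for a b :: nat
  proof (cases "b = 0")
    case False
    have "{i. i < a \<and> (i + 1) * b \<le> a} = {..<a div b}"
    proof (intro set_eqI iffI)
      fix i assume "i \<in> {..<a div b}"
      then have "Suc i \<le> a div b" by simp
      then have "Suc i * b \<le> a" using False by (simp add: less_eq_div_iff_mult_less_eq)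
      moreover have "i < Suc i * b" using False by (cases b) auto
      ultimately show "i \<in> {i. i < a \<and> (i + 1) * b \<le> a}" by simp
    next
      fix i assume "i \<in> {i. i < a \<and> (i + 1) * b \<le> a}"
      then show "i \<in> {..<a div b}" using False by (simp add: less_eq_div_iff_mult_less_eq flip: Suc_le_eq)
    qed
    then show ?thesis using False by (simp add: sum.If_cases of_bool_def Int_def lessThan_def)
  qed simp
  then show "pf 2 (\<lambda>w e. e 0 div e 1)" by (simp only:) (intro pf_rules; simp)
qed

lemma pf_mod [pf_rules]:
  assumes "pf d f" "pf d g"
  shows "pf d (\<lambda>w e. f w e mod g w e)"
  unfolding modulo_nat_def using assms by (intro pf_rules)

lemma pf_poly [pf_rules]: "pf d f \<Longrightarrow> pf d (\<lambda>w e. poly p (f w e))"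
proof (induction p)
  case (pCons c p)
  then show ?case unfolding poly_pCons by (intro pf_rules) auto
qed (simp add: pf_const)

text \<open>\<open>K\<close> is a constant, so this is a finite case distinction, and the dependence
  on \<open>c\<close> may be arbitrary. In this way the transition table of a fixed machine becomes
  computable.\<close>

lemma pf_finite_less:
  assumes "pf d f" "\<And>c. c < K \<Longrightarrow> pf d (\<lambda>w e. of_bool (P w e c))"
  shows "pf d (\<lambda>w e. of_bool (f w e < K \<and> P w e (f w e)))"
  using assms(2)
proof (induction K)
  case 0
  show ?case using pf_const[of d 0] by simp
next
  case (Suc K)
  have "pf d (\<lambda>w e. of_bool ((f w e < K \<and> P w e (f w e)) \<or> (f w e = K \<and> P w e K)))"
    using Suc by (intro pf_disj[OF Suc.IH] pf_conj pf_eq pf_const assms(1)) auto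
  moreover have "(f w e < Suc K \<and> P w e (f w e)) \<longleftrightarrow>
      ((f w e < K \<and> P w e (f w e)) \<or> (f w e = K \<and> P w e K))" for w e by (auto simp: less_Suc_eq)
  ultimately show ?case by simp
qed

lemma pf_table2:
  assumes "pf d f" "pf d g"
  shows "pf d (\<lambda>w e. of_bool (f w e < K \<and> g w e < L \<and> P (f w e) (g w e)))"
  by (intro pf_finite_less assms pf_const)

lemma pf_table1:
  assumes "pf d f"
  shows "pf d (\<lambda>w e. of_bool (f w e < K \<and> P (f w e)))"
  by (intro pf_finite_less assms pf_const)

section \<open>Binary numbers and the encoding of instances\<close>

text \<open>A power of two is a positive number whose only odd divisor is 1. The exponential is not
  polynomially bounded and hence outside the class; instead, the exponent of a given power is found
  by counting the smaller powers.\<close>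

definition is_pow2 :: "nat \<Rightarrow> bool" where
  "is_pow2 m \<longleftrightarrow> 0 < m \<and> (\<forall>d<m + 1. m mod d = 0 \<longrightarrow> d = 1 \<or> d mod 2 = 0)"

lemma is_pow2_iff: "is_pow2 m \<longleftrightarrow> (\<exists>t. m = 2 ^ t)"
proof
  assume m: "is_pow2 m"
  show "\<exists>t. m = 2 ^ t"
    using m
  proof (induction m rule: less_induct)
    case (less m)
    show ?case
    proof (cases "m = 1")
      case True
      then show ?thesis by (metis power_0)
    next
      case False
      then have "even m" using less.prems unfolding is_pow2_def by (metis even_iff_mod_2_eq_zero less_add_one mod_self)
      then obtain k where k: "m = 2 * k" by blast
      have "is_pow2 k" unfolding is_pow2_def
      proof (intro conjI allI impI)
        show "0 < k" using less.prems k by (simp add: is_pow2_def)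
        fix d assume "d < k + 1" "k mod d = 0"
        then have "d < m + 1" "m mod d = 0" using k by (auto simp: mod_eq_0_iff_dvd)
        then show "d = 1 \<or> d mod 2 = 0" using less.prems by (simp add: is_pow2_def)
      qed
      moreover have "k < m" using k less.prems by (simp add: is_pow2_def)
      ultimately obtain t where "k = 2 ^ t" using less.IH by blast
      then show ?thesis using k by (metis power_Suc)
    qed
  qed
next
  assume "\<exists>t. m = 2 ^ t"
  then obtain t where t: "m = 2 ^ t" by blast
  have "d = 1 \<or> even d" if "d dvd m" for d
  proof -
    have "odd d \<Longrightarrow> coprime d (2 ^ t)" by simp
    then show ?thesis using that t by (metis coprime_absorb_left nat_dvd_1_iff_1)
  qed
  then show "is_pow2 m" using t by (auto simp: is_pow2_def mod_eq_0_iff_dvd)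
qed

lemma pow2_below: "{i. i < 2 ^ t \<and> is_pow2 i} = (\<lambda>j. 2 ^ j) ` {..<t}"
  by (auto simp: is_pow2_iff)

lemma count_pow2: "(\<Sum>i<2 ^ t. of_bool (is_pow2 i)) = t"
  using pow2_below[of t]
  by (simp add: sum.If_cases of_bool_def Int_def lessThan_def card_image inj_on_def)

lemma eq_pow2_iff: "m = 2 ^ t \<longleftrightarrow> is_pow2 m \<and> (\<Sum>i<m. of_bool (is_pow2 i)) = t"
  using count_pow2 by (auto simp: is_pow2_iff)

lemma pf_is_pow2 [pf_rules]: "pf d f \<Longrightarrow> pf d (\<lambda>w e. of_bool (is_pow2 (f w e)))"
  by (rule pf_comp1) (unfold is_pow2_def, (intro pf_rules; simp))

lemma pf_eq_pow2 [pf_rules]: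
  "pf d f \<Longrightarrow> pf d g \<Longrightarrow> pf d (\<lambda>w e. of_bool (f w e = 2 ^ g w e))"
  by (rule pf_comp2) (unfold eq_pow2_iff, (intro pf_rules; simp))

lemma pf_odd_div [pf_rules]:
  assumes "pf d f" "pf d g"
  shows "pf d (\<lambda>w e. of_bool (odd (f w e div 2 ^ g w e)))"
proof (rule pf_comp2[OF _ assms])
  \<comment> \<open>If the power exceeds k, the quotient is 0 and hence even, so a search up to k
    suffices.\<close>
  have "odd (k div 2 ^ t) \<longleftrightarrow> (\<exists>m<k + 1. m = 2 ^ t \<and> k div m mod 2 = 1)" for k t :: nat
  proof -
    have "(\<exists>m<k + 1. m = 2 ^ t \<and> k div m mod 2 = 1) \<longleftrightarrow> 2 ^ t < k + 1 \<and> odd (k div 2 ^ t)"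
      unfolding odd_iff_mod_2_eq_one by blast
    moreover have "k div 2 ^ t = 0" if "\<not> 2 ^ t < k + 1" using that by simp
    ultimately show ?thesis by force
  qed
  then show "pf 2 (\<lambda>w e. of_bool (odd (e 0 div 2 ^ e 1)))" by (simp only:) (intro pf_rules; simp)
qed

text \<open>The powers of two up to \<open>k\<close> correspond to the binary digits of
  \<open>k\<close>.\<close>

definition bit_length :: "nat \<Rightarrow> nat" where
  "bit_length k = (\<Sum>m<k + 1. of_bool (is_pow2 m))"

lemma pf_bit_length [pf_rules]: "pf d f \<Longrightarrow> pf d (\<lambda>w e. bit_length (f w e))"
  by (rule pf_comp1) (unfold bit_length_def, (intro pf_rules; simp))

lemma binary_eq: "binary k = map (\<lambda>t. odd (k div 2 ^ t)) [0..<bit_length k]"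
proof (induction k rule: less_induct)
  case (less k)
  show ?case
  proof (cases "k = 0")
    case True
    then show ?thesis by (simp add: binary.simps bit_length_def is_pow2_def)
  next
    case False
    have "bit_length k = Suc (bit_length (k div 2))"
    proof -
      have card: "bit_length n = card {m. m < Suc n \<and> is_pow2 m}" for n
        by (simp add: bit_length_def sum.If_cases of_bool_def Int_def lessThan_def)
      have "{m. m < Suc k \<and> is_pow2 m} = insert 1 ((\<lambda>m. 2 * m) ` {m. m < Suc (k div 2) \<and> is_pow2 m})"
        (is "?l = ?r")
      proof
        show "?l \<subseteq> ?r"
        proof
          fix m assume "m \<in> ?l"
          then obtain t where t: "m = 2 ^ t" "m \<le> k" by (auto simp: is_pow2_iff)
          show "m \<in> ?r"
          proof (cases t)
            case (Suc s)
            then have "2 ^ s < Suc (k div 2)" using t by simp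
            then show ?thesis using t Suc by (auto simp: is_pow2_iff image_iff)
          qed (use t in simp)
        qed
        show "?r \<subseteq> ?l" using False by (auto simp: is_pow2_iff intro: exI[of _ 0] exI[of _ "Suc t" for t])
      qed
      moreover have "1 \<notin> (\<lambda>m. 2 * m) ` {m::nat. m < Suc (k div 2) \<and> is_pow2 m}" by auto
      ultimately show ?thesis unfolding card
        by (simp add: card_insert_if card_image inj_on_def)
    qed
    then show ?thesis using False less.IH[of "k div 2"]
      by (simp add: binary.simps[of k] map_upt_Suc div_mult2_eq del: upt_Suc)
  qed
qed

lemma concat_matrix:
  "concat (map (\<lambda>i. map (f i) [0..<n]) [0..<m]) = map (\<lambda>q. f (q div n) (q mod n)) [0..<m * n]"
proof (induction m)
  case (Suc m)
  have split: "[0..<Suc m * n] = [0..<m * n] @ map (\<lambda>j. j + m * n) [0..<n]"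
    using upt_add_eq_append[of 0 "m * n" n] map_add_upt[of "m * n" n] by (simp add: add.commute)
  have "map (\<lambda>q. f (q div n) (q mod n)) (map (\<lambda>j. j + m * n) [0..<n]) = map (f m) [0..<n]"
    by (simp add: comp_def)
  then show ?case using Suc unfolding split by simp
qed simp

definition instance_length :: "nat \<Rightarrow> nat \<Rightarrow> nat" where
  "instance_length n k = n + 1 + n * n + bit_length k"

text \<open>The code of an instance as a function of the position, the form in which an output is
  computed bit by bit.\<close>

definition instance_bit :: "nat \<Rightarrow> (nat \<Rightarrow> nat \<Rightarrow> bool) \<Rightarrow> nat \<Rightarrow> nat \<Rightarrow> bool" where
  "instance_bit n E k p = (if p < n then True else if p = n then False
     else if p < n + 1 + n * n then E ((p - (n + 1)) div n) ((p - (n + 1)) mod n)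
     else odd (k div 2 ^ (p - (n + 1 + n * n))))"

lemma encode_instance_eq:
  "encode_instance n E k =
     map (instance_bit n (\<lambda>i j. (i, j) \<in> E) k) [0..<instance_length n k]"
proof (rule nth_equalityI)
  have adj: "adjacency_matrix n E = map (\<lambda>q. (q div n, q mod n) \<in> E) [0..<n * n]"
    unfolding adjacency_matrix_def by (rule concat_matrix)
  show "length (encode_instance n E k) =
      length (map (instance_bit n (\<lambda>i j. (i, j) \<in> E) k) [0..<instance_length n k])"
    by (simp add: encode_instance_def adj binary_eq instance_length_def)
  fix p assume "p < length (encode_instance n E k)"
  then have "p < instance_length n k"
    by (simp add: encode_instance_def adj binary_eq instance_length_def)
  then show "encode_instance n E k ! p =
      map (instance_bit n (\<lambda>i j. (i, j) \<in> E) k) [0..<instance_length n k] ! p"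
    by (auto simp: encode_instance_def adj binary_eq instance_bit_def nth_append nth_Cons'
        instance_length_def not_less simp del: upt_Suc)
qed

section \<open>Layered tournaments without a 7-snake\<close>

text \<open>\<open>ty\<close> is the layer, and \<open>bk p q\<close> a backedge with left end
  \<open>p\<close>. A right end has at most one partner in each layer, and so has a left end outside
  layer 0, where the graph vertices branch. No backedge ends in layer 2 or 4.\<close>

locale layered =
  fixes ty :: "nat \<Rightarrow> nat" and bk :: "nat \<Rightarrow> nat \<Rightarrow> bool"
  assumes ty_mono: "p \<le> q \<Longrightarrow> ty p \<le> ty q"
    and bk_ty: "bk p q \<Longrightarrow> (ty p, ty q) \<in> {(0, 5), (0, 6), (1, 6), (1, 3), (3, 5)}"
    and bk_left_unique: "bk p q \<Longrightarrow> bk p' q \<Longrightarrow> ty p = ty p' \<Longrightarrow> p = p'"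
    and bk_right_unique: "bk p q \<Longrightarrow> bk p q' \<Longrightarrow> ty p \<noteq> 0 \<Longrightarrow> ty q = ty q' \<Longrightarrow> q = q'"
    and nested: "bk p q \<Longrightarrow> bk p' q' \<Longrightarrow> ty p = ty p' \<Longrightarrow> ty q = ty q' \<Longrightarrow>
      (ty p, ty q) \<in> {(1, 3), (3, 5)} \<Longrightarrow> p < p' \<Longrightarrow> q' < q"
begin

definition arc :: "nat \<Rightarrow> nat \<Rightarrow> bool" where
  "arc p q \<longleftrightarrow> p < q \<and> \<not> bk p q \<or> bk q p"

lemma ty_less: "ty p < ty q \<Longrightarrow> p < q"
  using ty_mono by (meson not_le)

lemma bk_less: "bk p q \<Longrightarrow> p < q"
  using bk_ty[of p q] by (auto intro: ty_less[of p q])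

lemma arc_back: "arc p q \<Longrightarrow> ty q < ty p \<Longrightarrow> bk q p"
  using ty_less[of q p] by (auto simp: arc_def)

lemma arc_same: "arc p q \<Longrightarrow> ty p = ty q \<Longrightarrow> p < q"
  using bk_ty[of q p] by (auto simp: arc_def)

lemma arc_asym: "arc p q \<Longrightarrow> \<not> arc q p"
  using bk_less[of p q] bk_less[of q p] by (auto simp: arc_def)

text \<open>Left ends lie in layers up to 3, right ends in layers from 3 on. Unless \<open>v\<close>
  and \<open>u'\<close> both lie in layer 3, \<open>u'\<close> is in a lower layer than
  \<open>v\<close>, and the arc from \<open>v\<close> to \<open>u'\<close> comes from a second
  backedge at \<open>v\<close>. Uniqueness and the list of layer pairs then leave no place for
  \<open>u\<close> or for \<open>v'\<close>.\<close>

lemma two_backedges: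
  assumes "bk u v" "bk u' v'" "arc u u'" "arc u v'" "arc v u'" "arc v v'"
  shows "ty u = 1 \<and> ty v = 3 \<and> ty u' = 3 \<and> ty v' = 5 \<and> v < u'"
proof -
  have ne: "u \<noteq> u'" "v \<noteq> v'" "v \<noteq> u'" using assms arc_asym by metis+
  have v: "bk u' v" if "ty u' < ty v" using that assms by (intro arc_back)
  have u: "bk u' u" if "ty u' < ty u" using that assms by (intro arc_back)
  have v': "bk v' v" if "ty v' < ty v" using that assms by (intro arc_back)
  have vu: "v < u'" if "ty v = ty u'" using that assms by (intro arc_same)
  from bk_ty[OF assms(1)] bk_ty[OF assms(2)] show ?thesis
    using u v v' vu ne bk_left_unique[OF assms(1), of u'] bk_right_unique[OF assms(2), of v]
     bk_ty[of u' u] bk_ty[of u' v] bk_ty[of v' v]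
    by auto
qed

text \<open>A 7-snake consists of two cyclic triangles, all arcs between them leading from the first to the
  second, and a vertex \<open>x\<close> with exactly one out-neighbour in the first and exactly one in-neighbour
  in the second triangle.\<close>

lemma no_link:
  assumes A: "bk l m" "arc l w" "arc w m"
    and B: "bk m' r" "arc m' w'" "arc w' r"
    and AB: "\<And>a b. a \<in> {l, m, w} \<Longrightarrow> b \<in> {m', r, w'} \<Longrightarrow> arc a b"
    and x: "(arc x l \<and> arc w x \<and> arc m x) \<or> (arc l x \<and> arc x w \<and> arc m x) \<or> (arc l x \<and> arc w x \<and> arc x m)"
    and y: "(arc m' x \<and> arc x w' \<and> arc x r) \<or> (arc x m' \<and> arc w' x \<and> arc x r) \<or> (arc x m' \<and> arc x w' \<and> arc r x)"
  shows False
proof -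
  have t: "ty l = 1" "ty m = 3" "ty m' = 3" "ty r = 5" "m < m'"
    using two_backedges[OF A(1) B(1)] AB by auto
  have lm: "l < m" and mr: "m' < r" using bk_less A B by auto
  \<comment> \<open>A backedge with left end \<open>m\<close> would by \<open>two_backedges\<close>
    put \<open>m\<close> into layer 1. Hence \<open>w\<close> lies between \<open>l\<close> and
    \<open>m\<close> in the order, and dually \<open>w'\<close> between \<open>m'\<close> and
    \<open>r\<close>.\<close>
  have "\<not> bk m w" using two_backedges[of m w m' r] B AB t by auto
  then have wm: "w < m" using A(3) by (auto simp: arc_def)
  have lw: "l < w" using A(2) t bk_ty[of w l] by (auto simp: arc_def)
  have "\<not> bk w' m'" using two_backedges[of l m w' m'] A AB t by auto
  then have mw: "m' < w'" using B(2) by (auto simp: arc_def)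
  have wr: "w' < r" using B(3) t bk_ty[of r w'] by (auto simp: arc_def)
  \<comment> \<open>Each alternative in \<open>y\<close> has an arc from \<open>x\<close> to
    \<open>m'\<close> or to \<open>r\<close>. If \<open>x\<close> in layer 5 is joined to a vertex
    of layer 3 before \<open>m'\<close>, then nesting puts it behind \<open>r\<close> and uniqueness
    keeps it from being joined to \<open>m'\<close>, so it has neither arc.\<close>
  have past: False if "bk p x" "ty p = 3" "ty x = 5" "p < m'" for p
  proof -
    have "\<not> arc x m'" using arc_back[of x m'] t that bk_left_unique[OF that(1), of m'] by auto
    moreover have "\<not> arc x r" using arc_same[of x r] t that nested[OF that(1) B(1)] by auto
    ultimately show False using y by blast
  qed
  have "m \<noteq> x" "l \<noteq> x" using x arc_asym by metis+
  consider "arc x l" "arc w x" "arc m x" | "arc l x" "arc x w" "arc m x" | "arc l x" "arc w x" "arc x m"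
    using x by blast
  then show False
  proof cases
    case 1
    show False
    proof (cases "bk l x")
      case True
      \<comment> \<open>From layer 6 no arc leads back to layer 3 or 5, so \<open>x\<close> cannot
        reach \<open>m'\<close> or \<open>r\<close>.\<close>
      then have "ty x = 6" using bk_ty[OF True] t \<open>m \<noteq> x\<close> bk_right_unique[OF A(1) True] by auto
      then have "\<not> arc x m'" "\<not> arc x r"
        using arc_back[of x m'] arc_back[of x r] t bk_ty[of m' x] bk_ty[of r x] by auto
      then show False using y by blast
    next
      case False
      then have "x < l" using 1 by (auto simp: arc_def)
      then have "ty x \<le> 1" using ty_mono[of x l] t by simp
      then have "bk x m" using 1 t by (intro arc_back) auto
      then show False using bk_left_unique[OF A(1) \<open>bk x m\<close>] bk_ty[OF \<open>bk x m\<close>] t \<open>l \<noteq> x\<close> by auto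
    qed
  next
    case 2
    \<comment> \<open>Otherwise \<open>x\<close> would be the left end of a backedge to
      \<open>m\<close>, but the only such left end is \<open>l\<close>.\<close>
    have "m < x" using 2 bk_left_unique[OF A(1), of x] bk_ty[of x m] t \<open>l \<noteq> x\<close>
      by (auto simp: arc_def)
    then have wx: "bk w x" using 2 wm by (auto simp: arc_def)
    have "ty w = 1 \<or> ty w = 3" using bk_ty[OF wx] ty_mono[of l w] ty_mono[of w m] lw wm t by auto
    then show False
    proof
      assume w1: "ty w = 1"
      have "ty x \<noteq> 3" using nested[OF A(1) wx] w1 t lw \<open>m < x\<close> by auto
      then have "ty x = 6" using bk_ty[OF wx] w1 by auto
      then have "\<not> arc x m'" "\<not> arc x r"
        using arc_back[of x m'] arc_back[of x r] t bk_ty[of m' x] bk_ty[of r x] by auto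
      then show False using y by blast
    next
      assume w3: "ty w = 3"
      then have "ty x = 5" using bk_ty[OF wx] by auto
      then show False using past[OF wx] w3 wm t by auto
    qed
  next
    case 3
    show False
    proof (cases "bk m x")
      case True
      then have "ty x = 5" using bk_ty[OF True] t by auto
      then show False using past[OF True] t by auto
    next
      case False
      then have "x < m" "\<not> bk x m" using 3 arc_asym by (auto simp: arc_def)
      have lx: "l < x" using 3 bk_ty[of x l] t by (auto simp: arc_def)
      have ty_x: "ty x \<in> {1, 2, 3}" using ty_mono[of l x] ty_mono[of x m] lx \<open>x < m\<close> t by auto
      \<comment> \<open>Now \<open>x\<close> lies between \<open>l\<close> and \<open>m\<close> in
        the order, while \<open>y\<close> demands an arc to \<open>x\<close> from the second
        triangle. It would come from a backedge with left end \<open>x\<close>, which nesting with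
        (l, m) or (m', r), or uniqueness at \<open>r\<close>, excludes.\<close>
      have "\<not> arc m' x"
      proof
        assume "arc m' x"
        then have b: "bk x m'" using \<open>x < m\<close> t by (auto simp: arc_def)
        then have "ty x = 1" using bk_ty[OF b] t by auto
        then show False using nested[OF A(1) b] t lx by auto
      qed
      moreover have "\<not> arc r x"
      proof
        assume "arc r x"
        then have b: "bk x r" using \<open>x < m\<close> t mr by (auto simp: arc_def)
        then have "ty x = 3" using bk_ty[OF b] t ty_x by auto
        then show False using bk_left_unique[OF B(1) b] t \<open>x < m\<close> by auto
      qed
      moreover have "\<not> arc w' x"
      proof
        assume "arc w' x"
        then have b: "bk x w'" using \<open>x < m\<close> t mw by (auto simp: arc_def)
        have "ty w' \<le> 5" using ty_mono[of w' r] wr t by auto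
        then consider "ty x = 1" "ty w' = 3" | "ty x = 3" "ty w' = 5" using bk_ty[OF b] ty_x by auto
        then show False
        proof cases
          case 1
          then show False using nested[OF A(1) b] t lx mw by auto
        next
          case 2
          then show False using nested[OF b B(1)] t \<open>x < m\<close> wr by auto
        qed
      qed
      ultimately show False using y by blast
    qed
  qed
qed

lemma triangle_backedge:
  assumes "arc a b" "arc b c" "arc c a"
  shows "bk b a \<or> bk c b \<or> bk a c"
  using assms unfolding arc_def by (meson less_trans less_irrefl)

lemma no_snake:
  assumes "\<And>i j. (i, j) \<in> snake7_arcs \<Longrightarrow> arc (v i) (v j)"
  shows False
proof -
  have s: "(i, j) \<in> snake7_arcs"
    if "i \<in> {1..7} \<and> j \<in> {1..7} \<and> (i = j + 1 \<or> i + 2 \<le> j)" for i j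
    using that by (auto simp: snake7_arcs_def)
  have a: "arc (v 2) (v 1)" "arc (v 1) (v 3)" "arc (v 3) (v 2)"
    "arc (v 6) (v 5)" "arc (v 5) (v 7)" "arc (v 7) (v 6)"
    "arc (v 1) (v 4)" "arc (v 2) (v 4)" "arc (v 4) (v 3)"
    "arc (v 5) (v 4)" "arc (v 4) (v 6)" "arc (v 4) (v 7)"
    by (auto intro!: assms s)
  have AB: "arc (v i) (v j)" if "i \<in> {1, 2, 3}" "j \<in> {5, 6, 7}" for i j
    using that by (auto intro!: assms s)
  have A: "bk (v 1) (v 2) \<or> bk (v 3) (v 1) \<or> bk (v 2) (v 3)"
    using triangle_backedge[OF a(1-3)] .
  have B: "bk (v 5) (v 6) \<or> bk (v 7) (v 5) \<or> bk (v 6) (v 7)"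
    using triangle_backedge[OF a(4-6)] .
  \<comment> \<open>Which pair of a triangle carries the backedge is open, so \<open>no_link\<close>
    is applied to all nine combinations; \<open>k\<close> and \<open>k'\<close> are the remaining
    vertices.\<close>
  have C: False if "bk (v i) (v j)" "arc (v i) (v k)" "arc (v k) (v j)" "{i, j, k} = {1, 2, 3}"
    "bk (v i') (v j')" "arc (v i') (v k')" "arc (v k') (v j')" "{i', j', k'} = {5, 6, 7}" for i j k i' j' k'
  proof (rule no_link[OF that(1-3) that(5-7), of "v 4"])
    show "arc p q" if "p \<in> {v i, v j, v k}" "q \<in> {v i', v j', v k'}" for p q
    proof -
      from that obtain a b where "p = v a" "a \<in> {i, j, k}" "q = v b" "b \<in> {i', j', k'}" by blast
      then show ?thesis using AB \<open>{i, j, k} = {1, 2, 3}\<close> \<open>{i', j', k'} = {5, 6, 7}\<close> by simp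
    qed
    have "3 \<in> {i, j, k}" "1 \<in> {i, j, k}" "2 \<in> {i, j, k}" using that(4) by auto
    then show "(arc (v 4) (v i) \<and> arc (v k) (v 4) \<and> arc (v j) (v 4)) \<or>
      (arc (v i) (v 4) \<and> arc (v 4) (v k) \<and> arc (v j) (v 4)) \<or>
      (arc (v i) (v 4) \<and> arc (v k) (v 4) \<and> arc (v 4) (v j))"
      using a(7-9) by auto
    have "5 \<in> {i', j', k'}" "6 \<in> {i', j', k'}" "7 \<in> {i', j', k'}" using that(8) by auto
    then show "(arc (v i') (v 4) \<and> arc (v 4) (v k') \<and> arc (v 4) (v j')) \<or>
      (arc (v 4) (v i') \<and> arc (v k') (v 4) \<and> arc (v 4) (v j')) \<or>
      (arc (v 4) (v i') \<and> arc (v 4) (v k') \<and> arc (v j') (v 4))"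
      using a(10-12) by auto
  qed
  have sets: "{1, 2, 3 :: nat} = {1, 2, 3}" "{3, 1, 2 :: nat} = {1, 2, 3}" "{2, 3, 1 :: nat} = {1, 2, 3}"
    "{5, 6, 7 :: nat} = {5, 6, 7}" "{7, 5, 6 :: nat} = {5, 6, 7}" "{6, 7, 5 :: nat} = {5, 6, 7}" by auto
  show False
    using A B C[of 1 2 3 5 6 7] C[of 1 2 3 7 5 6] C[of 1 2 3 6 7 5]
      C[of 3 1 2 5 6 7] C[of 3 1 2 7 5 6] C[of 3 1 2 6 7 5]
      C[of 2 3 1 5 6 7] C[of 2 3 1 7 5 6] C[of 2 3 1 6 7 5] a(1-6) sets by blast
qed

lemma snake7_free_arcs: "snake7_free {..<n} {(p, q). p < n \<and> q < n \<and> arc p q}"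
  unfolding snake7_free_def
proof
  let ?E = "{(p, q). p < n \<and> q < n \<and> arc p q}"
  assume "\<exists>S\<subseteq>{..<n}. digraph_isomorphic S (induced ?E S) snake7_verts snake7_arcs"
  then obtain S f where f: "bij_betw f S snake7_verts"
    "\<And>u v. u \<in> S \<Longrightarrow> v \<in> S \<Longrightarrow> (u, v) \<in> induced ?E S \<longleftrightarrow> (f u, f v) \<in> snake7_arcs"
    unfolding digraph_isomorphic_def by blast
  define v where "v = inv_into S f"
  have v: "v i \<in> S" "f (v i) = i" if "i \<in> snake7_verts" for i
    using f(1) that by (auto simp: v_def bij_betw_def inv_into_into f_inv_into_f)
  show False
  proof (rule no_snake[of v])
    fix i j assume ij: "(i, j) \<in> snake7_arcs"
    then have "i \<in> snake7_verts" "j \<in> snake7_verts"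
      using tournament_snake7 by (auto simp: tournament_def)
    then have "(v i, v j) \<in> induced ?E S" using f(2)[of "v i" "v j"] v ij by simp
    then show "arc (v i) (v j)" by (simp add: induced_def)
  qed
qed

lemma tournament_arcs: "tournament {..<n} {(p, q). p < n \<and> q < n \<and> arc p q}"
  unfolding tournament_def
proof (intro conjI ballI impI)
  let ?E = "{(p, q). p < n \<and> q < n \<and> arc p q}"
  show "irrefl ?E" using arc_asym by (auto simp: irrefl_def)
  fix p q assume "p \<in> {..<n}" "q \<in> {..<n}" "p \<noteq> q"
  moreover have "arc p q \<or> arc q p" using \<open>p \<noteq> q\<close> by (auto simp: arc_def)
  ultimately show "(p, q) \<in> ?E \<longleftrightarrow> (q, p) \<notin> ?E" using arc_asym[of p q] by auto
qed auto

end

section \<open>From independent sets in graphs to tournaments\<close>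

text \<open>One more than n graph vertices and two vertices for each pair, which is the most that a
  set above the threshold can leave out; so it meets every layer. Layers have equal size for the
  sake of the coding, and the surplus vertices touch no backedge.\<close>

definition block :: "nat \<Rightarrow> nat" where
  "block n = n + 2 * (n * n) + 1"

text \<open>Vertex \<open>p\<close> is the vertex number \<open>p mod block n\<close> of layer \<open>p div block n\<close>. Layer 0 contains
  the vertices of the graph. The pair \<open>(u, v)\<close> with code \<open>i = u * n + v\<close> contributes a path from
  \<open>u\<close> to \<open>v\<close> through the vertices \<open>i\<close> of layer 6, \<open>i\<close> of layer 1, \<open>n\<^sup>2 - 1 - i\<close> of layer 3 and \<open>i\<close> of
  layer 5. The reversal in layer 3 nests the edges between the layers 1, 3 and 5.\<close>

definition linked :: "nat \<Rightarrow> (nat \<Rightarrow> nat \<Rightarrow> bool) \<Rightarrow> nat \<Rightarrow> nat \<Rightarrow> nat \<Rightarrow> nat \<Rightarrow> bool" where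
  "linked n A t i t' j \<longleftrightarrow>
     t = 0 \<and> t' = 6 \<and> j < n * n \<and> i = j div n \<and> A (j div n) (j mod n) \<or>
     t = 0 \<and> t' = 5 \<and> j < n * n \<and> i = j mod n \<and> A (j div n) (j mod n) \<or>
     t = 1 \<and> t' = 6 \<and> j < n * n \<and> i = j \<or>
     t = 1 \<and> t' = 3 \<and> i + j + 1 = n * n \<or>
     t = 3 \<and> t' = 5 \<and> i + j + 1 = n * n"

definition backedge :: "nat \<Rightarrow> (nat \<Rightarrow> nat \<Rightarrow> bool) \<Rightarrow> nat \<Rightarrow> nat \<Rightarrow> bool" where
  "backedge n A p q \<longleftrightarrow>
     linked n A (p div block n) (p mod block n) (q div block n) (q mod block n)"

lemma pair_code_less:
  assumes "u < a" "v < b"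
  shows "u * b + v < a * (b :: nat)"
proof -
  have "u * b + v < (u + 1) * b" using assms(2) by simp
  also have "\<dots> \<le> a * b" using assms(1) by (intro mult_le_mono1) simp
  finally show ?thesis .
qed

lemma div_mod_eqI: "p div k = q div k \<Longrightarrow> p mod k = q mod k \<Longrightarrow> p = (q :: nat)"
  by (metis div_mult_mod_eq)

lemma mod_less_of_less: "p < q \<Longrightarrow> p div k = q div k \<Longrightarrow> p mod k < q mod (k :: nat)"
  by (metis add_less_cancel_left div_mult_mod_eq)

lemma less_of_mod_less: "p div k = q div k \<Longrightarrow> p mod k < q mod k \<Longrightarrow> p < (q :: nat)"
  by (metis add_less_cancel_left div_mult_mod_eq)

interpretation layered "\<lambda>p. p div block n" "backedge n A" for n A
proof
  show "p div block n \<le> q div block n" if "p \<le> q" for p q using that by (rule div_le_mono)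
  show "(p div block n, q div block n) \<in> {(0, 5), (0, 6), (1, 6), (1, 3), (3, 5)}"
    if "backedge n A p q" for p q
    using that by (auto simp: backedge_def linked_def)
  show "p = p'" if "backedge n A p q" "backedge n A p' q" "p div block n = p' div block n" for p q p'
    using that by (intro div_mod_eqI[of p "block n" p']) (auto simp: backedge_def linked_def)
  show "q = q'" if "backedge n A p q" "backedge n A p q'" "p div block n \<noteq> 0"
    "q div block n = q' div block n" for p q q'
    using that by (intro div_mod_eqI[of q "block n" q']) (auto simp: backedge_def linked_def)
  show "q' < q" if "backedge n A p q" "backedge n A p' q'" "p div block n = p' div block n"
    "q div block n = q' div block n"
    "(p div block n, q div block n) \<in> {(1, 3), (3, 5)}" "p < p'" for p q p' q'
    using that mod_less_of_less[OF that(6,3)]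
    by (intro less_of_mod_less[of q' "block n" q]) (auto simp: backedge_def linked_def)
qed

definition gadget_arcs :: "nat \<Rightarrow> (nat \<Rightarrow> nat \<Rightarrow> bool) \<Rightarrow> nat rel" where
  "gadget_arcs n A = {(p, q). p < 7 * block n \<and> q < 7 * block n \<and>
     (p < q \<and> \<not> backedge n A p q \<or> backedge n A q p)}"

lemma tournament_gadget: "tournament {..<7 * block n} (gadget_arcs n A)"
  and snake7_free_gadget: "snake7_free {..<7 * block n} (gadget_arcs n A)"
  using tournament_arcs[of "7 * block n" n A] snake7_free_arcs[of "7 * block n" n A]
  by (simp_all add: gadget_arcs_def arc_def)

lemma block_div: "i < block n \<Longrightarrow> (t * block n + i) div block n = t"
  and block_mod: "i < block n \<Longrightarrow> (t * block n + i) mod block n = i"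
  by auto

lemma backedgeI:
  assumes i: "i < n * n"
  shows "A (i div n) (i mod n) \<Longrightarrow> backedge n A (i div n) (6 * block n + i)"
    and "A (i div n) (i mod n) \<Longrightarrow> backedge n A (i mod n) (5 * block n + i)"
    and "backedge n A (1 * block n + i) (6 * block n + i)"
    and "backedge n A (1 * block n + i) (3 * block n + (n * n - 1 - i))"
    and "backedge n A (3 * block n + (n * n - 1 - i)) (5 * block n + i)"
proof -
  have n: "0 < n" using i by (cases n) auto
  have "i div n < n" using i by (simp add: less_mult_imp_div_less)
  moreover have "i mod n < n" using n by simp
  ultimately have "i div n < block n" "i mod n < block n" "i < block n" "n * n - 1 - i < block n"
    using i unfolding block_def by linarith+
  note b = block_div[OF this(3)] block_mod[OF this(3)] block_div[OF this(4)] block_mod[OF this(4)]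
    this(1,2)
  show "A (i div n) (i mod n) \<Longrightarrow> backedge n A (i div n) (6 * block n + i)"
    and "A (i div n) (i mod n) \<Longrightarrow> backedge n A (i mod n) (5 * block n + i)"
    and "backedge n A (1 * block n + i) (6 * block n + i)"
    and "backedge n A (1 * block n + i) (3 * block n + (n * n - 1 - i))"
    and "backedge n A (3 * block n + (n * n - 1 - i)) (5 * block n + i)"
    unfolding backedge_def b using b(5,6) i by (auto simp: linked_def)
qed

lemma backedgeE:
  assumes "backedge n A p q"
  obtains i where "i < n * n" "A (i div n) (i mod n)" "p = i div n" "q = 6 * block n + i"
  | i where "i < n * n" "A (i div n) (i mod n)" "p = i mod n" "q = 5 * block n + i"
  | i where "i < n * n" "p = 1 * block n + i" "q = 6 * block n + i"
  | i where "i < n * n" "p = 1 * block n + i" "q = 3 * block n + (n * n - 1 - i)"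
  | i where "i < n * n" "p = 3 * block n + (n * n - 1 - i)" "q = 5 * block n + i"
proof -
  have p: "p = p div block n * block n + p mod block n" and q: "q = q div block n * block n + q mod block n"
    by simp_all
  from assms consider
    "p div block n = 0" "q div block n = 6" "q mod block n < n * n" "p mod block n = q mod block n div n"
      "A (q mod block n div n) (q mod block n mod n)"
  | "p div block n = 0" "q div block n = 5" "q mod block n < n * n" "p mod block n = q mod block n mod n"
      "A (q mod block n div n) (q mod block n mod n)"
  | "p div block n = 1" "q div block n = 6" "q mod block n < n * n" "p mod block n = q mod block n"
  | "p div block n = 1" "q div block n = 3" "p mod block n + q mod block n + 1 = n * n"
  | "p div block n = 3" "q div block n = 5" "p mod block n + q mod block n + 1 = n * n"
    unfolding backedge_def linked_def by (elim disjE conjE) simp_all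
  then show thesis
  proof cases
    case 1
    then show thesis using that(1)[of "q mod block n"] p q by simp
  next
    case 2
    then show thesis using that(2)[of "q mod block n"] p q by simp
  next
    case 3
    then show thesis using that(3)[of "q mod block n"] p q by simp
  next
    case 4
    then show thesis using that(4)[of "p mod block n"] p q by simp
  next
    case 5
    then show thesis using that(5)[of "q mod block n"] p q by simp
  qed
qed

text \<open>Besides the graph vertices outside \<open>Y\<close>, the cover \<open>D\<close> takes
  every other inner vertex of each path, beginning with the first one if \<open>u\<close> is in
  \<open>Y\<close> and with the second one otherwise. In the former case the edge at
  \<open>v\<close> is covered by \<open>v\<close>, which is outside \<open>Y\<close> if the pair is
  an edge.\<close>

lemma cover_of_graph_set:
  assumes Y: "Y \<subseteq> {..<n}" "\<And>u v. u \<in> Y \<Longrightarrow> v \<in> Y \<Longrightarrow> \<not> A u v"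
  shows "\<exists>S. independent_set {..<7 * block n} (gadget_arcs n A) S \<and>
    card S \<ge> 7 * block n + card Y - (n + 2 * (n * n))"
proof -
  define f where "f i = (if i div n \<in> Y then 6 * block n + i else 1 * block n + i)" for i
  define g where "g i = (if i div n \<in> Y then 3 * block n + (n * n - 1 - i) else 5 * block n + i)" for i
  define D where "D = ({..<n} - Y) \<union> f ` {..<n * n} \<union> g ` {..<n * n}"
  define S where "S = {..<7 * block n} - D"
  have fD: "f i \<in> D" and gD: "g i \<in> D" if "i < n * n" for i using that by (auto simp: D_def)
  have cover: "p \<in> D \<or> q \<in> D" if "backedge n A p q" for p q
    using that
  proof (cases rule: backedgeE)
    case (1 i)
    then have "i div n < n" by (simp add: less_mult_imp_div_less)
    then show ?thesis using 1 fD[of i] by (cases "i div n \<in> Y") (simp_all add: f_def, simp add: D_def)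
  next
    case (2 i)
    then have "0 < n" by (cases n) auto
    show ?thesis
    proof (cases "i div n \<in> Y")
      case True
      then have "i mod n \<notin> Y" using 2 Y(2) by blast
      then show ?thesis using 2 \<open>0 < n\<close> by (auto simp: D_def)
    next
      case False
      then have "g i = q" using 2 by (simp add: g_def)
      then show ?thesis using gD[OF 2(1)] by simp
    qed
  next
    case (3 i)
    then show ?thesis using fD[of i] by (cases "i div n \<in> Y") (simp_all add: f_def)
  next
    case (4 i)
    then show ?thesis using fD[of i] gD[of i] by (cases "i div n \<in> Y") (simp_all add: f_def g_def)
  next
    case (5 i)
    then show ?thesis using gD[of i] by (cases "i div n \<in> Y") (simp_all add: g_def)
  qed
  \<comment> \<open>No backedge survives, so the arcs inside \<open>S\<close> are given by the order
    of the numbers.\<close>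
  have "induced (gadget_arcs n A) S = {(p, q). p \<in> S \<and> q \<in> S \<and> p < q}"
    using cover by (auto simp: induced_def gadget_arcs_def S_def)
  then have "trans (induced (gadget_arcs n A) S)" by (auto simp: trans_def)
  moreover have "S \<subseteq> {..<7 * block n}" by (auto simp: S_def)
  ultimately have "independent_set {..<7 * block n} (gadget_arcs n A) S"
    by (simp add: independent_set_def)
  moreover have "card S \<ge> 7 * block n + card Y - (n + 2 * (n * n))"
  proof -
    have "finite Y" using Y(1) finite_subset by blast
    have "card D \<le> card ({..<n} - Y) + card (f ` {..<n * n}) + card (g ` {..<n * n})"
      unfolding D_def by (meson card_Un_le le_trans add_le_mono1)
    also have "\<dots> \<le> (n - card Y) + n * n + n * n"
      using card_image_le[of "{..<n * n}" f] card_image_le[of "{..<n * n}" g] Y(1) \<open>finite Y\<close>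
      by (simp add: card_Diff_subset)
    finally have "card D \<le> (n - card Y) + 2 * (n * n)" by simp
    moreover have "card Y \<le> n" using card_mono[OF _ Y(1)] by simp
    moreover have "7 * block n - card D \<le> card S"
      using diff_card_le_card_Diff[of D "{..<7 * block n}"] by (simp add: S_def D_def)
    ultimately show ?thesis by simp
  qed
  ultimately show ?thesis by blast
qed

text \<open>The complement \<open>D\<close> of \<open>S\<close> turns out to cover all backedges. It
  contains at least two inner vertices of each path, and three if the pair is an edge with both ends
  outside \<open>D\<close>. Dropping one end of each such edge is paid for by these extra
  vertices.\<close>

lemma graph_set_of_cover:
  assumes S: "independent_set {..<7 * block n} (gadget_arcs n A) S"
    and card: "card S \<ge> 7 * block n + m - (n + 2 * (n * n))"
  shows "\<exists>Y\<subseteq>{..<n}. (\<forall>u\<in>Y. \<forall>v\<in>Y. \<not> A u v) \<and> m \<le> card Y"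
proof -
  let ?K = "block n" and ?M = "n * n"
  define D where "D = {..<7 * ?K} - S"
  have sub: "S \<subseteq> {..<7 * ?K}" and tr: "trans (induced (gadget_arcs n A) S)"
    using S by (auto simp: independent_set_def)
  have finS: "finite S" using sub finite_subset by blast
  have "card D + card S = 7 * ?K"
    using sub card_mono[OF _ sub] finS by (simp add: D_def card_Diff_subset)
  then have cardD: "card D + m \<le> n + 2 * ?M" using card by (simp add: block_def)
  have block_meets: "\<exists>s\<in>S. s div ?K = t" if "t < 7" for t
  proof (rule ccontr)
    assume *: "\<not> ?thesis"
    have "(\<lambda>i. t * ?K + i) ` {..<?K} \<subseteq> D"
    proof (clarsimp simp: D_def, safe)
      fix i assume i: "i < ?K"
      have "t * ?K + i < (t + 1) * ?K" using i by simp
      also have "\<dots> \<le> 7 * ?K" using that by (intro mult_le_mono1) simp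
      finally show "t * ?K + i < 7 * ?K" .
      assume "t * ?K + i \<in> S"
      then show False using * block_div[OF i] by blast
    qed
    then have "card ((\<lambda>i. t * ?K + i) ` {..<?K}) \<le> card D"
      by (rule card_mono[rotated]) (simp add: D_def)
    then have "?K \<le> card D" by (simp add: card_image inj_on_def)
    then show False using cardD by (simp add: block_def)
  qed
  obtain w2 where w2: "w2 \<in> S" "w2 div ?K = 2" using block_meets[of 2] by auto
  obtain w4 where w4: "w4 \<in> S" "w4 div ?K = 4" using block_meets[of 4] by auto
  have cover: "p \<in> D \<or> q \<in> D" if b: "backedge n A p q" "p < 7 * ?K" "q < 7 * ?K" for p q
  proof (rule ccontr)
    assume "\<not> ?thesis"
    then have pq: "p \<in> S" "q \<in> S" using b by (auto simp: D_def)
    \<comment> \<open>Layer 2 or layer 4 lies strictly between the layers of the two ends. Its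
      vertex \<open>s\<close> would close a cyclic triangle with the backedge.\<close>
    obtain s where s: "s \<in> S" "p div ?K < s div ?K" "s div ?K < q div ?K" "s div ?K \<in> {2, 4}"
      using bk_ty[OF b(1)] w2 w4 by force
    have no: "\<not> backedge n A s r" "\<not> backedge n A r s" for r
      using s(4) bk_ty[of n A s r] bk_ty[of n A r s] by auto
    have "p < s" "s < q" using ty_less s by blast+
    then have "(q, p) \<in> induced (gadget_arcs n A) S" "(p, s) \<in> induced (gadget_arcs n A) S"
      using b pq s no sub by (auto simp: induced_def gadget_arcs_def)
    then have "(q, s) \<in> induced (gadget_arcs n A) S" using tr by (rule transD[rotated])
    then show False using \<open>s < q\<close> no by (auto simp: induced_def gadget_arcs_def)
  qed
  define b l c r where "b i = 6 * ?K + i" and "l i = 1 * ?K + i" and "c i = 3 * ?K + (?M - 1 - i)"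
    and "r i = 5 * ?K + i" for i
  note defs = b_def l_def c_def r_def
  define G where "G i = {b i, l i, c i, r i}" for i
  define X where "X = {..<n} - D"
  define Viol where "Viol = {i. i < ?M \<and> A (i div n) (i mod n) \<and> i div n \<in> X \<and> i mod n \<in> X}"
  have less: "b i < 7 * ?K" "l i < 7 * ?K" "c i < 7 * ?K" "r i < 7 * ?K" "n \<le> l i" if "i < ?M" for i
    using that by (auto simp: defs block_def)
  have distinct: "l i \<noteq> c j" "l i \<noteq> r j" "l i \<noteq> b j" "c i \<noteq> r j" "c i \<noteq> b j" "r i \<noteq> b j"
    if "i < ?M" "j < ?M" for i j
    using that by (auto simp: defs block_def)
  have Gcard: "2 + of_bool (i \<in> Viol) \<le> card (D \<inter> G i)" if i: "i < ?M" for i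
  proof -
    note e = backedgeI(1,2)[OF i, of A] backedgeI(3-5)[OF i, of A]
    have 1: "l i \<in> D \<or> b i \<in> D" using cover e(3) less[OF i] by (simp add: defs)
    have 2: "l i \<in> D \<or> c i \<in> D" using cover e(4) less[OF i] by (simp add: defs)
    have 3: "c i \<in> D \<or> r i \<in> D" using cover e(5) less[OF i] by (simp add: defs)
    have fin: "finite (D \<inter> G i)" by (simp add: G_def)
    show ?thesis
    proof (cases "i \<in> Viol")
      case True
      then have v: "A (i div n) (i mod n)" "i div n \<in> X" "i mod n \<in> X" by (auto simp: Viol_def)
      have "i div n < n" "i mod n < n" using v by (simp_all only: X_def Diff_iff lessThan_iff)
      moreover have "n \<le> 7 * ?K" by (simp add: block_def)
      ultimately have "i div n < 7 * ?K" "i mod n < 7 * ?K" using less_le_trans by blast+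
      then have "b i \<in> D" "r i \<in> D"
        using cover[OF e(1)[OF v(1)]] cover[OF e(2)[OF v(1)]] v less[OF i] by (auto simp: X_def defs)
      then obtain y where "{b i, r i, y} \<subseteq> D \<inter> G i" "y \<in> {l i, c i}" using 2 by (auto simp: G_def)
      then have "card {b i, r i, y} \<le> card (D \<inter> G i)" "y \<noteq> b i" "y \<noteq> r i" "r i \<noteq> b i"
        using distinct[OF i i] by (auto intro!: card_mono fin)
      then show ?thesis using True by (simp add: card_insert_if)
    next
      case False
      obtain x y where "{x, y} \<subseteq> D \<inter> G i" "x \<in> {l i, b i}" "y \<in> {c i, r i}" using 1 3 by (auto simp: G_def)
      then have "card {x, y} \<le> card (D \<inter> G i)" "x \<noteq> y"
        using distinct[OF i i] by (auto intro!: card_mono fin)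
      then show ?thesis using False by simp
    qed
  qed
  have Gdisj: "G i \<inter> G j = {}" if "i < ?M" "j < ?M" "i \<noteq> j" for i j
  proof -
    have "b i \<noteq> b j" "l i \<noteq> l j" "c i \<noteq> c j" "r i \<noteq> r j" using that by (auto simp: defs)
    then show ?thesis using distinct[OF that(1,2)] distinct[OF that(2,1)] by (auto simp: G_def)
  qed
  have finV: "finite Viol" by (simp add: Viol_def)
  have finD: "finite D" by (simp add: D_def)
  have "2 * ?M + card Viol = (\<Sum>i<?M. 2 + of_bool (i \<in> Viol))"
  proof -
    have "{..<?M} \<inter> Viol = Viol" by (auto simp: Viol_def)
    then show ?thesis unfolding sum.distrib by simp
  qed
  also have "\<dots> \<le> (\<Sum>i<?M. card (D \<inter> G i))" by (rule sum_mono) (use Gcard in auto)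
  also have "\<dots> = card (\<Union>i<?M. D \<inter> G i)"
    by (rule card_UN_disjoint[symmetric]) (use Gdisj finD in auto)
  finally have G: "2 * ?M + card Viol \<le> card (\<Union>i<?M. D \<inter> G i)" .
  have "card (D \<inter> {..<n}) + card (\<Union>i<?M. D \<inter> G i) = card ((D \<inter> {..<n}) \<union> (\<Union>i<?M. D \<inter> G i))"
  proof (rule card_Un_disjoint[symmetric])
    show "D \<inter> {..<n} \<inter> (\<Union>i<?M. D \<inter> G i) = {}"
      by (auto simp: G_def defs block_def)
  qed (use finD in auto)
  also have "\<dots> \<le> card D" by (rule card_mono[OF finD]) auto
  finally have "card (D \<inter> {..<n}) + 2 * ?M + card Viol + m \<le> n + 2 * ?M" using G cardD by linarith
  moreover have "card X + card (D \<inter> {..<n}) = n"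
  proof -
    have "card ({..<n} - D) + card ({..<n} \<inter> D) = card {..<n}"
      by (metis card_Diff_subset_Int card_Int_Diff finite_Int finite_lessThan add.commute)
    then show ?thesis by (simp add: X_def Int_commute)
  qed
  ultimately have cX: "card Viol + m \<le> card X" by linarith
  define Y where "Y = X - (\<lambda>i. i div n) ` Viol"
  have "card X - card ((\<lambda>i. i div n) ` Viol) \<le> card Y"
    unfolding Y_def by (rule diff_card_le_card_Diff) (use finV in simp)
  then have "m \<le> card Y" using cX card_image_le[OF finV, of "\<lambda>i. i div n"] by linarith
  moreover have "\<not> A u v" if uv: "u \<in> Y" "v \<in> Y" for u v
  proof
    assume "A u v"
    have "u < n" "v < n" using uv by (auto simp: Y_def X_def)
    then have i: "(u * n + v) div n = u" "(u * n + v) mod n = v" "u * n + v < ?M"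
      using pair_code_less[of u n v n] by auto
    then have "u * n + v \<in> Viol" using \<open>A u v\<close> uv by (auto simp: Viol_def Y_def)
    then have "u \<in> (\<lambda>i. i div n) ` Viol" using i(1) by (metis image_eqI)
    then show False using uv by (simp add: Y_def)
  qed
  moreover have "Y \<subseteq> {..<n}" by (auto simp: Y_def X_def)
  ultimately show ?thesis by blast
qed

section \<open>Computation tableaux\<close>

text \<open>The convention that a halted configuration stays unchanged is made part of the
  transition, so that all rows obey the same rule.\<close>

definition next_of :: "tm \<Rightarrow> nat \<Rightarrow> nat list \<Rightarrow> nat \<times> (nat \<times> move) list" where
  "next_of M q rs = (if q = halt_state M then (q, map (\<lambda>s. (s, NoMove)) rs) else transition M q rs)"

lemma step_next_of:
  "step M (q, ts) = (fst (next_of M q (map read_tape ts)), map2 act_tape (snd (next_of M q (map read_tape ts))) ts)"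
proof -
  have "map2 act_tape (map (\<lambda>s. (s, NoMove)) (map read_tape ts)) ts = ts"
    by (rule nth_equalityI) (auto simp: case_prod_unfold, metis act_tape.simps prod.collapse fun_upd_triv
        read_tape.simps add.right_neutral shift.simps(2))
  then show ?thesis by (simp add: next_of_def split: prod.split)
qed

text \<open>The content of a square of the tableau: the state and the symbols read (shared by all squares
  of a row), and for each tape the symbol at this position and whether the head is there.\<close>

type_synonym cell = "nat \<times> nat list \<times> nat list \<times> bool list"

definition cells :: "tm \<Rightarrow> cell set" where
  "cells M = {..<num_states M} \<times> {rs. set rs \<subseteq> {..<num_syms M} \<and> length rs = num_tapes M} \<times>
     {ss. set ss \<subseteq> {..<num_syms M} \<and> length ss = num_tapes M} \<times>
     {fs. set fs \<subseteq> UNIV \<and> length fs = num_tapes M}"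

lemma finite_cells: "finite (cells M)"
  unfolding cells_def by (intro finite_cartesian_product finite_lists_length_eq) auto

fun init_cell :: "tm \<Rightarrow> bool \<Rightarrow> cell \<Rightarrow> bool" where
  "init_cell M b (q, rs, ss, fs) \<longleftrightarrow> q = start_state M \<and>
     (\<forall>j<num_tapes M. fs ! j = b \<and> (0 < j \<longrightarrow> ss ! j = 0))"

fun first_sym :: "nat \<Rightarrow> cell \<Rightarrow> bool" where
  "first_sym s (q, rs, ss, fs) \<longleftrightarrow> ss ! 0 = s"

fun halt_cell :: "tm \<Rightarrow> cell \<Rightarrow> bool" where
  "halt_cell M (q, rs, ss, fs) \<longleftrightarrow> q = halt_state M"

fun yes_cell :: "tm \<Rightarrow> cell \<Rightarrow> bool" where
  "yes_cell M (q, rs, ss, fs) \<longleftrightarrow> ss ! (num_tapes M - 1) = 2"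

fun read_cell :: "tm \<Rightarrow> cell \<Rightarrow> bool" where
  "read_cell M (q, rs, ss, fs) \<longleftrightarrow> (\<forall>j<num_tapes M. fs ! j \<longrightarrow> ss ! j = rs ! j)"

fun same_row :: "cell \<Rightarrow> cell \<Rightarrow> bool" where
  "same_row (q, rs, ss, fs) (q', rs', ss', fs') \<longleftrightarrow> q = q' \<and> rs = rs'"

text \<open>\<open>d\<close> is the distance from the old column to the new one. The value 2, which
  is the shift of no move, stands for all distances beyond the neighbours: the head cannot get
  there. Symbols are compared only within a column.\<close>

fun next_row :: "tm \<Rightarrow> int \<Rightarrow> cell \<Rightarrow> cell \<Rightarrow> bool" where
  "next_row M d (q, rs, ss, fs) (q', rs', ss', fs') \<longleftrightarrow>
     q' = fst (next_of M q rs) \<and>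
     (\<forall>j<num_tapes M.
        (fs ! j \<longrightarrow> (fs' ! j \<longleftrightarrow> shift (snd (snd (next_of M q rs) ! j)) = d)) \<and>
        (d = 0 \<longrightarrow> ss' ! j = (if fs ! j then fst (snd (next_of M q rs) ! j) else ss ! j)))"

text \<open>Column \<open>T\<close> of the tableau is position 0 of the tapes. The certificate occupies at most
  \<open>m\<close> positions after the separator.\<close>

definition start_sym :: "nat list \<Rightarrow> nat \<Rightarrow> nat \<Rightarrow> nat \<Rightarrow> cell \<Rightarrow> bool" where
  "start_sym w m T z c \<longleftrightarrow>
     (if z < T then first_sym 0 c
      else if z < T + length w then
        (if contents w (int (z - T)) = 2 then first_sym 2 c else first_sym 1 c)
      else if z = T + length w then first_sym 3 c
      else if z \<le> T + length w + m then first_sym 0 c \<or> first_sym 1 c \<or> first_sym 2 c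
      else first_sym 0 c)"

text \<open>The predicates on cells receive constant parameters only, and tests on positions stay
  outside. Each predicate is then a finite table and the positions are left to arithmetic, which
  makes the clash relation computable.\<close>

definition valid_cell :: "tm \<Rightarrow> nat list \<Rightarrow> nat \<Rightarrow> nat \<Rightarrow> nat \<Rightarrow> nat \<Rightarrow> cell \<Rightarrow> bool" where
  "valid_cell M w m T t z c \<longleftrightarrow>
     (t = 0 \<longrightarrow> (if z = T then init_cell M True c else init_cell M False c) \<and> start_sym w m T z c) \<and>
     (t = T \<longrightarrow> halt_cell M c \<and> (z = T \<longrightarrow> yes_cell M c)) \<and> read_cell M c"

text \<open>The second condition propagates blanks to the right behind the separator, so that the
  certificate is a bit string followed by blanks only.\<close>

definition compatible ::
  "tm \<Rightarrow> nat list \<Rightarrow> nat \<Rightarrow> nat \<Rightarrow> nat \<Rightarrow> cell \<Rightarrow> nat \<Rightarrow> nat \<Rightarrow> cell \<Rightarrow> bool" where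
  "compatible M w T t z c t' z' c' \<longleftrightarrow>
     (t = t' \<longrightarrow> same_row c c') \<and>
     (t = 0 \<and> t' = 0 \<and> z' = z + 1 \<and> T + length w < z \<longrightarrow> first_sym 0 c \<longrightarrow> first_sym 0 c') \<and>
     (t' = t + 1 \<longrightarrow>
        (if z' = z then next_row M 0 c c' else if z' = z + 1 then next_row M 1 c c'
         else if z = z' + 1 then next_row M (-1) c c' else next_row M 2 c c'))"

lemma compatible_next_row:
  assumes "compatible M w T t z c (t + 1) z' c'"
  shows "next_row M 0 c c' \<and> z' = z \<or> next_row M (int z' - int z) c c' \<and> z' \<noteq> z \<or>
    next_row M 2 c c' \<and> int z' - int z \<notin> {-1, 0, 1}"
  using assms by (auto simp: compatible_def split: if_splits)

definition tableau :: "tm \<Rightarrow> nat list \<Rightarrow> nat \<Rightarrow> nat \<Rightarrow> (nat \<Rightarrow> nat \<Rightarrow> cell) \<Rightarrow> bool" where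
  "tableau M w m T c \<longleftrightarrow>
     (\<forall>t\<le>T. \<forall>z\<le>2 * T. c t z \<in> cells M \<and> valid_cell M w m T t z (c t z)) \<and>
     (\<forall>t\<le>T. \<forall>z\<le>2 * T. \<forall>t'\<le>T. \<forall>z'\<le>2 * T. compatible M w T t z (c t z) t' z' (c t' z'))"

lemma wf_next_of:
  assumes "wf_tm M" "q < num_states M" "length rs = num_tapes M" "set rs \<subseteq> {..<num_syms M}"
  shows "fst (next_of M q rs) < num_states M" "length (snd (next_of M q rs)) = num_tapes M"
    "fst ` set (snd (next_of M q rs)) \<subseteq> {..<num_syms M}"
proof -
  have "\<forall>q < num_states M. \<forall>rs. length rs = num_tapes M \<and> set rs \<subseteq> {..<num_syms M} \<longrightarrow>
      (case transition M q rs of (q', acts) \<Rightarrow>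
        q' < num_states M \<and> length acts = num_tapes M \<and> fst ` set acts \<subseteq> {..<num_syms M})"
    using assms(1) unfolding wf_tm_def by (elim conjE)
  from this[rule_format, OF assms(2) conjI[OF assms(3,4)]]
  have tr: "fst (transition M q rs) < num_states M" "length (snd (transition M q rs)) = num_tapes M"
    "fst ` set (snd (transition M q rs)) \<subseteq> {..<num_syms M}"
    by (simp_all add: case_prod_unfold)
  have "fst ` (\<lambda>s. (s, NoMove)) ` set rs = set rs" by (simp add: image_image)
  then show "fst (next_of M q rs) < num_states M" "length (snd (next_of M q rs)) = num_tapes M"
    "fst ` set (snd (next_of M q rs)) \<subseteq> {..<num_syms M}"
    using assms(2-4) tr by (cases "q = halt_state M"; simp add: next_of_def)+
qed

definition wf_config :: "tm \<Rightarrow> config \<Rightarrow> bool" where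
  "wf_config M C \<longleftrightarrow> fst C < num_states M \<and> length (snd C) = num_tapes M \<and>
     (\<forall>j<num_tapes M. \<forall>i. fst (snd C ! j) i < num_syms M)"

lemma read_tape_eq: "read_tape T = fst T (snd T)"
  by (cases T) simp

lemma act_tape_eq: "act_tape a T = ((fst T)(snd T := fst a), snd T + shift (snd a))"
  by (cases T; cases a) simp

lemma wf_config_reads:
  "wf_config M C \<Longrightarrow> set (map read_tape (snd C)) \<subseteq> {..<num_syms M}"
  by (auto simp: wf_config_def in_set_conv_nth) (metis fst_conv)

lemma wf_config_step:
  assumes "wf_tm M" "wf_config M C"
  shows "wf_config M (step M C)"
proof -
  obtain q ts where C: "C = (q, ts)" by (cases C)
  note n = wf_next_of[OF assms(1), of q "map read_tape ts"]
  have p: "q < num_states M" "length (map read_tape ts) = num_tapes M" "set (map read_tape ts) \<subseteq> {..<num_syms M}"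
    using assms(2) wf_config_reads[OF assms(2)] by (simp_all add: C wf_config_def)
  have "fst (snd (next_of M q (map read_tape ts)) ! j) < num_syms M" if "j < num_tapes M" for j
  proof -
    have "snd (next_of M q (map read_tape ts)) ! j \<in> set (snd (next_of M q (map read_tape ts)))"
      using n(2)[OF p] that by simp
    then show ?thesis using n(3)[OF p] by blast
  qed
  then show ?thesis
    using n[OF p] p assms(2) unfolding C step_next_of wf_config_def
    by (auto simp: act_tape_eq)
qed

lemma wf_config_init:
  assumes "wf_tm M" "set w \<subseteq> {..<num_syms M}"
  shows "wf_config M (init_config M w)"
  using assms nth_mem[of _ w]
  by (auto simp: wf_config_def init_config_def wf_tm_def contents_def nth_Cons subset_iff split: nat.split)

lemma wf_config_steps:
  assumes "wf_tm M" "set w \<subseteq> {..<num_syms M}"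
  shows "wf_config M ((step M ^^ t) (init_config M w))"
  by (induction t) (auto simp: wf_config_init[OF assms] wf_config_step[OF assms(1)])

lemma steps_halted:
  assumes "(step M ^^ t) C = (halt_state M, ts)" "t \<le> t'"
  shows "(step M ^^ t') C = (halt_state M, ts)"
proof -
  have "(step M ^^ n) (halt_state M, ts) = (halt_state M, ts)" for n by (induction n) auto
  then have "(step M ^^ (t' - t + t)) C = (halt_state M, ts)"
    using assms(1) by (simp only: funpow_add o_apply)
  then show ?thesis using assms(2) by simp
qed

definition square :: "config \<Rightarrow> int \<Rightarrow> cell" where
  "square C i = (fst C, map read_tape (snd C), map (\<lambda>T. fst T i) (snd C), map (\<lambda>T. snd T = i) (snd C))"

lemma square_in_cells:
  assumes "wf_config M C"
  shows "square C i \<in> cells M"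
  using assms wf_config_reads[OF assms]
  by (auto simp: square_def cells_def wf_config_def in_set_conv_nth) (metis fst_conv)

lemma next_row_square:
  assumes M: "wf_tm M" and C: "wf_config M C" and d: "i' - i = d \<or> d = 2 \<and> i' - i \<notin> {-1, 0, 1}"
  shows "next_row M d (square C i) (square (step M C) i')"
proof -
  obtain q ts where qts: "C = (q, ts)" by (cases C)
  let ?n = "next_of M q (map read_tape ts)"
  have len: "length ts = num_tapes M" "length (snd ?n) = num_tapes M"
    using wf_next_of(2)[OF M, of q "map read_tape ts"] C wf_config_reads[OF C]
    by (auto simp: qts wf_config_def)
  have shift: "shift m \<in> {-1, 0, 1}" for m by (cases m) auto
  have shift2: "shift m \<noteq> 2" for m by (cases m) auto
  show ?thesis
    using len d unfolding qts step_next_of square_def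
    by (auto simp: act_tape_eq shift2) (use shift in \<open>(fastforce | force)+\<close>)
qed

lemma contents_input_less:
  "set w \<subseteq> {1, 2} \<Longrightarrow> 0 \<le> i \<Longrightarrow> i < int (length w) \<Longrightarrow> contents w i = 1 \<or> contents w i = 2"
proof -
  assume "set w \<subseteq> {1, 2}" "0 \<le> i" "i < int (length w)"
  moreover from this have "w ! nat i \<in> set w" by (intro nth_mem) simp
  ultimately have "w ! nat i \<in> {1, 2}" "0 \<le> i" "i < int (length w)" by blast+
  then show ?thesis by (auto simp: contents_def)
qed

lemma set_bits: "set (bits x) \<subseteq> {1, 2}"
  by (auto simp: bits_def)

lemma contents_append: "contents (xs @ ys) i =
    (if i < int (length xs) then contents xs i else contents ys (i - int (length xs)))"
  by (auto simp: contents_def nth_append nat_diff_distrib')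

lemma contents_Cons: "contents (x # xs) i = (if i = 0 then x else if i < 0 then 0 else contents xs (i - 1))"
  by (auto simp: contents_def nth_Cons' nat_diff_distrib' intro!: arg_cong[of _ _ "(!) xs"])

lemma start_sym_square:
  assumes x: "set w \<subseteq> {1, 2}" and u: "length u \<le> m" and k: "1 \<le> num_tapes M"
  shows "start_sym w m T z (square (init_config M (w @ [3] @ bits u)) (int z - int T))"
proof -
  have first: "first_sym s (square (init_config M v) i) \<longleftrightarrow> contents v i = s" for s v i
    by (simp add: square_def init_config_def)
  have b: "contents (bits u) i \<in> {0, 1, 2}" for i
    using contents_input_less[OF set_bits[of u], of i] by (auto simp: contents_def)
  have lb: "length (bits u) = length u" by (simp add: bits_def)
  show ?thesis
  proof (cases "z < T")
    case True
    then show ?thesis unfolding start_sym_def first by (simp add: contents_def)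
  next
    case False
    then obtain y where z: "z = T + y" by (metis le_Suc_ex not_less)
    show ?thesis
      using contents_input_less[OF x, of "int y"] u b[of "int y - int (length w) - 1"]
      unfolding start_sym_def first contents_append append_Cons append_Nil contents_Cons z
      by (auto simp: contents_def lb)
  qed
qed

lemma tableau_of_run:
  assumes M: "wf_tm M" and w: "set w \<subseteq> {1, 2}" and u: "length u \<le> m"
    and run: "computes_within M (w @ [3] @ bits u) (bits [True]) t" and t: "t \<le> T"
  shows "\<exists>c. tableau M w m T c"
proof -
  let ?v = "w @ [3] @ bits u"
  define C where "C t = (step M ^^ t) (init_config M ?v)" for t
  define c where "c t z = square (C t) (int z - int T)" for t z
  have k: "1 \<le> num_tapes M" "4 \<le> num_syms M" using M by (auto simp: wf_tm_def)
  have "set ?v \<subseteq> {..<num_syms M}" using w set_bits[of u] k by auto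
  then have wf: "wf_config M (C t)" for t unfolding C_def by (rule wf_config_steps[OF M])
  obtain ts where ts: "C t = (halt_state M, ts)" "fst (last ts) = contents (bits [True])"
    using run by (auto simp: computes_within_def C_def split: prod.splits)
  \<comment> \<open>The halted configuration persists up to row \<open>T\<close>, whatever the
    actual running time.\<close>
  then have CT: "C T = (halt_state M, ts)" using steps_halted[OF ts(1)[unfolded C_def] t] by (simp add: C_def)
  have len: "length ts = num_tapes M" using wf[of T] by (simp add: CT wf_config_def)
  have "last ts = ts ! (num_tapes M - 1)" using len k by (subst last_conv_nth) auto
  then have yes: "fst (ts ! (num_tapes M - 1)) 0 = 2" using ts(2) by (simp add: bits_def contents_def)
  have valid: "valid_cell M w m T t z (c t z)" for t z
  proof -
    have "read_cell M (c t z)"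
      using wf[of t] by (auto simp: c_def square_def wf_config_def read_tape_eq)
    moreover have "(if z = T then init_cell M True (c 0 z) else init_cell M False (c 0 z)) \<and>
        start_sym w m T z (c 0 z)"
      using start_sym_square[OF w u k(1)] k(1)
      by (auto simp: c_def C_def square_def init_config_def nth_Cons contents_def split: nat.split)
    moreover have "halt_cell M (c T z) \<and> (z = T \<longrightarrow> yes_cell M (c T z))"
      using yes len k by (auto simp: c_def CT square_def)
    ultimately show ?thesis by (auto simp: valid_cell_def)
  qed
  have sq: "next_row M d (c t z) (c (Suc t) z')" if "int z' - int z = d \<or> d = 2 \<and> int z' - int z \<notin> {-1, 0, 1}" for t z z' d
    using next_row_square[OF M wf, of "int z' - int T" "int z - int T" d t] that by (simp add: c_def C_def)
  have nonblank: "first_sym 0 (c 0 (z + 1))" if "first_sym 0 (c 0 z)" "T + length w < z" for z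
  proof -
    have b: "bits u ! i \<noteq> 0" if "i < length u" for i using that by (simp add: bits_def)
    have "contents ?v (int z - int T) = 0" using that(1) by (simp add: c_def C_def square_def init_config_def)
    then have "\<not> int z - int T < int (length ?v)"
      using that(2) b by (auto simp: contents_def nth_append bits_def split: if_splits)
    then show ?thesis by (simp add: c_def C_def square_def init_config_def contents_def)
  qed
  have "compatible M w T t z (c t z) t' z' (c t' z')" for t z t' z'
    unfolding compatible_def
  proof (intro conjI impI)
    show "same_row (c t z) (c t' z')" if "t = t'" using that by (simp add: c_def square_def)
    show "first_sym 0 (c t' z')" if "t = 0 \<and> t' = 0 \<and> z' = z + 1 \<and> T + length w < z" "first_sym 0 (c t z)"
      using that nonblank by auto
    show "if z' = z then next_row M 0 (c t z) (c t' z')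
         else if z' = z + 1 then next_row M 1 (c t z) (c t' z')
         else if z = z' + 1 then next_row M (-1) (c t z) (c t' z') else next_row M 2 (c t z) (c t' z')"
      if "t' = t + 1" unfolding that by (auto intro!: sq)
  qed
  moreover have "c t z \<in> cells M" for t z unfolding c_def by (rule square_in_cells[OF wf])
  ultimately have "tableau M w m T c" using valid by (simp add: tableau_def)
  then show ?thesis by blast
qed

section \<open>From tableaux back to runs\<close>

definition agrees :: "tm \<Rightarrow> nat \<Rightarrow> config \<Rightarrow> (nat \<Rightarrow> cell) \<Rightarrow> bool" where
  "agrees M T C row \<longleftrightarrow> (\<forall>z\<le>2 * T. case row z of (q, rs, ss, fs) \<Rightarrow> q = fst C \<and>
     (\<forall>j<num_tapes M. ss ! j = fst (snd C ! j) (int z - int T) \<and>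
        (fs ! j \<longleftrightarrow> snd (snd C ! j) = int z - int T)))"

text \<open>A head moves at most one square per step and thus stays within the 2T + 1 columns. So
  for each tape some square of the row carries its head, and that square forces the read symbol
  shared by the row to be the one actually read.\<close>

lemma run_of_tableau_rows:
  assumes M: "wf_tm M" and tab: "tableau M w m T c" and init: "agrees M T (init_config M v) (c 0)"
    and t: "t \<le> T"
  shows "agrees M T ((step M ^^ t) (init_config M v)) (c t) \<and>
    length (snd ((step M ^^ t) (init_config M v))) = num_tapes M \<and>
    (\<forall>j<num_tapes M. \<bar>snd (snd ((step M ^^ t) (init_config M v)) ! j)\<bar> \<le> int t)"
  using t
proof (induction t)
  case 0
  have "1 \<le> num_tapes M" using M by (simp add: wf_tm_def)
  then show ?case using init by (auto simp: init_config_def nth_Cons split: nat.split)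
next
  case (Suc t)
  obtain q ts where C: "(step M ^^ t) (init_config M v) = (q, ts)" by (cases "(step M ^^ t) (init_config M v)")
  from Suc have IH: "agrees M T (q, ts) (c t)" and len: "length ts = num_tapes M"
    and bound: "\<And>j. j < num_tapes M \<Longrightarrow> \<bar>snd (ts ! j)\<bar> \<le> int t"
    by (auto simp: C)
  have head: "\<exists>z\<le>2 * T. int z - int T = snd (ts ! j)" if "j < num_tapes M" for j
    using bound[OF that] Suc.prems by (intro exI[of _ "nat (snd (ts ! j) + int T)"]) auto
  obtain q0 rs ss0 fs0 where c0: "c t 0 = (q0, rs, ss0, fs0)" by (cases "c t 0")
  have cell: "c t z \<in> cells M" "read_cell M (c t z)" if "z \<le> 2 * T" for z
    using tab that Suc.prems by (auto simp: tableau_def valid_cell_def)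
  have row: "\<exists>ss fs. c t z = (q, rs, ss, fs) \<and> (\<forall>j<num_tapes M. ss ! j = fst (ts ! j) (int z - int T) \<and>
      (fs ! j \<longleftrightarrow> snd (ts ! j) = int z - int T))" if "z \<le> 2 * T" for z
  proof -
    obtain q' rs' ss fs where z: "c t z = (q', rs', ss, fs)" by (cases "c t z")
    have "compatible M w T t 0 (c t 0) t z (c t z)" using tab that Suc.prems by (simp add: tableau_def)
    then have "rs' = rs" by (simp add: compatible_def c0 z)
    then show ?thesis using IH that z by (auto simp: agrees_def)
  qed
  have lrs: "length rs = num_tapes M" "set rs \<subseteq> {..<num_syms M}" "q < num_states M"
    using cell(1)[of 0] row[of 0] c0 by (auto simp: cells_def)
  have "rs ! j = read_tape (ts ! j)" if j: "j < num_tapes M" for j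
  proof -
    obtain z where z: "z \<le> 2 * T" "int z - int T = snd (ts ! j)" using head[OF j] by blast
    then show ?thesis using row[OF z(1)] cell(2)[OF z(1)] j by (auto simp: read_tape_eq)
  qed
  then have reads: "map read_tape ts = rs" using len lrs by (intro nth_equalityI) auto
  let ?n = "next_of M q rs"
  have ln: "length (snd ?n) = num_tapes M" by (rule wf_next_of(2)[OF M lrs(3,1,2)])
  have step: "(step M ^^ Suc t) (init_config M v) = (fst ?n, map2 act_tape (snd ?n) ts)"
    by (simp add: C step_next_of reads del: step.simps)
  have nth: "map2 act_tape (snd ?n) ts ! j =
      ((fst (ts ! j))(snd (ts ! j) := fst (snd ?n ! j)), snd (ts ! j) + shift (snd (snd ?n ! j)))"
    if "j < num_tapes M" for j
    using that len ln by (simp add: act_tape_eq)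
  have sh: "\<bar>shift d\<bar> \<le> 1" for d by (cases d) auto
  have next_row: "compatible M w T t z (c t z) (t + 1) z' (c (Suc t) z')" if "z \<le> 2 * T" "z' \<le> 2 * T" for z z'
    using tab that Suc.prems by (simp add: tableau_def)
  have "agrees M T (fst ?n, map2 act_tape (snd ?n) ts) (c (Suc t))"
    unfolding agrees_def
  proof (intro allI impI)
    fix z' assume z': "z' \<le> 2 * T"
    obtain q' rs' ss' fs' where c': "c (Suc t) z' = (q', rs', ss', fs')" by (cases "c (Suc t) z'")
    obtain ss fs where c: "c t z' = (q, rs, ss, fs)" and
      sf: "\<forall>j<num_tapes M. ss ! j = fst (ts ! j) (int z' - int T) \<and> (fs ! j \<longleftrightarrow> snd (ts ! j) = int z' - int T)"
      using row[OF z'] by blast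
    have 0: "next_row M 0 (q, rs, ss, fs) (q', rs', ss', fs')"
      using next_row[OF z' z'] by (simp add: compatible_def c c')
    \<comment> \<open>Each square of the next row is compared with the square of the head in this
      row, at whatever distance; this also excludes spurious heads.\<close>
    have fs': "fs' ! j \<longleftrightarrow> snd (ts ! j) + shift (snd (snd ?n ! j)) = int z' - int T" if j: "j < num_tapes M" for j
    proof -
      obtain z where z: "z \<le> 2 * T" "int z - int T = snd (ts ! j)" using head[OF j] by blast
      obtain ss1 fs1 where c1: "c t z = (q, rs, ss1, fs1)" "fs1 ! j" using row[OF z(1)] z(2) j by auto
      have "next_row M 0 (c t z) (c (Suc t) z') \<and> z' = z \<or>
          next_row M (int z' - int z) (c t z) (c (Suc t) z') \<and> z' \<noteq> z \<or>
          next_row M 2 (c t z) (c (Suc t) z') \<and> int z' - int z \<notin> {-1, 0, 1}"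
        by (rule compatible_next_row) (rule next_row[OF z(1) z'])
      then show ?thesis
        using c1 c' j z(2) sh[of "snd (snd ?n ! j)"] by auto
    qed
    show "case c (Suc t) z' of (q, rs, ss, fs) \<Rightarrow>
      q = fst (fst ?n, map2 act_tape (snd ?n) ts) \<and>
      (\<forall>j<num_tapes M. ss ! j = fst (snd (fst ?n, map2 act_tape (snd ?n) ts) ! j) (int z' - int T) \<and>
        (fs ! j \<longleftrightarrow> snd (snd (fst ?n, map2 act_tape (snd ?n) ts) ! j) = int z' - int T))"
      using 0 fs' sf by (auto simp: c' nth)
  qed
  moreover have "\<bar>snd (map2 act_tape (snd ?n) ts ! j)\<bar> \<le> int (Suc t)" if "j < num_tapes M" for j
    using bound[OF that] sh[of "snd (snd ?n ! j)"] unfolding nth[OF that] by simp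
  ultimately show ?case unfolding step using len ln by simp
qed

text \<open>The first row leaves the certificate open; it is read off behind the separator up to the
  first blank.\<close>

lemma start_of_tableau:
  assumes M: "wf_tm M" and w: "set w \<subseteq> {1, 2}" and tab: "tableau M w m T c" and T: "length w + 1 + m \<le> T"
  shows "\<exists>u. length u \<le> m \<and> agrees M T (init_config M (w @ [3] @ bits u)) (c 0)"
proof -
  have k: "1 \<le> num_tapes M" using M by (simp add: wf_tm_def)
  define g where "g z = (case c 0 z of (q, rs, ss, fs) \<Rightarrow> ss ! 0)" for z
  have first: "first_sym s (c 0 z) \<longleftrightarrow> g z = s" for s z by (cases "c 0 z") (simp add: g_def)
  have valid: "valid_cell M w m T 0 z (c 0 z)" if "z \<le> 2 * T" for z
    using tab that by (simp add: tableau_def)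
  then have start: "start_sym w m T z (c 0 z)" if "z \<le> 2 * T" for z
    using that by (simp add: valid_cell_def)
  define f where "f i = g (T + length w + 1 + i)" for i
  have f012: "f i \<in> {0, 1, 2}" if "i < m" for i
    using start[of "T + length w + 1 + i"] that T unfolding start_sym_def first f_def by auto
  have f_next: "f (Suc i) = 0" if "f i = 0" "Suc i < m" for i
  proof -
    have "compatible M w T 0 (T + length w + 1 + i) (c 0 (T + length w + 1 + i))
        0 (T + length w + 1 + Suc i) (c 0 (T + length w + 1 + Suc i))"
      using tab that T by (simp add: tableau_def)
    then show ?thesis using that(1) by (simp add: compatible_def first f_def)
  qed
  \<comment> \<open>The alternative \<open>i = m\<close> ends the search if the certificate fills
    all \<open>m\<close> squares.\<close>
  define l where "l = (LEAST i. i = m \<or> f i = 0)"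
  have l: "l = m \<or> f l = 0" unfolding l_def by (rule LeastI[of _ m]) simp
  have lm: "l \<le> m" unfolding l_def by (rule Least_le) simp
  have below: "f i \<noteq> 0" if "i < l" for i using not_less_Least[OF that[unfolded l_def]] by blast
  have above: "f i = 0" if "l \<le> i" "i < m" for i
    using that
  proof (induction i rule: dec_induct)
    case base
    then show ?case using l by auto
  next
    case (step i)
    then show ?case using f_next[of i] by simp
  qed
  define u where "u = map (\<lambda>i. f i = 2) [0..<l]"
  have lu: "length u = l" by (simp add: u_def)
  have bu: "bits u ! i = f i" if "i < l" for i
    using that f012[of i] below[of i] lm by (auto simp: u_def bits_def)
  have lb: "length (bits u) = l" by (simp add: bits_def lu)
  have sym: "g z = contents (w @ [3] @ bits u) (int z - int T)" if z: "z \<le> 2 * T" for z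
  proof (cases "z < T")
    case True
    then show ?thesis using start[OF z] by (simp add: start_sym_def first contents_def)
  next
    case False
    then obtain y where y: "z = T + y" by (metis le_Suc_ex not_less)
    have eq: "int z - int T = int y" by (simp add: y)
    consider "y < length w" | "y = length w" | i where "y = length w + 1 + i"
      by (metis add.assoc add.commute less_imp_Suc_add linorder_neqE_nat plus_1_eq_Suc add_Suc_right)
    then show ?thesis
    proof cases
      case 1
      then show ?thesis
        using start[OF z] contents_input_less[OF w, of "int y"] unfolding start_sym_def first eq
        by (auto simp: y nth_append contents_def split: if_splits)
    next
      case 2
      then show ?thesis using start[OF z] unfolding start_sym_def first eq
        by (auto simp: y contents_append contents_Cons)
    next
      case (3 i)
      have "contents (w @ [3] @ bits u) (int y) = contents (bits u) (int i)"
        unfolding 3 by (simp add: contents_append contents_Cons)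
      moreover have "g z = f i" by (simp add: y 3 f_def add.assoc)
      moreover have "f i = contents (bits u) (int i)"
      proof (cases "i < m")
        case True
        then show ?thesis using bu[of i] above[of i] by (auto simp: contents_def lb)
      next
        case False
        then have "g z = 0" using start[OF z] unfolding start_sym_def first by (simp add: y 3)
        then show ?thesis using False lm \<open>g z = f i\<close> by (simp add: contents_def lb)
      qed
      ultimately show ?thesis unfolding eq by simp
    qed
  qed
  have "agrees M T (init_config M (w @ [3] @ bits u)) (c 0)"
    unfolding agrees_def
  proof (intro allI impI)
    fix z assume z: "z \<le> 2 * T"
    obtain q rs ss fs where c: "c 0 z = (q, rs, ss, fs)" by (cases "c 0 z")
    have "if z = T then init_cell M True (c 0 z) else init_cell M False (c 0 z)"
      using valid[OF z] unfolding valid_cell_def by blast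
    then have "init_cell M (z = T) (q, rs, ss, fs)" unfolding c by (simp split: if_splits)
    then have "q = start_state M" "\<forall>j<num_tapes M. (fs ! j \<longleftrightarrow> z = T) \<and> (0 < j \<longrightarrow> ss ! j = 0)"
      by auto
    moreover have "ss ! 0 = contents (w @ [3] @ bits u) (int z - int T)" using sym[OF z] by (simp add: g_def c)
    ultimately show "case c 0 z of (q, rs, ss, fs) \<Rightarrow> q = fst (init_config M (w @ [3] @ bits u)) \<and>
        (\<forall>j<num_tapes M. ss ! j = fst (snd (init_config M (w @ [3] @ bits u)) ! j) (int z - int T) \<and>
          (fs ! j \<longleftrightarrow> snd (snd (init_config M (w @ [3] @ bits u)) ! j) = int z - int T))"
      by (auto simp: c init_config_def nth_Cons contents_def[of "[]"] split: nat.split)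
  qed
  then show ?thesis using lm lu by auto
qed

text \<open>Quantifying over \<open>b\<close> and \<open>t\<close> avoids any assumption that the
  machine answers. A decider does answer within the time bound, and its answer must then be
  yes.\<close>

lemma accepted_of_tableau:
  assumes M: "wf_tm M" and w: "set w \<subseteq> {1, 2}" and tab: "tableau M w m T c" and T: "length w + 1 + m \<le> T"
  shows "\<exists>u. length u \<le> m \<and>
    (\<forall>b t. t \<le> T \<longrightarrow> computes_within M (w @ [3] @ bits u) (bits [b]) t \<longrightarrow> b)"
proof -
  obtain u where u: "length u \<le> m" and init: "agrees M T (init_config M (w @ [3] @ bits u)) (c 0)"
    using start_of_tableau[OF assms] by blast
  have b if t: "t \<le> T" and run: "computes_within M (w @ [3] @ bits u) (bits [b]) t" for b t
  proof -
    obtain ts where "(step M ^^ t) (init_config M (w @ [3] @ bits u)) = (halt_state M, ts)"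
      and out: "fst (last ts) = contents (bits [b])"
      using run by (auto simp: computes_within_def split: prod.splits)
    then have C: "(step M ^^ T) (init_config M (w @ [3] @ bits u)) = (halt_state M, ts)"
      using steps_halted t by blast
    note rows = run_of_tableau_rows[OF M tab init order_refl, unfolded C]
    have k: "1 \<le> num_tapes M" using M by (simp add: wf_tm_def)
    have len: "length ts = num_tapes M" using rows by simp
    obtain q rs ss fs where c: "c T T = (q, rs, ss, fs)" by (cases "c T T")
    have "valid_cell M w m T T T (c T T)" using tab by (simp add: tableau_def)
    then have "ss ! (num_tapes M - 1) = 2" by (simp add: valid_cell_def c)
    moreover have "ss ! (num_tapes M - 1) = fst (ts ! (num_tapes M - 1)) 0"
      using rows k by (fastforce simp: agrees_def c dest: spec[of _ T])
    moreover have "last ts = ts ! (num_tapes M - 1)" using len k by (subst last_conv_nth) auto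
    ultimately show ?thesis using out by (simp add: bits_def contents_def split: if_splits)
  qed
  then show ?thesis using u by blast
qed

section \<open>NP-hardness\<close>

text \<open>Vertex \<open>v\<close> of the graph puts the cell number \<open>v mod length cl\<close> into the square number
  \<open>v div length cl\<close>, where squares are numbered row by row. A vertex clashing with itself is an
  inadmissible choice.\<close>

definition clash :: "tm \<Rightarrow> cell list \<Rightarrow> nat list \<Rightarrow> nat \<Rightarrow> nat \<Rightarrow> nat \<Rightarrow> nat \<Rightarrow> bool" where
  "clash M cl w m T u v \<longleftrightarrow> \<not>
     (valid_cell M w m T (u div length cl div (2 * T + 1)) (u div length cl mod (2 * T + 1))
        (cl ! (u mod length cl)) \<and>
      valid_cell M w m T (v div length cl div (2 * T + 1)) (v div length cl mod (2 * T + 1))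
        (cl ! (v mod length cl)) \<and>
      (u div length cl = v div length cl \<longrightarrow> u mod length cl = v mod length cl) \<and>
      compatible M w T
        (u div length cl div (2 * T + 1)) (u div length cl mod (2 * T + 1)) (cl ! (u mod length cl))
        (v div length cl div (2 * T + 1)) (v div length cl mod (2 * T + 1)) (cl ! (v mod length cl)))"

lemma tableau_iff_clash_free:
  assumes cl: "set cl = cells M" "cl \<noteq> []"
  shows "(\<exists>c. tableau M w m T c) \<longleftrightarrow>
    (\<exists>Y\<subseteq>{..<(T + 1) * (2 * T + 1) * length cl}. (\<forall>u\<in>Y. \<forall>v\<in>Y. \<not> clash M cl w m T u v) \<and>
      (T + 1) * (2 * T + 1) \<le> card Y)"
proof -
  define D where "D = length cl"
  define W where "W = 2 * T + 1"
  have D: "0 < D" using cl(2) by (simp add: D_def)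
  have W: "0 < W" by (simp add: W_def)
  show ?thesis
    unfolding D_def[symmetric] W_def[symmetric]
  proof
    assume "\<exists>c. tableau M w m T c"
    then obtain c where c: "tableau M w m T c" by blast
    have tz: "i div W \<le> T" "i mod W \<le> 2 * T" if "i < (T + 1) * W" for i
      using that W less_mult_imp_div_less[OF that] mod_less_divisor[OF W, of i] by (auto simp: W_def)
    have "\<exists>a<D. cl ! a = c (i div W) (i mod W)" if "i < (T + 1) * W" for i
    proof -
      have "c (i div W) (i mod W) \<in> set cl" using c tz[OF that] cl(1) by (simp add: tableau_def)
      then show ?thesis by (simp add: in_set_conv_nth D_def)
    qed
    then obtain s where s: "\<And>i. i < (T + 1) * W \<Longrightarrow> s i < D \<and> cl ! s i = c (i div W) (i mod W)"
      by metis
    define g where "g i = i * D + s i" for i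
    have g: "g i div D = i" "g i mod D = s i" if "i < (T + 1) * W" for i
      using s[OF that] D by (simp_all add: g_def)
    have "inj_on g {..<(T + 1) * W}" by (rule inj_on_inverseI[of _ "\<lambda>u. u div D"]) (use g in auto)
    then have "card (g ` {..<(T + 1) * W}) = (T + 1) * W" by (simp add: card_image)
    moreover have "g ` {..<(T + 1) * W} \<subseteq> {..<(T + 1) * W * D}"
      using s pair_code_less by (auto simp: g_def)
    moreover have "\<not> clash M cl w m T u v" if uv: "u \<in> g ` {..<(T + 1) * W}" "v \<in> g ` {..<(T + 1) * W}" for u v
    proof -
      obtain i j where ij: "u = g i" "i < (T + 1) * W" "v = g j" "j < (T + 1) * W" using uv by auto
      show ?thesis
        unfolding clash_def D_def[symmetric] W_def[symmetric] ij(1,3) g[OF ij(2)] g[OF ij(4)]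
        using c s[OF ij(2)] s[OF ij(4)] tz[OF ij(2)] tz[OF ij(4)]
        by (simp add: tableau_def)
    qed
    ultimately show "\<exists>Y\<subseteq>{..<(T + 1) * W * D}. (\<forall>u\<in>Y. \<forall>v\<in>Y. \<not> clash M cl w m T u v) \<and> (T + 1) * W \<le> card Y"
      by (intro exI[of _ "g ` {..<(T + 1) * W}"]) auto
  next
    assume "\<exists>Y\<subseteq>{..<(T + 1) * W * D}. (\<forall>u\<in>Y. \<forall>v\<in>Y. \<not> clash M cl w m T u v) \<and> (T + 1) * W \<le> card Y"
    then obtain Y where Y: "Y \<subseteq> {..<(T + 1) * W * D}" "\<And>u v. u \<in> Y \<Longrightarrow> v \<in> Y \<Longrightarrow> \<not> clash M cl w m T u v"
      "(T + 1) * W \<le> card Y" by blast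
    \<comment> \<open>Different fillings of one square clash, so there is at most one vertex per
      square; with as many vertices as squares, each square is filled exactly once.\<close>
    have inj: "inj_on (\<lambda>u. u div D) Y"
    proof (rule inj_onI)
      fix u v assume "u \<in> Y" "v \<in> Y" "u div D = v div D"
      then show "u = v" using Y(2)[of u v] div_mod_eqI[of u D v] unfolding clash_def D_def[symmetric] by blast
    qed
    have sub: "(\<lambda>u. u div D) ` Y \<subseteq> {..<(T + 1) * W}"
      using Y(1) D by (auto simp: div_less_iff_less_mult)
    have "(\<lambda>u. u div D) ` Y = {..<(T + 1) * W}"
      using sub Y(3) card_image[OF inj] by (intro card_seteq) auto
    then have "\<forall>i. \<exists>u. i < (T + 1) * W \<longrightarrow> u \<in> Y \<and> u div D = i" by (metis imageE lessThan_iff)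
    then obtain \<sigma> where \<sigma>: "\<And>i. i < (T + 1) * W \<Longrightarrow> \<sigma> i \<in> Y \<and> \<sigma> i div D = i" by metis
    define c where "c t z = cl ! (\<sigma> (t * W + z) mod D)" for t z
    have code: "t * W + z < (T + 1) * W" "(t * W + z) div W = t" "(t * W + z) mod W = z"
      if "t \<le> T" "z \<le> 2 * T" for t z
    proof -
      have "z < W" using that by (simp add: W_def)
      then show "t * W + z < (T + 1) * W" "(t * W + z) div W = t" "(t * W + z) mod W = z"
        using that pair_code_less[of t "T + 1" z W] by auto
    qed
    have "tableau M w m T c"
      unfolding tableau_def
    proof (intro conjI allI impI)
      fix t z assume tz: "t \<le> T" "z \<le> 2 * T"
      note k = code[OF tz]
      have "\<sigma> (t * W + z) mod D < D" using D by simp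
      then have "c t z \<in> set cl" unfolding c_def D_def by (rule nth_mem)
      then show "c t z \<in> cells M" using cl(1) by simp
      show "valid_cell M w m T t z (c t z)"
        using Y(2)[of "\<sigma> (t * W + z)" "\<sigma> (t * W + z)"] \<sigma>[OF k(1)] k(2,3)
        unfolding clash_def D_def[symmetric] W_def[symmetric] c_def by simp
      fix t' z' assume tz': "t' \<le> T" "z' \<le> 2 * T"
      note k' = code[OF tz']
      show "compatible M w T t z (c t z) t' z' (c t' z')"
        using Y(2)[of "\<sigma> (t * W + z)" "\<sigma> (t' * W + z')"] \<sigma>[OF k(1)] k(2,3) \<sigma>[OF k'(1)] k'(2,3)
        unfolding clash_def D_def[symmetric] W_def[symmetric] c_def by simp
    qed
    then show "\<exists>c. tableau M w m T c" by blast
  qed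
qed

lemma cells_nonempty: "wf_tm M \<Longrightarrow> cells M \<noteq> {}"
proof -
  assume "wf_tm M"
  then have "(start_state M, replicate (num_tapes M) 0, replicate (num_tapes M) 0, replicate (num_tapes M) False) \<in> cells M"
    by (auto simp: wf_tm_def cells_def)
  then show ?thesis by blast
qed

section \<open>Computability of the clash relation and of the reduction\<close>

lemma pf_cell1:
  assumes "cl \<noteq> []" "pf d f"
  shows "pf d (\<lambda>w e. of_bool (P (cl ! (f w e mod length cl))))"
proof -
  have "pf d (\<lambda>w e. of_bool (f w e mod length cl < length cl \<and> P (cl ! (f w e mod length cl))))"
    by (intro pf_table1[of d "\<lambda>w e. f w e mod length cl" "length cl" "\<lambda>i. P (cl ! i)"] pf_mod pf_const assms)
  then show ?thesis using assms(1) by simp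
qed

lemma pf_cell2:
  assumes "cl \<noteq> []" "pf d f" "pf d g"
  shows "pf d (\<lambda>w e. of_bool (P (cl ! (f w e mod length cl)) (cl ! (g w e mod length cl))))"
proof -
  have "pf d (\<lambda>w e. of_bool (f w e mod length cl < length cl \<and> g w e mod length cl < length cl \<and>
      P (cl ! (f w e mod length cl)) (cl ! (g w e mod length cl))))"
    by (intro pf_table2[of d "\<lambda>w e. f w e mod length cl" "\<lambda>w e. g w e mod length cl" "length cl" "length cl"
        "\<lambda>i j. P (cl ! i) (cl ! j)"] pf_mod pf_const assms)
  then show ?thesis using assms(1) by simp
qed

lemma pf_clash:
  assumes cl: "cl \<noteq> []" and m: "\<And>d. pf d (\<lambda>w e. m w)" and T: "\<And>d. pf d (\<lambda>w e. T w)"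
  shows "pf 2 (\<lambda>w e. of_bool (clash M cl w (m w) (T w) (e 0) (e 1)))"
  unfolding clash_def valid_cell_def start_sym_def compatible_def
  by (intro pf_rules m T cl
      pf_cell1[where P = "init_cell M b" for b] pf_cell1[where P = "first_sym b" for b]
      pf_cell1[where P = "halt_cell M"] pf_cell1[where P = "yes_cell M"] pf_cell1[where P = "read_cell M"]
      pf_cell2[where P = same_row] pf_cell2[where P = "next_row M b" for b])
    simp_all

lemma pf_block: "pf d f \<Longrightarrow> pf d (\<lambda>w e. block (f w e))"
  unfolding block_def by (intro pf_rules)

lemma pf_gadget_arcs:
  assumes n: "\<And>d. pf d (\<lambda>w e. n w)" and A: "pf 2 (\<lambda>w e. of_bool (A w (e 0) (e 1)))"
  shows "pf 2 (\<lambda>w e. of_bool ((e 0, e 1) \<in> gadget_arcs (n w) (A w)))"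
  unfolding gadget_arcs_def backedge_def linked_def mem_Collect_eq case_prod_conv
  by (intro pf_rules pf_block n pf_comp2[OF A]) simp_all

lemma pf_instance_bit:
  assumes n: "\<And>d. pf d (\<lambda>w e. n w)" and E: "pf 2 (\<lambda>w e. of_bool (E w (e 0) (e 1)))"
    and k: "\<And>d. pf d (\<lambda>w e. k w)"
  shows "pf 1 (\<lambda>w e. of_bool (instance_bit (n w) (E w) (k w) (e 0)))"
  unfolding instance_bit_def by (intro pf_rules n k pf_comp2[OF E]) simp_all

theorem MISP_snake7_free_hard: "NP_hard MISP_snake7_free"
  unfolding NP_hard_def
proof
  fix L assume "L \<in> NP"
  then obtain R and q :: "nat poly" where R: "poly_time_decidable_rel R"
    and L: "\<And>x. x \<in> L \<longleftrightarrow> (\<exists>u. length u \<le> poly q (length x) \<and> (x, u) \<in> R)"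
    unfolding NP_def by blast
  obtain M and p :: "nat poly" where M: "wf_tm M"
    and run: "\<And>x u. computes_within M (bits x @ [3] @ bits u) (bits [(x, u) \<in> R])
      (poly p (length (bits x @ [3] @ bits u)))"
    using R unfolding poly_time_decidable_rel_def poly_time_def by fastforce
  obtain cl where cl: "set cl = cells M" using finite_list[OF finite_cells] by blast
  have ne: "cl \<noteq> []" using cl cells_nonempty[OF M] by auto
  define m where "m w = poly q (length w)" for w :: "nat list"
  \<comment> \<open>The first summand bounds the running time on all admissible certificates, the
    second makes room for input, separator and certificate in the columns.\<close>
  define T where "T w = poly p (length w + 1 + m w) + (length w + 1 + m w)" for w :: "nat list"
  define s where "s w = (T w + 1) * (2 * T w + 1)" for w
  define n where "n w = s w * length cl" for w
  define A where "A w = clash M cl w (m w) (T w)" for w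
  \<comment> \<open>All vertices except a cover with n - s graph vertices and two inner vertices for
    each pair.\<close>
  define k where "k w = 7 * block (n w) + s w - (n w + 2 * (n w * n w))" for w
  define f where "f x = encode_instance (7 * block (n (bits x))) (gadget_arcs (n (bits x)) (A (bits x))) (k (bits x))" for x
  have pm: "pf d (\<lambda>w e. m w)" for d unfolding m_def by (intro pf_rules)
  have pT: "pf d (\<lambda>w e. T w)" for d unfolding T_def by (intro pf_rules pm)
  have ps: "pf d (\<lambda>w e. s w)" for d unfolding s_def by (intro pf_rules pT)
  have pn: "pf d (\<lambda>w e. n w)" for d unfolding n_def by (intro pf_rules ps)
  have pk: "pf d (\<lambda>w e. k w)" for d unfolding k_def by (intro pf_rules pf_block pn ps)
  have p7: "pf d (\<lambda>w e. 7 * block (n w))" for d by (intro pf_rules pf_block pn)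
  have "poly_time_computable f"
    unfolding poly_time_computable_def
  proof (rule poly_timeI)
    show "pf 0 (\<lambda>w e. instance_length (7 * block (n w)) (k w))"
      unfolding instance_length_def by (intro pf_rules p7 pk)
    show "pf 1 (\<lambda>w e. of_bool (instance_bit (7 * block (n w)) (\<lambda>i j. (i, j) \<in> gadget_arcs (n w) (A w)) (k w) (e 0)))"
      by (intro pf_instance_bit[OF p7 _ pk] pf_gadget_arcs pn)
        (unfold A_def, rule pf_clash[OF ne pm pT])
    show "0 \<notin> set (bits x)" for x by (auto simp: bits_def)
    show "bits (f x) = bits (map (instance_bit (7 * block (n (bits x)))
        (\<lambda>i j. (i, j) \<in> gadget_arcs (n (bits x)) (A (bits x))) (k (bits x)))
        [0..<instance_length (7 * block (n (bits x))) (k (bits x))])" for x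
      by (simp add: f_def encode_instance_eq)
  qed
  moreover have "x \<in> L \<longleftrightarrow> f x \<in> MISP_snake7_free" for x
  proof -
    define w where "w = bits x"
    have w: "set w \<subseteq> {1, 2}" unfolding w_def by (rule set_bits)
    have lw: "length w = length x" by (simp add: w_def bits_def)
    have time: "poly p (length (w @ [3] @ bits u)) \<le> T w" if "length u \<le> m w" for u
    proof -
      have "poly p (length (w @ [3] @ bits u)) \<le> poly p (length w + 1 + m w)"
        by (rule poly_mono_nat) (use that in \<open>simp add: bits_def\<close>)
      then show ?thesis by (simp add: T_def)
    qed
    have "x \<in> L \<longleftrightarrow> (\<exists>c. tableau M w (m w) (T w) c)"
    proof
      assume "x \<in> L"
      then obtain u where u: "length u \<le> m w" "(x, u) \<in> R" by (auto simp: L m_def lw)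
      show "\<exists>c. tableau M w (m w) (T w) c"
        by (rule tableau_of_run[OF M w u(1) _ time[OF u(1)]]) (use run[of x u] u(2) in \<open>simp add: w_def\<close>)
    next
      assume "\<exists>c. tableau M w (m w) (T w) c"
      then obtain c where c: "tableau M w (m w) (T w) c" by blast
      obtain u where u: "length u \<le> m w"
        "\<And>b t. t \<le> T w \<Longrightarrow> computes_within M (w @ [3] @ bits u) (bits [b]) t \<Longrightarrow> b"
        using accepted_of_tableau[OF M w c] by (auto simp: T_def)
      have "(x, u) \<in> R" using u(2)[OF time[OF u(1)]] run[of x u] by (simp add: w_def)
      then show "x \<in> L" using u(1) by (auto simp: L m_def lw)
    qed
    also have "\<dots> \<longleftrightarrow> (\<exists>Y\<subseteq>{..<n w}. (\<forall>u\<in>Y. \<forall>v\<in>Y. \<not> A w u v) \<and> s w \<le> card Y)"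
      unfolding A_def n_def s_def by (rule tableau_iff_clash_free[OF cl ne])
    also have "\<dots> \<longleftrightarrow> (\<exists>S. independent_set {..<7 * block (n w)} (gadget_arcs (n w) (A w)) S \<and> k w \<le> card S)"
    proof
      assume "\<exists>Y\<subseteq>{..<n w}. (\<forall>u\<in>Y. \<forall>v\<in>Y. \<not> A w u v) \<and> s w \<le> card Y"
      then obtain Y where Y: "Y \<subseteq> {..<n w}" "\<forall>u\<in>Y. \<forall>v\<in>Y. \<not> A w u v" "s w \<le> card Y" by blast
      from cover_of_graph_set[OF Y(1), of "A w"] Y(2)
      obtain S where "independent_set {..<7 * block (n w)} (gadget_arcs (n w) (A w)) S"
        "card S \<ge> 7 * block (n w) + card Y - (n w + 2 * (n w * n w))" by blast
      then show "\<exists>S. independent_set {..<7 * block (n w)} (gadget_arcs (n w) (A w)) S \<and> k w \<le> card S"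
        using Y(3) by (intro exI[of _ S]) (simp add: k_def)
    next
      assume "\<exists>S. independent_set {..<7 * block (n w)} (gadget_arcs (n w) (A w)) S \<and> k w \<le> card S"
      then show "\<exists>Y\<subseteq>{..<n w}. (\<forall>u\<in>Y. \<forall>v\<in>Y. \<not> A w u v) \<and> s w \<le> card Y"
        using graph_set_of_cover[of "n w" "A w"] unfolding k_def by blast
    qed
    also have "\<dots> \<longleftrightarrow> f x \<in> MISP_snake7_free"
    proof -
      have E: "gadget_arcs (n w) (A w) \<subseteq> {..<7 * block (n w)} \<times> {..<7 * block (n w)}"
        by (auto simp: gadget_arcs_def)
      have "1 \<le> k w" by (simp add: k_def block_def)
      \<comment> \<open>Arc sets inside the vertex set are determined by the code, so the instance
        witnessing membership is the constructed one.\<close>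
      moreover have "E' \<subseteq> {..<n'} \<times> {..<n'}" if "tournament {..<n'} E'" for n' and E' :: "nat rel"
        using that by (simp add: tournament_def)
      ultimately show ?thesis
        using tournament_gadget[of "n w" "A w"] snake7_free_gadget[of "n w" "A w"]
        unfolding MISP_snake7_free_def f_def w_def[symmetric]
        by (smt (verit) E encode_instance_inject mem_Collect_eq)
    qed
    finally show ?thesis .
  qed
  ultimately show "poly_reducible L MISP_snake7_free" unfolding poly_reducible_def by blast
qed

section \<open>Membership in NP\<close>

definition bounded_tournament :: "nat \<Rightarrow> (nat \<Rightarrow> nat \<Rightarrow> bool) \<Rightarrow> bool" where
  "bounded_tournament n E \<longleftrightarrow>
     (\<forall>i<n. \<forall>j<n. (i = j \<longrightarrow> \<not> E i j) \<and> (i \<noteq> j \<longrightarrow> (E i j \<longleftrightarrow> \<not> E j i)))"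

definition bounded_snake :: "nat \<Rightarrow> (nat \<Rightarrow> nat \<Rightarrow> bool) \<Rightarrow> bool" where
  "bounded_snake n E \<longleftrightarrow>
     (\<exists>a<n. \<exists>b<n. E b a \<and> (\<exists>c<n. E c b \<and> E a c \<and> (\<exists>d<n. E d c \<and> E a d \<and> E b d \<and>
     (\<exists>e<n. E e d \<and> E a e \<and> E b e \<and> E c e \<and>
     (\<exists>f<n. E f e \<and> E a f \<and> E b f \<and> E c f \<and> E d f \<and>
     (\<exists>g<n. E g f \<and> E a g \<and> E b g \<and> E c g \<and> E d g \<and> E e g))))))"

definition bounded_trans :: "nat \<Rightarrow> (nat \<Rightarrow> bool) \<Rightarrow> (nat \<Rightarrow> nat \<Rightarrow> bool) \<Rightarrow> bool" where
  "bounded_trans n U E \<longleftrightarrow>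
     (\<forall>a<n. \<forall>b<n. \<forall>c<n. U a \<and> U b \<and> U c \<and> E a b \<and> E b c \<longrightarrow> E a c)"

definition below_rel :: "nat \<Rightarrow> (nat \<Rightarrow> nat \<Rightarrow> bool) \<Rightarrow> nat rel" where
  "below_rel n E = {(i, j). i < n \<and> j < n \<and> E i j}"

lemma tournament_below_rel: "tournament {..<n} (below_rel n E) \<longleftrightarrow> bounded_tournament n E"
  by (auto simp: tournament_def below_rel_def bounded_tournament_def irrefl_def)

lemma ex_snake_iff:
  "(\<exists>v. (\<forall>i\<in>snake7_verts. v i < n) \<and> (\<forall>i j. (i, j) \<in> snake7_arcs \<longrightarrow> E (v i) (v j))) \<longleftrightarrow>
    bounded_snake n E"
proof
  assume "\<exists>v. (\<forall>i\<in>snake7_verts. v i < n) \<and> (\<forall>i j. (i, j) \<in> snake7_arcs \<longrightarrow> E (v i) (v j))"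
  then obtain v where v: "\<And>i. i \<in> snake7_verts \<Longrightarrow> v i < n"
    "\<And>i j. (i, j) \<in> snake7_arcs \<Longrightarrow> E (v i) (v j)" by blast
  have n: "v i < n" if "1 \<le> i \<and> i \<le> 7" for i using that by (intro v) (simp add: snake7_verts_def)
  have E: "E (v i) (v j)" if "1 \<le> i \<and> i \<le> 7 \<and> 1 \<le> j \<and> j \<le> 7 \<and> (i = j + 1 \<or> i + 2 \<le> j)" for i j
    using that by (intro v) (auto simp: snake7_arcs_def)
  show "bounded_snake n E"
    unfolding bounded_snake_def
    apply (rule exI[of _ "v 1"], rule conjI, simp add: n)
    apply (rule exI[of _ "v 2"], rule conjI, simp add: n, rule conjI, simp add: E)
    apply (rule exI[of _ "v 3"], rule conjI, simp add: n, intro conjI, (simp add: E)+)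
    apply (rule exI[of _ "v 4"], rule conjI, simp add: n, intro conjI, (simp add: E)+)
    apply (rule exI[of _ "v 5"], rule conjI, simp add: n, intro conjI, (simp add: E)+)
    apply (rule exI[of _ "v 6"], rule conjI, simp add: n, intro conjI, (simp add: E)+)
    apply (rule exI[of _ "v 7"], rule conjI, simp add: n, intro conjI, (simp add: E)+)
    done
next
  assume "bounded_snake n E"
  then show "\<exists>v. (\<forall>i\<in>snake7_verts. v i < n) \<and> (\<forall>i j. (i, j) \<in> snake7_arcs \<longrightarrow> E (v i) (v j))"
    unfolding bounded_snake_def
  proof (elim exE conjE, goal_cases)
    case (1 a b c d e f g)
    note facts = 1
    define vs where "vs = [a, b, c, d, e, f, g]"
    have "\<forall>i<7. vs ! i < n"
      by (simp add: vs_def numeral_eq_Suc All_less_Suc facts)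
    then have "vs ! (i - 1) < n" if "i \<in> snake7_verts" for i
      using that by (auto simp: snake7_verts_def)
    moreover have "\<forall>i<7. \<forall>j<7. (i = j + 1 \<or> i + 2 \<le> j) \<longrightarrow> E (vs ! i) (vs ! j)"
      by (simp add: vs_def numeral_eq_Suc All_less_Suc facts)
    then have "E (vs ! (i - 1)) (vs ! (j - 1))" if "(i, j) \<in> snake7_arcs" for i j
    proof -
      have "i - 1 < 7" "j - 1 < 7" "i - 1 = (j - 1) + 1 \<or> (i - 1) + 2 \<le> j - 1"
        using that by (auto simp: snake7_arcs_def)
      then show ?thesis using \<open>\<forall>i<7. \<forall>j<7. (i = j + 1 \<or> i + 2 \<le> j) \<longrightarrow> E (vs ! i) (vs ! j)\<close> by blast
    qed
    ultimately show ?case by (intro exI[of _ "\<lambda>i. vs ! (i - 1)"]) blast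
  qed
qed

text \<open>Finding the arcs of a snake suffices: any two of its vertices are joined, so the absence
  of loops gives injectivity and asymmetry excludes further arcs.\<close>

lemma snake7_free_below_rel:
  assumes E: "tournament {..<n} (below_rel n E)"
  shows "snake7_free {..<n} (below_rel n E) \<longleftrightarrow> \<not> bounded_snake n E"
proof -
  let ?E = "below_rel n E"
  have snake: "(i, j) \<in> snake7_arcs \<or> (j, i) \<in> snake7_arcs" if "i \<in> snake7_verts" "j \<in> snake7_verts" "i \<noteq> j" for i j
    using tournament_snake7 that unfolding tournament_def by blast
  have sub: "i \<in> snake7_verts \<and> j \<in> snake7_verts" if "(i, j) \<in> snake7_arcs" for i j
    using tournament_snake7 that unfolding tournament_def by blast
  have "(\<exists>S\<subseteq>{..<n}. digraph_isomorphic S (induced ?E S) snake7_verts snake7_arcs) \<longleftrightarrow>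
    (\<exists>v. (\<forall>i\<in>snake7_verts. v i < n) \<and> (\<forall>i j. (i, j) \<in> snake7_arcs \<longrightarrow> E (v i) (v j)))"
  proof
    assume "\<exists>S\<subseteq>{..<n}. digraph_isomorphic S (induced ?E S) snake7_verts snake7_arcs"
    then obtain S f where S: "S \<subseteq> {..<n}" and f: "bij_betw f S snake7_verts"
      "\<And>u v. u \<in> S \<Longrightarrow> v \<in> S \<Longrightarrow> (u, v) \<in> induced ?E S \<longleftrightarrow> (f u, f v) \<in> snake7_arcs"
      unfolding digraph_isomorphic_def by blast
    define v where "v = inv_into S f"
    have v: "v i \<in> S" "f (v i) = i" if "i \<in> snake7_verts" for i
      using f(1) that by (auto simp: v_def bij_betw_def inv_into_into f_inv_into_f)
    have "E (v i) (v j)" if ij: "(i, j) \<in> snake7_arcs" for i j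
    proof -
      have "(v i, v j) \<in> induced ?E S" using f(2)[of "v i" "v j"] v sub[OF ij] ij by simp
      then show ?thesis by (simp add: induced_def below_rel_def)
    qed
    then show "\<exists>v. (\<forall>i\<in>snake7_verts. v i < n) \<and> (\<forall>i j. (i, j) \<in> snake7_arcs \<longrightarrow> E (v i) (v j))"
      using v(1) S by blast
  next
    assume "\<exists>v. (\<forall>i\<in>snake7_verts. v i < n) \<and> (\<forall>i j. (i, j) \<in> snake7_arcs \<longrightarrow> E (v i) (v j))"
    then obtain v where v: "\<And>i. i \<in> snake7_verts \<Longrightarrow> v i < n"
      "\<And>i j. (i, j) \<in> snake7_arcs \<Longrightarrow> E (v i) (v j)" by blast
    have arc: "(v i, v j) \<in> ?E" if "(i, j) \<in> snake7_arcs" for i j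
      using v(1) v(2)[OF that] sub[OF that] by (simp add: below_rel_def)
    have irr: "(p, p) \<notin> ?E" for p using E by (auto simp: tournament_def irrefl_def)
    have asym: "(q, p) \<notin> ?E" if "(p, q) \<in> ?E" for p q
    proof -
      have "p \<in> {..<n}" "q \<in> {..<n}" "p \<noteq> q" using that irr by (auto simp: below_rel_def)
      then show ?thesis using E that unfolding tournament_def by blast
    qed
    have inj: "inj_on v snake7_verts"
      by (rule inj_onI) (metis snake arc irr)
    define S where "S = v ` snake7_verts"
    define f where "f = inv_into snake7_verts v"
    have f: "bij_betw f S snake7_verts"
      unfolding f_def S_def by (intro bij_betw_inv_into inj_on_imp_bij_betw inj)
    have fv: "f (v i) = i" if "i \<in> snake7_verts" for i using that inj by (simp add: f_def)
    have "(v i, v j) \<in> induced ?E S \<longleftrightarrow> (i, j) \<in> snake7_arcs"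
      if ij: "i \<in> snake7_verts" "j \<in> snake7_verts" for i j
    proof
      assume "(v i, v j) \<in> induced ?E S"
      then have "(v i, v j) \<in> ?E" by (simp add: induced_def)
      moreover from this have "i \<noteq> j" using irr by auto
      ultimately show "(i, j) \<in> snake7_arcs" using snake[OF ij] arc asym by blast
    qed (use arc ij in \<open>auto simp: induced_def S_def\<close>)
    then have "digraph_isomorphic S (induced ?E S) snake7_verts snake7_arcs"
      unfolding digraph_isomorphic_def using f fv by (intro exI[of _ f]) (auto simp: S_def)
    moreover have "S \<subseteq> {..<n}" using v(1) by (auto simp: S_def)
    ultimately show "\<exists>S\<subseteq>{..<n}. digraph_isomorphic S (induced ?E S) snake7_verts snake7_arcs" by blast
  qed
  then show ?thesis unfolding snake7_free_def ex_snake_iff by simp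
qed

section \<open>The check of an instance together with its certificate\<close>

lemma instance_bit_cong:
  assumes "\<And>i j. i < n \<Longrightarrow> j < n \<Longrightarrow> E i j = E' i j"
  shows "instance_bit n E k p = instance_bit n E' k p"
proof (cases "n < p \<and> p < n + 1 + n * n")
  case True
  then have "p - (n + 1) < n * n" "0 < n" by (auto intro: gr0I)
  then have "(p - (n + 1)) div n < n" "(p - (n + 1)) mod n < n" by (simp_all add: less_mult_imp_div_less)
  then show ?thesis using assms by (simp add: instance_bit_def)
qed (auto simp: instance_bit_def)

text \<open>\<open>X\<close> and \<open>U\<close> are the bit strings of the instance and of the certificate, \<open>s\<close> and \<open>l\<close> their
  lengths; the certificate is the characteristic vector of the independent set.\<close>

definition matrix_entry :: "(nat \<Rightarrow> bool) \<Rightarrow> nat \<Rightarrow> nat \<Rightarrow> nat \<Rightarrow> bool" where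
  "matrix_entry X n i j \<longleftrightarrow> X (n + 1 + (i * n + j))"

definition verify :: "(nat \<Rightarrow> bool) \<Rightarrow> nat \<Rightarrow> (nat \<Rightarrow> bool) \<Rightarrow> nat \<Rightarrow> bool" where
  "verify X s U l \<longleftrightarrow> (\<exists>n<s + 1. \<exists>k<n + 1. 1 \<le> k \<and> s = instance_length n k \<and> l = n \<and>
     (\<forall>p<s. X p \<longleftrightarrow> instance_bit n (matrix_entry X n) k p) \<and>
     bounded_tournament n (matrix_entry X n) \<and> \<not> bounded_snake n (matrix_entry X n) \<and>
     bounded_trans n U (matrix_entry X n) \<and> k \<le> (\<Sum>i<n. of_bool (U i)))"

text \<open>The threshold is coded in binary and could be exponential in the length, out of reach of
  unary counters. In a yes-instance it is at most n, so the search in \<open>verify\<close> for k up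
  to n misses nothing. The matrix is read from the string itself, so comparing bits really tests the
  prefix and the binary part.\<close>

lemma verify_iff:
  "x \<in> MISP_snake7_free \<longleftrightarrow> (\<exists>u. length u \<le> length x \<and> verify ((!) x) (length x) ((!) u) (length u))"
proof
  assume "x \<in> MISP_snake7_free"
  then obtain n E k S where x: "x = encode_instance n E k" and E: "tournament {..<n} E" "snake7_free {..<n} E"
    and k: "1 \<le> k" and S: "independent_set {..<n} E S" "k \<le> card S"
    by (auto simp: MISP_snake7_free_def)
  have S': "S \<subseteq> {..<n}" "trans (induced E S)" using S(1) by (auto simp: independent_set_def)
  have kn: "k \<le> n" using S(2) card_mono[OF _ S'(1)] by simp
  have len: "length x = instance_length n k" by (simp add: x encode_instance_eq)
  have entry: "matrix_entry ((!) x) n i j \<longleftrightarrow> (i, j) \<in> E" if "i < n" "j < n" for i j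
  proof -
    have l: "i * n + j < n * n" using that by (rule pair_code_less)
    then have "n + 1 + (i * n + j) < instance_length n k" by (simp add: instance_length_def)
    then show ?thesis
      using that l unfolding matrix_entry_def x encode_instance_eq
      by (simp add: instance_bit_def del: upt_Suc)
  qed
  have EE: "below_rel n (matrix_entry ((!) x) n) = E"
    using entry E(1) by (auto simp: below_rel_def tournament_def)
  have tour: "bounded_tournament n (matrix_entry ((!) x) n)"
    using tournament_below_rel[of n "matrix_entry ((!) x) n"] E(1) by (simp add: EE)
  have free: "\<not> bounded_snake n (matrix_entry ((!) x) n)"
    using snake7_free_below_rel[of n "matrix_entry ((!) x) n"] E by (simp add: EE)
  define u where "u = map (\<lambda>i. i \<in> S) [0..<n]"
  have u: "length u = n" "\<And>i. i < n \<Longrightarrow> u ! i \<longleftrightarrow> i \<in> S" by (simp_all add: u_def)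
  have "bounded_trans n ((!) u) (matrix_entry ((!) x) n)"
    unfolding bounded_trans_def
  proof (intro allI impI)
    fix a b c assume abc: "a < n" "b < n" "c < n"
      "u ! a \<and> u ! b \<and> u ! c \<and> matrix_entry ((!) x) n a b \<and> matrix_entry ((!) x) n b c"
    then have "(a, b) \<in> induced E S" "(b, c) \<in> induced E S" using u entry by (auto simp: induced_def)
    then have "(a, c) \<in> induced E S" using S'(2) by (rule transD[rotated])
    then show "matrix_entry ((!) x) n a c" using entry abc by (simp add: induced_def)
  qed
  moreover have "(\<Sum>i<n. of_bool (u ! i)) = card S"
  proof -
    have "(\<Sum>i<n. of_bool (u ! i)) = (\<Sum>i<n. of_bool (i \<in> S) :: nat)" by (rule sum.cong) (auto simp: u)
    also have "\<dots> = card S" using S'(1) by (simp add: Int_absorb1)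
    finally show ?thesis .
  qed
  moreover have "x ! p \<longleftrightarrow> instance_bit n (matrix_entry ((!) x) n) k p" if "p < length x" for p
  proof -
    have "x ! p \<longleftrightarrow> instance_bit n (\<lambda>i j. (i, j) \<in> E) k p" using that by (simp add: x encode_instance_eq)
    also have "\<dots> \<longleftrightarrow> instance_bit n (matrix_entry ((!) x) n) k p"
      by (rule instance_bit_cong) (simp add: entry)
    finally show ?thesis .
  qed
  moreover have "n < length x + 1" by (simp add: len instance_length_def)
  ultimately have "verify ((!) x) (length x) ((!) u) (length u)"
    unfolding verify_def using k kn len tour free S(2) u(1)
    by (intro exI[of _ n] exI[of _ k] conjI) auto
  moreover have "length u \<le> length x" by (simp add: u(1) len instance_length_def)
  ultimately show "\<exists>u. length u \<le> length x \<and> verify ((!) x) (length x) ((!) u) (length u)" by blast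
next
  assume "\<exists>u. length u \<le> length x \<and> verify ((!) x) (length x) ((!) u) (length u)"
  then obtain u n k where k: "1 \<le> k" and len: "length x = instance_length n k" and u: "length u = n"
    and x: "\<And>p. p < length x \<Longrightarrow> x ! p \<longleftrightarrow> instance_bit n (matrix_entry ((!) x) n) k p"
    and E: "bounded_tournament n (matrix_entry ((!) x) n)" "\<not> bounded_snake n (matrix_entry ((!) x) n)"
    and S: "bounded_trans n ((!) u) (matrix_entry ((!) x) n)" "k \<le> (\<Sum>i<n. of_bool (u ! i))"
    unfolding verify_def by blast
  define E' where "E' = below_rel n (matrix_entry ((!) x) n)"
  have tour: "tournament {..<n} E'" using E(1) by (simp add: E'_def tournament_below_rel)
  moreover have "snake7_free {..<n} E'"
    using E(2) snake7_free_below_rel[OF tour[unfolded E'_def]] by (simp add: E'_def)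
  moreover have "x = encode_instance n E' k"
  proof (rule nth_equalityI)
    show "length x = length (encode_instance n E' k)" by (simp add: encode_instance_eq len)
    fix p assume p: "p < length x"
    have "instance_bit n (matrix_entry ((!) x) n) k p = instance_bit n (\<lambda>i j. (i, j) \<in> E') k p"
      by (rule instance_bit_cong) (simp add: E'_def below_rel_def)
    then show "x ! p = encode_instance n E' k ! p" using x[OF p] p len by (simp add: encode_instance_eq)
  qed
  moreover have "independent_set {..<n} E' {i. i < n \<and> u ! i}"
    using S(1) by (auto simp: independent_set_def trans_def induced_def E'_def below_rel_def bounded_trans_def)
  moreover have "k \<le> card {i. i < n \<and> u ! i}"
  proof -
    have "(\<Sum>i<n. of_bool (u ! i) :: nat) = card {i. i < n \<and> u ! i}"
      by (simp add: Int_def lessThan_def)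
    then show ?thesis using S(2) by simp
  qed
  ultimately show "x \<in> MISP_snake7_free" using k unfolding MISP_snake7_free_def by blast
qed

lemma bounded_cong:
  assumes E: "\<And>i j. i < n \<Longrightarrow> j < n \<Longrightarrow> E i j = E' i j" and U: "\<And>i. i < n \<Longrightarrow> U i = U' i"
  shows "bounded_tournament n E = bounded_tournament n E'" "bounded_snake n E = bounded_snake n E'"
    "bounded_trans n U E = bounded_trans n U' E'"
proof -
  show "bounded_tournament n E = bounded_tournament n E'"
    using E by (simp add: bounded_tournament_def)
  show "bounded_trans n U E = bounded_trans n U' E'"
    using E U by (simp add: bounded_trans_def)
  have "i \<in> snake7_verts \<and> j \<in> snake7_verts" if "(i, j) \<in> snake7_arcs" for i j
    using tournament_snake7 that unfolding tournament_def by blast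
  then show "bounded_snake n E = bounded_snake n E'"
    unfolding ex_snake_iff[symmetric] using E by (intro ex_cong1 conj_cong refl) meson
qed

lemma verify_mono:
  assumes X: "\<And>p. p < s \<Longrightarrow> X p = X' p" and U: "\<And>p. p < l \<Longrightarrow> U p = U' p" and v: "verify X s U l"
  shows "verify X' s U' l"
proof -
  obtain n k where nk: "n < s + 1" "k < n + 1" "1 \<le> k" "s = instance_length n k" "l = n"
    and x: "\<forall>p<s. X p \<longleftrightarrow> instance_bit n (matrix_entry X n) k p"
    and E: "bounded_tournament n (matrix_entry X n)" "\<not> bounded_snake n (matrix_entry X n)"
      "bounded_trans n U (matrix_entry X n)" "k \<le> (\<Sum>i<n. of_bool (U i))"
    using v unfolding verify_def by blast
  have e: "matrix_entry X n i j = matrix_entry X' n i j" if "i < n" "j < n" for i j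
  proof -
    have "n + 1 + (i * n + j) < s" using pair_code_less[OF that] by (simp add: nk(4) instance_length_def)
    then show ?thesis unfolding matrix_entry_def by (rule X)
  qed
  have "(\<Sum>i<n. of_bool (U i) :: nat) = (\<Sum>i<n. of_bool (U' i))" by (rule sum.cong) (use U nk(5) in auto)
  moreover note bounded_cong[of n "matrix_entry X n" "matrix_entry X' n" U U', OF e]
  moreover have "\<forall>p<s. X' p \<longleftrightarrow> instance_bit n (matrix_entry X' n) k p"
    using x X instance_bit_cong[of n "matrix_entry X n" "matrix_entry X' n", OF e] by simp
  ultimately show ?thesis
    unfolding verify_def using nk E U by (intro exI[of _ n] exI[of _ k] conjI) simp_all
qed

text \<open>Beyond the two strings, list indexing is unspecified while the machine sees a separator,
  other bits or blanks; the result must not depend on them.\<close>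

lemma verify_cong:
  assumes "\<And>p. p < s \<Longrightarrow> X p = X' p" "\<And>p. p < l \<Longrightarrow> U p = U' p"
  shows "verify X s U l \<longleftrightarrow> verify X' s U' l"
proof
  show "verify X' s U' l" if "verify X s U l" by (rule verify_mono[OF assms that])
  show "verify X s U l" if "verify X' s U' l"
    by (rule verify_mono[OF assms(1)[symmetric] assms(2)[symmetric] that])
qed

lemma pf_bounded:
  assumes E: "pf 3 (\<lambda>w e. of_bool (E w (e 0) (e 1) (e 2)))"
    and U: "pf 2 (\<lambda>w e. of_bool (U w (e 0) (e 1)))"
  shows "pf 1 (\<lambda>w e. of_bool (bounded_tournament (e 0) (E w (e 0))))"
    and "pf 1 (\<lambda>w e. of_bool (bounded_snake (e 0) (E w (e 0))))"
    and "pf 2 (\<lambda>w e. of_bool (bounded_trans (e 0) (U w (e 1)) (E w (e 0))))"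
    and "pf 3 (\<lambda>w e. of_bool (instance_bit (e 0) (E w (e 0)) (e 1) (e 2)))"
proof -
  note E3 = pf_comp3[where h = "\<lambda>w i j k. of_bool (E w i j k)", OF E]
  note U2 = pf_comp2[where h = "\<lambda>w i j. of_bool (U w i j)", OF U]
  show "pf 1 (\<lambda>w e. of_bool (bounded_tournament (e 0) (E w (e 0))))"
    unfolding bounded_tournament_def by (intro pf_rules E3) simp_all
  show "pf 1 (\<lambda>w e. of_bool (bounded_snake (e 0) (E w (e 0))))"
    unfolding bounded_snake_def by (intro pf_ex pf_conj pf.var E3) simp_all
  show "pf 2 (\<lambda>w e. of_bool (bounded_trans (e 0) (U w (e 1)) (E w (e 0))))"
    unfolding bounded_trans_def by (intro pf_rules E3 U2) simp_all
  show "pf 3 (\<lambda>w e. of_bool (instance_bit (e 0) (E w (e 0)) (e 1) (e 2)))"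
    unfolding instance_bit_def by (intro pf_rules E3) simp_all
qed

text \<open>Variable 0 is the position of the separator and thus the length of the instance; the
  certificate starts one position behind it.\<close>

lemma pf_verify:
  assumes X: "pf 1 (\<lambda>w e. of_bool (X w (e 0)))"
  shows "pf 1 (\<lambda>w e. of_bool (verify (X w) (e 0) (\<lambda>i. X w (e 0 + 1 + i)) (length w - (e 0 + 1))))"
proof -
  note X1 = pf_comp1[where h = "\<lambda>w i. of_bool (X w i)", OF X]
  have E: "pf 3 (\<lambda>w e. of_bool (matrix_entry (X w) (e 0) (e 1) (e 2)))"
    unfolding matrix_entry_def by (intro pf_rules X1) simp_all
  have U: "pf 2 (\<lambda>w e. of_bool (X w (e 0 + 1 + e 1)))"
    by (intro pf_rules X1) simp_all
  note b = pf_bounded[of "\<lambda>w. matrix_entry (X w)" "\<lambda>w s i. X w (s + 1 + i)", OF E U]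
  note b' = pf_comp1[where h = "\<lambda>w i. of_bool (bounded_tournament i (matrix_entry (X w) i))", OF b(1)]
    pf_comp1[where h = "\<lambda>w i. of_bool (bounded_snake i (matrix_entry (X w) i))", OF b(2)]
    pf_comp2[where h = "\<lambda>w i j. of_bool (bounded_trans i (\<lambda>l. X w (j + 1 + l)) (matrix_entry (X w) i))", OF b(3)]
    pf_comp3[where h = "\<lambda>w i j k. of_bool (instance_bit i (matrix_entry (X w) i) j k)", OF b(4)]
  show ?thesis
    unfolding verify_def instance_length_def by (intro pf_rules b' X1) simp_all
qed

theorem MISP_snake7_free_in_NP: "MISP_snake7_free \<in> NP"
proof -
  define X where "X w i \<longleftrightarrow> contents w (int i) = 2" for w and i :: nat
  define R where "R = {(x, u). verify ((!) x) (length x) ((!) u) (length u)}"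
  define g where "g w (i :: nat) \<longleftrightarrow> (\<exists>s<length w. contents w (int s) = 3 \<and>
      verify (X w) s (\<lambda>i. X w (s + 1 + i)) (length w - (s + 1)))" for w i
  have "pf 1 (\<lambda>w e. of_bool (X w (e 0)))" unfolding X_def by (intro pf_rules) simp
  note verify1 = pf_comp1[where h = "\<lambda>w s. of_bool (verify (X w) s (\<lambda>i. X w (s + 1 + i)) (length w - (s + 1)))",
      OF pf_verify[OF this]]
  have "poly_time_decidable_rel R"
    unfolding poly_time_decidable_rel_def
  proof (rule poly_timeI)
    show "pf 0 (\<lambda>w e. 1)" by (rule pf_one)
    show "pf 1 (\<lambda>w e. of_bool (g w (e 0)))"
      unfolding g_def by (intro pf_ex pf_conj pf.len pf.sym pf.var verify1) simp_all
    show "0 \<notin> set (case a of (x, u) \<Rightarrow> bits x @ [3] @ bits u)" for a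
      by (cases a) (auto simp: bits_def)
    fix a :: "bool list \<times> bool list"
    obtain x u where a: "a = (x, u)" by (cases a)
    let ?w = "bits x @ [3] @ bits u"
    have lx: "length (bits x) = length x" for x by (simp add: bits_def)
    have sep: "contents ?w (int s) = 3 \<longleftrightarrow> s = length x" for s
      by (auto simp: contents_def nth_append nth_Cons' bits_def)
    have x: "X ?w p = x ! p" if "p < length x" for p
      using that by (auto simp: X_def contents_def nth_append bits_def)
    have c: "contents v (int k) = (if k < length v then v ! k else 0)" for v k
      by (simp add: contents_def)
    have u: "X ?w (length x + 1 + i) = u ! i" if "i < length u" for i
      using that unfolding X_def c by (simp add: nth_append bits_def)
    have "g ?w 0 \<longleftrightarrow> verify (X ?w) (length x) (\<lambda>i. X ?w (length x + 1 + i)) (length u)"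
      unfolding g_def sep by (simp add: lx)
    also have "\<dots> \<longleftrightarrow> (x, u) \<in> R" unfolding R_def using verify_cong[OF x u] by simp
    finally show "(case a of (x, u) \<Rightarrow> bits [(x, u) \<in> R]) =
        bits (map (g (case a of (x, u) \<Rightarrow> bits x @ [3] @ bits u)) [0..<1])"
      by (simp add: a)
  qed
  moreover have "x \<in> MISP_snake7_free \<longleftrightarrow> (\<exists>u. length u \<le> poly [:0, 1:] (length x) \<and> (x, u) \<in> R)" for x
    using verify_iff[of x] by (simp add: R_def)
  ultimately show ?thesis unfolding NP_def by blast
qed

theorem theorem3p2p3:
  shows "NP_complete MISP_snake7_free"
  using MISP_snake7_free_in_NP MISP_snake7_free_hard by (simp add: NP_complete_def)

end
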